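(* Let $n\ge 1$, $s\in(0,\frac12)$, let $\Omega\subset\mathbb{R}^n$ be a bounded Lipschitz domain, $W$ a double-well potential with minima at $\pm1$, and $g:\mathbb{R}^n\to[-1,1]$ continuous. With $X_g$, $\mathcal{F}_\varepsilon^{(1)}$, $\mathcal{F}_\varepsilon^{(2)}$, $m_1$ and $\mathcal{U}_1$ as defined in the context, suppose $m_1\neq 0$ and let $\bar u\in\mathcal{U}_1$ be such that $\bar u|_\Omega=\chi_E-\chi_{E^c}$ for some measurable set $E\subset\mathbb{R}^n$. Assume that at least one of the following holds: (I.1) there exist $x_0\in\partial E$ and $r>0$ such that $B_r(x_0)\Subset\Omega$ and $\partial E\cap B_r(x_0)$ is a $C^{1,\alpha}$ surface; (I.2) there exists a connected component $\Omega'$ of $\Omega$ such that neither $g\equiv 1$ on $\partial\Omega'$ nor $g\equiv-1$ on $\partial\Omega'$. Then there exists a sequence $v_\varepsilon\in X_g$ such that $v_\varepsilon\to\bar u$ as $\varepsilon\searrow0$ and, for any $\mu>1-2s$, $$\lim_{\varepsilon\searrow0}\frac{\mathcal{F}_\varepsilon^{(1)}(v_\varepsilon)-m_1}{\varepsilon^\mu}=-\infty.$$ In particular, $$\lim_{\varepsilon\searrow0}\mathcal{F}_\varepsilon^{(2)}(v_\varepsilon)=-\infty.$$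
   Context: Notation: $A^c=\mathbb{R}^n\setminus A$; $\chi_A$ is the indicator function of $A$; $B_r(x)$ is the open ball. $\Omega$ is open and not necessarily connected. $W$ is continuous on $[-1,1]$, with $W(\pm1)=0$ and $W>0$ in $(-1,1)$. $X_g$ is the set of measurable functions $u:\mathbb{R}^n\to[-1,1]$ with $u=g$ in $\mathbb{R}^n\setminus\Omega$. Convergence in $X_g$ is with respect to the metric of $L^1(\Omega)$. Let $Q_\Omega:=(\mathbb{R}^n\times\mathbb{R}^n)\setminus(\Omega^c\times\Omega^c)$ and $u(Q_\Omega):=\iint_{Q_\Omega}\frac{|u(x)-u(y)|^2}{|x-y|^{n+2s}}\,dx\,dy$. For $\varepsilon>0$ and $u\in X_g$, $$\mathcal{F}_\varepsilon(u):=\varepsilon\,u(Q_\Omega)+\varepsilon^{1-2s}\int_\Omega W(u(x))\,dx,\qquad \mathcal{F}^{(1)}_\varepsilon(u):=\frac{\mathcal{F}_\varepsilon(u)}{\varepsilon}=u(Q_\Omega)+\frac{1}{\varepsilon^{2s}}\int_\Omega W(u(x))\,dx,$$ $$\mathcal{F}^{(2)}_\varepsilon(u):=\frac{\mathcal{F}^{(1)}_\varepsilon(u)-m_1}{\varepsilon}.$$ Define $\mathcal{F}^{(1)}:X_g\to[0,+\infty]$ by $$\mathcal{F}^{(1)}(u)=\iint_{\Omega\times\Omega}\frac{|u(x)-u(y)|^2}{|x-y|^{n+2s}}\,dx\,dy+2\iint_{\Omega\times\Omega^c}\frac{|u(x)-g(y)|^2}{|x-y|^{n+2s}}\,dx\,dy$$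 if $u|_\Omega=\chi_E-\chi_{E^c}$ for some measurable $E\subset\mathbb{R}^n$, and $\mathcal{F}^{(1)}(u)=+\infty$ otherwise. Set $m_1:=\inf_{X_g}\mathcal{F}^{(1)}$ and $\mathcal{U}_1:=\{u\in X_g:\mathcal{F}^{(1)}(u)=m_1\}$ (the minimizers of $\mathcal{F}^{(1)}$). Convention: sets are considered up to modification on null sets, and one always chooses the representative with the smallest possible topological boundary, so that $\partial E=\{x: 0<|E\cap B_\rho(x)|<|B_\rho(x)| \text{ for all }\rho>0\}$. *)

theory Defs
  imports "HOL-Analysis.Analysis"
begin

text \<open>
  Throughout, \<open>'a\<close> is the ambient space $\mathbb{R}^n$ and \<open>n = DIM('a)\<close>. Energies are
  \<open>ennreal\<close>-valued (they may be infinite); differences of energies are taken in \<open>ereal\<close>.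
\<close>

subsection \<open>Regularity of boundaries\<close>

text \<open>Orthogonal projection onto the hyperplane through the origin with unit normal \<open>e\<close>.\<close>

definition hyp_proj :: "'a::euclidean_space \<Rightarrow> 'a \<Rightarrow> 'a" where
  "hyp_proj e x = x - (x \<bullet> e) *\<^sub>R e"

text \<open>
  Near each boundary point, the set is the strict epigraph, in some direction \<open>e\<close>, of a Lipschitz
  function on the hyperplane orthogonal to \<open>e\<close>. Connectedness is not required. In dimension one
  the hyperplane is a point.
\<close>

definition lipschitz_domain :: "'a::euclidean_space set \<Rightarrow> bool" where
  "lipschitz_domain \<Omega> \<longleftrightarrow> open \<Omega> \<and>
     (\<forall>p\<in>frontier \<Omega>. \<exists>\<rho>>0. \<exists>e \<phi> L. norm e = 1 \<and> L-lipschitz_on {y. y \<bullet> e = 0} \<phi> \<and>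
        \<Omega> \<inter> ball p \<rho> = {x \<in> ball p \<rho>. \<phi> (hyp_proj e x) < x \<bullet> e})"

definition C1_holder_on :: "real \<Rightarrow> 'a::euclidean_space set \<Rightarrow> ('a \<Rightarrow> real) \<Rightarrow> bool" where
  "C1_holder_on \<alpha> U \<phi> \<longleftrightarrow>
     (\<exists>G C. (\<forall>y\<in>U. (\<phi> has_derivative (\<lambda>h. G y \<bullet> h)) (at y)) \<and>
            (\<forall>y\<in>U. \<forall>z\<in>U. norm (G y - G z) \<le> C * norm (y - z) powr \<alpha>))"

text \<open>
  A hypersurface that is locally a $C^{1,\alpha}$ graph. Only the values of \<open>\<phi>\<close> on the hyperplane
  orthogonal to \<open>e\<close> matter; asking for regularity on a full ball is no restriction, since a function
  on the hyperplane extends constantly in direction \<open>e\<close>.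
\<close>

definition C1_holder_surface :: "real \<Rightarrow> 'a::euclidean_space set \<Rightarrow> bool" where
  "C1_holder_surface \<alpha> S \<longleftrightarrow>
     (\<forall>p\<in>S. \<exists>\<rho>>0. \<exists>e \<phi>. norm e = 1 \<and> C1_holder_on \<alpha> (ball (hyp_proj e p) \<rho>) \<phi> \<and>
        S \<inter> ball p \<rho> = {x \<in> ball p \<rho>. x \<bullet> e = \<phi> (hyp_proj e x)})"

text \<open>
  The topological boundary of the representative of \<open>E\<close>, modulo null sets, whose boundary is
  smallest.
\<close>

definition ess_boundary :: "'a::euclidean_space set \<Rightarrow> 'a set" where
  "ess_boundary E = {x. \<forall>\<rho>>0. 0 < emeasure lebesgue (E \<inter> ball x \<rho>) \<and>
                       emeasure lebesgue (E \<inter> ball x \<rho>) < emeasure lebesgue (ball x \<rho>)}"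

subsection \<open>The function space and the energies\<close>

definition double_well :: "(real \<Rightarrow> real) \<Rightarrow> bool" where
  "double_well W \<longleftrightarrow> continuous_on {-1..1} W \<and> W (-1) = 0 \<and> W 1 = 0 \<and> (\<forall>t\<in>{-1<..<1}. 0 < W t)"

definition X_space :: "'a::euclidean_space set \<Rightarrow> ('a \<Rightarrow> real) \<Rightarrow> ('a \<Rightarrow> real) set" where
  "X_space \<Omega> g = {u \<in> borel_measurable lebesgue. range u \<subseteq> {-1..1} \<and> (\<forall>x\<in>-\<Omega>. u x = g x)}"

definition L1_dist :: "'a::euclidean_space set \<Rightarrow> ('a \<Rightarrow> real) \<Rightarrow> ('a \<Rightarrow> real) \<Rightarrow> real" where
  "L1_dist \<Omega> u v = set_lebesgue_integral lebesgue \<Omega> (\<lambda>x. \<bar>u x - v x\<bar>)"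

text \<open>
  $\iint_A |u(x)-w(y)|^2 |x-y|^{-n-2s}\,dx\,dy$. The integrand takes the value \<open>0\<close> on the
  diagonal, a null set.
\<close>

definition interaction ::
    "real \<Rightarrow> ('a \<times> 'a) set \<Rightarrow> ('a::euclidean_space \<Rightarrow> real) \<Rightarrow> ('a \<Rightarrow> real) \<Rightarrow> ennreal" where
  "interaction s A u w =
     (\<integral>\<^sup>+z\<in>A. ennreal (\<bar>u (fst z) - w (snd z)\<bar>\<^sup>2 / norm (fst z - snd z) powr (real DIM('a) + 2 * s))
        \<partial>(lebesgue \<Otimes>\<^sub>M lebesgue))"

definition Q_set :: "'a set \<Rightarrow> ('a \<times> 'a) set" where
  "Q_set \<Omega> = UNIV \<times> UNIV - (-\<Omega>) \<times> (-\<Omega>)"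

definition F_eps :: "real \<Rightarrow> 'a::euclidean_space set \<Rightarrow> (real \<Rightarrow> real) \<Rightarrow> real \<Rightarrow> ('a \<Rightarrow> real) \<Rightarrow> ennreal" where
  "F_eps s \<Omega> W \<epsilon> u = ennreal \<epsilon> * interaction s (Q_set \<Omega>) u u
     + ennreal (\<epsilon> powr (1 - 2 * s)) * (\<integral>\<^sup>+x\<in>\<Omega>. ennreal (W (u x)) \<partial>lebesgue)"

definition F1_eps :: "real \<Rightarrow> 'a::euclidean_space set \<Rightarrow> (real \<Rightarrow> real) \<Rightarrow> real \<Rightarrow> ('a \<Rightarrow> real) \<Rightarrow> ennreal" where
  "F1_eps s \<Omega> W \<epsilon> u = F_eps s \<Omega> W \<epsilon> u / ennreal \<epsilon>"

lemma F1_eps_eq: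
  assumes "0 < \<epsilon>"
  shows "F1_eps s \<Omega> W \<epsilon> u = interaction s (Q_set \<Omega>) u u
     + ennreal (1 / \<epsilon> powr (2 * s)) * (\<integral>\<^sup>+x\<in>\<Omega>. ennreal (W (u x)) \<partial>lebesgue)"
proof -
  have inv: "inverse (ennreal \<epsilon>) = ennreal (1 / \<epsilon>)"
    using assms by (simp add: inverse_ennreal inverse_eq_divide)
  have "\<epsilon> powr (1 - 2 * s) * (1 / \<epsilon>) = 1 / \<epsilon> powr (2 * s)"
    using assms by (simp add: powr_diff)
  then have a: "ennreal (\<epsilon> powr (1 - 2 * s)) * ennreal (1 / \<epsilon>) = ennreal (1 / \<epsilon> powr (2 * s))"
    using assms by (simp flip: ennreal_mult)
  have b: "ennreal \<epsilon> * ennreal (1 / \<epsilon>) = 1"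
    using assms by (simp flip: ennreal_mult)
  have c: "(e * p + d * q) * i = (e * i) * p + (d * i) * q" for e p d q i :: ennreal
    by (simp add: algebra_simps)
  show ?thesis
    unfolding F1_eps_def F_eps_def divide_ennreal_def inv c a b by simp
qed

text \<open>
  \<open>u = \<chi>\<^sub>E - \<chi>\<^bsub>E\<^sup>c\<^esub>\<close> on \<open>\<Omega>\<close>, up to a null set, as elements of \<open>X_space\<close> are identified when they
  agree almost everywhere.
\<close>

definition is_phase :: "'a::euclidean_space set \<Rightarrow> ('a \<Rightarrow> real) \<Rightarrow> 'a set \<Rightarrow> bool" where
  "is_phase \<Omega> u E \<longleftrightarrow> E \<in> sets lebesgue \<and>
     (AE x in lebesgue. x \<in> \<Omega> \<longrightarrow> u x = indicator E x - indicator (-E) x)"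

definition F1 :: "real \<Rightarrow> 'a::euclidean_space set \<Rightarrow> ('a \<Rightarrow> real) \<Rightarrow> ('a \<Rightarrow> real) \<Rightarrow> ennreal" where
  "F1 s \<Omega> g u =
     (if \<exists>E. is_phase \<Omega> u E
      then interaction s (\<Omega> \<times> \<Omega>) u u + 2 * interaction s (\<Omega> \<times> (-\<Omega>)) u g
      else \<infinity>)"

definition m1 :: "real \<Rightarrow> 'a::euclidean_space set \<Rightarrow> ('a \<Rightarrow> real) \<Rightarrow> ennreal" where
  "m1 s \<Omega> g = (INF u \<in> X_space \<Omega> g. F1 s \<Omega> g u)"

definition U1 :: "real \<Rightarrow> 'a::euclidean_space set \<Rightarrow> ('a \<Rightarrow> real) \<Rightarrow> ('a \<Rightarrow> real) set" where
  "U1 s \<Omega> g = {u \<in> X_space \<Omega> g. F1 s \<Omega> g u = m1 s \<Omega> g}"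

definition F1_excess ::
    "real \<Rightarrow> 'a::euclidean_space set \<Rightarrow> (real \<Rightarrow> real) \<Rightarrow> ('a \<Rightarrow> real) \<Rightarrow> real \<Rightarrow> ('a \<Rightarrow> real) \<Rightarrow> ereal" where
  "F1_excess s \<Omega> W g \<epsilon> u = enn2ereal (F1_eps s \<Omega> W \<epsilon> u) - enn2ereal (m1 s \<Omega> g)"

definition F2_eps ::
    "real \<Rightarrow> 'a::euclidean_space set \<Rightarrow> (real \<Rightarrow> real) \<Rightarrow> ('a \<Rightarrow> real) \<Rightarrow> real \<Rightarrow> ('a \<Rightarrow> real) \<Rightarrow> ereal" where
  "F2_eps s \<Omega> W g \<epsilon> u = F1_excess s \<Omega> W g \<epsilon> u / ereal \<epsilon>"

end

theory Submission
  imports Defs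
begin

text \<open>
  Replace the minimizer \<open>u\<close> by \<open>(1 - \<tau> \<psi>) u\<close>, where \<open>\<psi>\<close> is a cutoff at scale \<open>\<delta>\<close> supported in an open
  set \<open>A \<subseteq> \<Omega>\<close>. As \<open>u\<^sup>2 = 1\<close> in \<open>\<Omega>\<close>, the nonlocal energy drops by at least $2\tau H - \tau^2 D$, where
  \<open>H\<close> is the interaction of $\psi(x)(1 - u(x)u(y))$ with the kernel and the seminorm \<open>D\<close> of \<open>\<psi>\<close> is at
  most $C |A| \delta^{-2s}$. If every point of \<open>A\<close> sees, at distance of order \<open>\<delta>\<close>, comparable portions
  of values where $1 - u(x)u(y) \ge c$, then averaging over \<open>A\<close> gives $H \ge c |A| \delta^{-2s}$. For
  \<open>\<tau>\<close> small the gain $c |A| \delta^{-2s}$ beats the potential cost $C |A| \epsilon^{-2s}$ once \<open>\<delta>\<close> is a small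
  multiple of \<open>\<epsilon>\<close>, so the excess is at most $-c |A| \epsilon^{-2s}$. Finiteness of the energy then forces
  \<open>|A|\<close> to be of order $\delta^{2s}$, which yields convergence in $L^1$.

  It remains to find such \<open>A\<close> with $|A| \ge c \delta$. Discrete paths with steps of length \<open>\<delta>\<close> that lead
  from one phase to the other (or from \<open>\<Omega>\<close> to its complement, near a boundary point where the datum
  differs from the phase) must meet \<open>A\<close>, and a set of such paths of positive measure is covered by
  $C/\delta$ translates of \<open>A\<close>.
\<close>

subsection \<open>The kernel\<close>

text \<open>All three terms are proportional to |A|: the gain by averaging over \<open>A\<close>,
  the cutoff seminorm because a translation difference of \<open>\<psi>\<close> lives on
  \<open>A\<close> and one translate of it, the potential because \<open>W\<close> vanishes wherever
  the pure phase is kept. So no upper bound on |A| has to be known in advance, and |A| >= c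
  \<open>\<delta>\<close> with \<open>\<delta>\<close> proportional to \<open>\<epsilon>\<close>
  turns |A| \<open>\<epsilon>\<close>^(-2s) into \<open>\<epsilon>\<close>^(1-2s), the threshold for
  \<open>\<mu>\<close>. The factor \<open>\<tau>\<close> is fixed independently of
  \<open>\<epsilon>\<close>: the gain is linear in it, the seminorm term quadratic.

  The restriction s < 1/2 enters through the finiteness of the integral of min(1,|z|) |z|^(-n-2s).
  This one integral bounds the cutoff seminorm and also the fractional perimeter of
  \<open>\<Omega>\<close>, which makes the minimum finite.

  The competitor has to keep the datum outside \<open>\<Omega>\<close>. Near the boundary
  \<open>A\<close> therefore sits at height of order \<open>\<delta>\<close> inside the domain,
  while the values that it is compared with lie outside; this is why the two portions in
  \<open>mixed_at\<close> have different radii.\<close>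

definition kern :: "real \<Rightarrow> 'a::euclidean_space \<Rightarrow> real" where
  "kern s z = 1 / norm z powr (real DIM('a) + 2 * s)"

lemma ball_in_sets_borel [measurable]: "ball (x::'a::euclidean_space) r \<in> sets borel"
  by simp

lemma kern_nonneg [simp]: "0 \<le> kern s z"
  by (simp add: kern_def)

text \<open>Division by zero and \<open>0 powr p = 0\<close> give the value 0 on the diagonal, as in
  \<open>interaction\<close>. Lower bounds such as \<open>kern_ge\<close> must therefore exclude the
  origin.\<close>

lemma kern_zero [simp]: "kern s 0 = 0"
  by (simp add: kern_def)

lemma kern_minus [simp]: "kern s (- z) = kern s z"
  by (simp add: kern_def)

lemma kern_commute: "kern s (x - y) = kern s (y - x)"
  by (simp add: kern_def norm_minus_commute)

lemma measurable_kern [measurable]: "kern s \<in> borel_measurable borel"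
  unfolding kern_def by measurable

lemma kern_ge:
  fixes z :: "'a::euclidean_space"
  assumes "z \<noteq> 0" "norm z \<le> \<rho>" "0 < s"
  shows "1 / \<rho> powr (real DIM('a) + 2 * s) \<le> kern s z"
proof -
  have "0 < norm z" using assms by simp
  moreover from this have "0 < \<rho>" using assms(2) by linarith
  ultimately show ?thesis
    unfolding kern_def using assms by (intro divide_left_mono powr_mono2) auto
qed

lemma kern_scale:
  fixes z :: "'a::euclidean_space"
  assumes "0 < c"
  shows "kern s (c *\<^sub>R z) = kern s z / c powr (real DIM('a) + 2 * s)"
  using assms by (simp add: kern_def powr_mult)

section \<open>Integrability of the kernel by dyadic shells\<close>

lemma ennreal_suminf_geometric_less_top:
  assumes "0 \<le> c" "0 \<le> q" "q < 1"
  shows "(\<Sum>k. ennreal (c * q ^ k)) < top"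
proof -
  have "(\<Sum>k. ennreal (c * q ^ k)) \<noteq> top"
    using assms by (intro ennreal_suminf_neq_top summable_mult summable_geometric) auto
  then show ?thesis by (simp add: top.not_eq_extremum)
qed

text \<open>The k-th term integrates to the volume of the unit ball times
  \<open>a k * r k ^ DIM('a)\<close>, so \<open>eq\<close> makes the total a geometric series.
  Dominating functions of this form replace polar coordinates.\<close>

lemma nn_integral_shell_sum_less_top:
  fixes a :: "nat \<Rightarrow> real" and r :: "nat \<Rightarrow> real"
  assumes "\<And>k. 0 \<le> a k" "\<And>k. 0 \<le> r k"
    and eq: "\<And>k. a k * r k ^ DIM('a) = c * q ^ k" and q: "0 \<le> c" "0 \<le> q" "q < 1"
  shows "(\<integral>\<^sup>+z. (\<Sum>k. ennreal (a k) * indicator (ball (0::'a::euclidean_space) (r k)) z) \<partial>lborel) < top"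
proof -
  have "(\<integral>\<^sup>+z. (\<Sum>k. ennreal (a k) * indicator (ball (0::'a) (r k)) z) \<partial>lborel)
      = (\<Sum>k. ennreal (a k) * emeasure lborel (ball (0::'a) (r k)))"
    by (subst nn_integral_suminf, measurable) (intro suminf_cong nn_integral_cmult_indicator, simp)
  also have "\<dots> = (\<Sum>k. ennreal (unit_ball_vol (DIM('a)) * c * q ^ k))"
  proof (rule suminf_cong)
    fix k
    have "a k * (unit_ball_vol (DIM('a)) * r k ^ DIM('a)) = unit_ball_vol (DIM('a)) * c * q ^ k"
      using eq[of k] by (metis mult.assoc mult.left_commute)
    then show "ennreal (a k) * emeasure lborel (ball (0::'a) (r k))
        = ennreal (unit_ball_vol (DIM('a)) * c * q ^ k)"
      using assms by (subst emeasure_ball) (auto simp flip: ennreal_mult)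
  qed
  also have "\<dots> < top"
    using q by (intro ennreal_suminf_geometric_less_top) auto
  finally show ?thesis .
qed

lemma term_le_shell_sum:
  fixes z :: "'a::euclidean_space"
  assumes "f \<le> a k" "norm z < r k"
  shows "ennreal f \<le> (\<Sum>k. ennreal (a k) * indicator (ball 0 (r k)) z)"
proof -
  have "ennreal f \<le> ennreal (a k) * indicator (ball 0 (r k)) z"
    using assms by (auto simp: ennreal_leI)
  also have "\<dots> \<le> (\<Sum>k. ennreal (a k) * indicator (ball 0 (r k)) z)"
    using sum_le_suminf[of "\<lambda>k. ennreal (a k) * indicator (ball 0 (r k)) z" "{k}"]
    by (auto simp del: sum_mult_indicator)
  finally show ?thesis .
qed

lemma power_powr_swap:
  fixes x p :: real
  assumes "0 < x"
  shows "(x ^ k) powr p = (x powr p) ^ k"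
  using assms by (simp add: powr_power flip: powr_realpow[of _ k] add: powr_powr mult.commute)

lemma kern_small_le:
  fixes z :: "'a::euclidean_space"
  assumes "0 < s" "norm z < 1" "z \<noteq> 0"
  obtains k where "norm z < (1/2) ^ k"
    "norm z * kern s z \<le> (2 powr (real DIM('a) + 2 * s - 1)) ^ Suc k"
proof -
  define p where "p = real DIM('a) + 2 * s"
  have "1 \<le> DIM('a)" using DIM_positive[where 'a='a] by linarith
  then have "1 \<le> real DIM('a)" by simp
  then have p: "p - 1 > 0" using assms unfolding p_def by linarith
  \<comment> \<open>Minimality puts \<open>z\<close> in the shell (1/2)^(k+1) <= |z| < (1/2)^k; for
    k = 0 the upper bound is the assumption |z| < 1.\<close>
  define k where "k = (LEAST k. (1/2) ^ Suc k \<le> norm z)"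
  have "\<exists>k. (1/2::real) ^ Suc k \<le> norm z"
  proof -
    obtain m where "(1/2::real) ^ m < norm z"
      using real_arch_pow_inv[of "norm z" "1/2"] assms by auto
    then show ?thesis by (intro exI[of _ m]) (use norm_ge_zero[of z] in \<open>simp, linarith\<close>)
  qed
  then have k1: "(1/2) ^ Suc k \<le> norm z" unfolding k_def by (rule LeastI_ex)
  have k2: "norm z < (1/2) ^ k"
  proof (cases k)
    case 0 then show ?thesis using assms by simp
  next
    case (Suc j)
    then have "\<not> (1/2) ^ Suc j \<le> norm z"
      using not_less_Least[of j "\<lambda>k. (1/2) ^ Suc k \<le> norm z"] unfolding k_def by simp
    then show ?thesis using Suc by simp
  qed
  have "norm z * kern s z = 1 / norm z powr (p - 1)"
    using assms by (simp add: kern_def p_def powr_diff)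
  also have "\<dots> \<le> 1 / ((1/2) ^ Suc k) powr (p - 1)"
    using k1 p assms by (intro divide_left_mono powr_mono2) auto
  also have "((1/2::real) ^ Suc k) powr (p - 1) = ((1/2) powr (p - 1)) ^ Suc k"
    by (rule power_powr_swap) simp
  also have "1 / ((1/2::real) powr (p - 1)) ^ Suc k = (2 powr (p - 1)) ^ Suc k"
    by (simp add: powr_divide power_divide)
  finally show ?thesis using k2 that by (simp add: p_def)
qed

lemma kern_large_le:
  fixes z :: "'a::euclidean_space"
  assumes "0 < s" "1 \<le> norm z"
  obtains k where "norm z < 2 ^ Suc k"
    "kern s z \<le> (1 / 2 powr (real DIM('a) + 2 * s)) ^ k"
proof -
  define p where "p = real DIM('a) + 2 * s"
  have p: "p > 0" using assms unfolding p_def by (simp add: add_nonneg_pos)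
  define k where "k = (LEAST k. norm z < 2 ^ Suc k)"
  have "\<exists>k. norm z < 2 ^ Suc k"
  proof -
    obtain m where "norm z < 2 ^ m" using real_arch_pow[of 2 "norm z"] by auto
    then show ?thesis by (intro exI[of _ m]) (auto intro: order_less_trans)
  qed
  then have k1: "norm z < 2 ^ Suc k" unfolding k_def by (rule LeastI_ex)
  have k2: "2 ^ k \<le> norm z"
  proof (cases k)
    case 0 then show ?thesis using assms by simp
  next
    case (Suc j)
    then have "\<not> norm z < 2 ^ Suc j"
      using not_less_Least[of j "\<lambda>k. norm z < 2 ^ Suc k"] unfolding k_def by simp
    then show ?thesis using Suc by simp
  qed
  have z: "0 < norm z" using assms by linarith
  have "kern s z = 1 / norm z powr p" by (simp add: kern_def p_def)
  also have "\<dots> \<le> 1 / (2 ^ k) powr p"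
    using k2 p z by (intro divide_left_mono powr_mono2 mult_pos_pos) (simp_all add: less_imp_le)
  also have "(2 ^ k) powr p = (2 powr p) ^ k"
    by (rule power_powr_swap) simp
  finally show ?thesis using k1 that by (simp add: p_def power_divide)
qed

text \<open>Kernel bound times ball volume leaves the ratio 2^(2s-1) for the shells near the origin
  and 2^(-2s) for those at infinity. The first is below 1 because s < 1/2, the second because s >
  0.\<close>

lemma kern_integral_less_top:
  assumes "0 < s" "s < 1/2"
  shows "(\<integral>\<^sup>+z. ennreal (min 1 (norm z) * kern s z) \<partial>(lborel :: 'a::euclidean_space measure)) < top"
proof -
  define n where "n = DIM('a)"
  define a where "a = 2 powr (real n + 2 * s - 1)"
  define b where "b = 1 / 2 powr (real n + 2 * s)"
  let ?f = "\<lambda>z::'a. \<Sum>k. ennreal (a ^ Suc k) * indicator (ball 0 ((1/2) ^ k)) z"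
  let ?g = "\<lambda>z::'a. \<Sum>k. ennreal (b ^ k) * indicator (ball 0 (2 ^ Suc k)) z"
  have le: "ennreal (min 1 (norm z) * kern s z) \<le> ?f z + ?g z" for z
  proof (cases "norm z < 1")
    case True
    have "ennreal (min 1 (norm z) * kern s z) \<le> ?f z"
    proof (cases "z = 0")
      case False
      obtain k where "norm z < (1/2) ^ k" "norm z * kern s z \<le> a ^ Suc k"
        using kern_small_le[OF assms(1) True False] unfolding a_def n_def by blast
      then show ?thesis using True by (intro term_le_shell_sum) auto
    qed auto
    then show ?thesis by (simp add: add_increasing2)
  next
    case False
    then obtain k where "norm z < 2 ^ Suc k" "kern s z \<le> b ^ k"
      using kern_large_le[OF assms(1), of z] unfolding b_def n_def by auto
    then have "ennreal (min 1 (norm z) * kern s z) \<le> ?g z"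
      using False by (intro term_le_shell_sum) auto
    then show ?thesis by (simp add: add_increasing)
  qed
  have qa: "a / 2 ^ n = 2 powr (2 * s - 1)"
    by (simp add: a_def powr_diff powr_add powr_realpow)
  have qb: "b * 2 ^ n = 1 / 2 powr (2 * s)"
    by (simp add: b_def powr_add powr_realpow)
  have f: "(\<integral>\<^sup>+z. ?f z \<partial>lborel) < top"
  proof (rule nn_integral_shell_sum_less_top)
    fix k :: nat
    show "a ^ Suc k * ((1 / 2) ^ k) ^ DIM('a) = a * (a / 2 ^ n) ^ k"
      by (simp add: n_def power_divide mult.commute flip: power_mult)
    show "a / 2 ^ n < 1" unfolding qa using assms by (intro powr_less_one) auto
  qed (use assms in \<open>auto simp: a_def\<close>)
  have g: "(\<integral>\<^sup>+z. ?g z \<partial>lborel) < top"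
  proof (rule nn_integral_shell_sum_less_top)
    fix k :: nat
    show "b ^ k * (2 ^ Suc k) ^ DIM('a) = 2 ^ n * (b * 2 ^ n) ^ k"
      by (simp add: n_def power_mult_distrib mult.commute flip: power_mult)
    show "b * 2 ^ n < 1" unfolding qb using assms gr_one_powr[of 2 "2 * s"] by simp
  qed (auto simp: b_def)
  have "(\<integral>\<^sup>+z. ennreal (min 1 (norm z) * kern s z) \<partial>(lborel :: 'a measure)) \<le> (\<integral>\<^sup>+z. ?f z + ?g z \<partial>lborel)"
    by (intro nn_integral_mono le)
  also have "\<dots> = (\<integral>\<^sup>+z. ?f z \<partial>lborel) + (\<integral>\<^sup>+z. ?g z \<partial>lborel)"
    by (subst nn_integral_add) auto
  also have "\<dots> < top" using f g by (simp add: ennreal_add_less_top)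
  finally show ?thesis .
qed

section \<open>Translation, scaling and the seminorm\<close>

lemma nn_integral_lborel_shift:
  fixes f :: "'a::euclidean_space \<Rightarrow> ennreal"
  assumes [measurable]: "f \<in> borel_measurable borel"
  shows "(\<integral>\<^sup>+x. f (c + x) \<partial>lborel) = (\<integral>\<^sup>+x. f x \<partial>lborel)"
proof -
  have "(\<integral>\<^sup>+x. f x \<partial>lborel) = (\<integral>\<^sup>+x. f x \<partial>(distr lborel borel ((+) c)))"
    by (simp add: lborel_distr_plus)
  also have "\<dots> = (\<integral>\<^sup>+x. f (c + x) \<partial>lborel)"
    by (rule nn_integral_distr) auto
  finally show ?thesis by simp
qed

lemma nn_integral_lborel_scale:
  fixes f :: "'a::euclidean_space \<Rightarrow> ennreal"
  assumes [measurable]: "f \<in> borel_measurable borel" and "0 < c"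
  shows "(\<integral>\<^sup>+x. f x \<partial>lborel) = ennreal (c ^ DIM('a)) * (\<integral>\<^sup>+x. f (c *\<^sub>R x) \<partial>lborel)"
proof -
  have "(\<integral>\<^sup>+x. f x \<partial>lborel)
      = (\<integral>\<^sup>+x. f x \<partial>(density (distr lborel borel (\<lambda>x. 0 + c *\<^sub>R x)) (\<lambda>_. \<bar>c\<bar> ^ DIM('a))))"
    using lborel_affine[of c "0::'a"] assms by simp
  also have "\<dots> = ennreal (c ^ DIM('a)) * (\<integral>\<^sup>+x. f (c *\<^sub>R x) \<partial>lborel)"
    using assms by (simp add: nn_integral_density nn_integral_distr nn_integral_cmult)
  finally show ?thesis .
qed

text \<open>The unnamed argument only carries the dimension. Since \<open>enn2real\<close> sends
  infinity to 0, the number is the value of the integral only when that is finite, which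
  \<open>kern_integral_less_top\<close> gives for 0 < s < 1/2.\<close>

definition kern_const :: "real \<Rightarrow> 'a::euclidean_space itself \<Rightarrow> real" where
  "kern_const s _ = enn2real (\<integral>\<^sup>+z. ennreal (min 1 (norm z) * kern s z) \<partial>(lborel :: 'a measure))"

lemma kern_const_nonneg: "0 \<le> kern_const s TYPE('a::euclidean_space)"
  by (simp add: kern_const_def)

text \<open>Under the substitution z -> d z the Jacobian d^n meets the homogeneity d^(-n-2s) of the
  kernel, and d^(-2s) survives.\<close>

lemma nn_integral_kern_scaled:
  assumes s: "0 < s" "s < 1/2" and d: "0 < d"
  shows "(\<integral>\<^sup>+z. ennreal (min 1 (norm z / d) * kern s z) \<partial>(lborel :: 'a::euclidean_space measure))
     = ennreal (kern_const s TYPE('a) / d powr (2 * s))"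
proof -
  have J: "(\<integral>\<^sup>+z. ennreal (min 1 (norm z) * kern s z) \<partial>(lborel :: 'a measure)) = ennreal (kern_const s TYPE('a))"
    unfolding kern_const_def using kern_integral_less_top[OF s, where 'a='a] by simp
  have "(\<integral>\<^sup>+z. ennreal (min 1 (norm z / d) * kern s z) \<partial>(lborel :: 'a measure))
      = ennreal (d ^ DIM('a)) * (\<integral>\<^sup>+z. ennreal (min 1 (norm (d *\<^sub>R z) / d) * kern s (d *\<^sub>R z)) \<partial>(lborel :: 'a measure))"
    by (rule nn_integral_lborel_scale[OF _ d]) measurable
  also have "(\<integral>\<^sup>+z. ennreal (min 1 (norm (d *\<^sub>R z) / d) * kern s (d *\<^sub>R z)) \<partial>(lborel :: 'a measure))
      = (\<integral>\<^sup>+z. ennreal (1 / d powr (real DIM('a) + 2 * s)) * ennreal (min 1 (norm z) * kern s z) \<partial>(lborel :: 'a measure))"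
    using d by (intro nn_integral_cong) (simp add: kern_scale flip: ennreal_mult)
  also have "\<dots> = ennreal (1 / d powr (real DIM('a) + 2 * s)) * ennreal (kern_const s TYPE('a))"
    by (subst nn_integral_cmult) (auto simp: J)
  also have "ennreal (d ^ DIM('a)) * \<dots> = ennreal (kern_const s TYPE('a) / d powr (2 * s))"
    using d kern_const_nonneg[of s, where 'a='a]
    by (simp add: powr_add powr_realpow flip: ennreal_mult)
  finally show ?thesis .
qed

text \<open>Substituting y = x + z and exchanging the integrals leaves the L1 modulus of translation
  of \<open>w\<close>, weighted by the kernel. It serves twice: for the cutoff with \<open>d\<close>
  the scale, and for the indicator of a Lipschitz domain with d = 1.\<close>

lemma seminorm_bound:
  fixes w :: "'a::euclidean_space \<Rightarrow> real"
  assumes s: "0 < s" "s < 1/2" and d: "0 < d" and M: "0 \<le> M"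
    and [measurable]: "w \<in> borel_measurable borel"
    and w: "\<And>z. (\<integral>\<^sup>+x. ennreal \<bar>w x - w (x + z)\<bar> \<partial>lborel) \<le> ennreal (M * min 1 (norm z / d))"
  shows "(\<integral>\<^sup>+x. \<integral>\<^sup>+y. ennreal (\<bar>w x - w y\<bar> * kern s (x - y)) \<partial>lborel \<partial>lborel)
      \<le> ennreal (M * kern_const s TYPE('a) / d powr (2 * s))"
proof -
  have "(\<integral>\<^sup>+x. \<integral>\<^sup>+y. ennreal (\<bar>w x - w y\<bar> * kern s (x - y)) \<partial>lborel \<partial>lborel)
      = (\<integral>\<^sup>+x. \<integral>\<^sup>+z. ennreal (\<bar>w x - w (x + z)\<bar> * kern s z) \<partial>lborel \<partial>lborel)"
  proof (rule nn_integral_cong)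
    fix x
    show "(\<integral>\<^sup>+y. ennreal (\<bar>w x - w y\<bar> * kern s (x - y)) \<partial>lborel)
        = (\<integral>\<^sup>+z. ennreal (\<bar>w x - w (x + z)\<bar> * kern s z) \<partial>lborel)"
      by (subst nn_integral_lborel_shift[of _ x, symmetric]) auto
  qed
  also have "\<dots> = (\<integral>\<^sup>+z. \<integral>\<^sup>+x. ennreal (\<bar>w x - w (x + z)\<bar> * kern s z) \<partial>lborel \<partial>lborel)"
    by (rule lborel_pair.Fubini') measurable
  also have "\<dots> = (\<integral>\<^sup>+z. ennreal (kern s z) * (\<integral>\<^sup>+x. ennreal \<bar>w x - w (x + z)\<bar> \<partial>lborel) \<partial>lborel)"
    by (intro nn_integral_cong, subst nn_integral_cmult[symmetric])
       (auto simp: ennreal_mult mult.commute)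
  also have "\<dots> \<le> (\<integral>\<^sup>+z. ennreal M * ennreal (min 1 (norm z / d) * kern s z) \<partial>(lborel :: 'a measure))"
  proof (intro nn_integral_mono)
    fix z :: 'a
    have "ennreal (kern s z) * (\<integral>\<^sup>+x. ennreal \<bar>w x - w (x + z)\<bar> \<partial>lborel)
        \<le> ennreal (kern s z) * ennreal (M * min 1 (norm z / d))"
      by (intro mult_left_mono w) auto
    also have "\<dots> = ennreal M * ennreal (min 1 (norm z / d) * kern s z)"
      using M d by (simp add: ac_simps flip: ennreal_mult)
    finally show "ennreal (kern s z) * (\<integral>\<^sup>+x. ennreal \<bar>w x - w (x + z)\<bar> \<partial>lborel)
        \<le> ennreal M * ennreal (min 1 (norm z / d) * kern s z)" .
  qed
  also have "\<dots> = ennreal M * ennreal (kern_const s TYPE('a) / d powr (2 * s))"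
    by (subst nn_integral_cmult) (auto simp: nn_integral_kern_scaled[OF s d])
  also have "\<dots> = ennreal (M * kern_const s TYPE('a) / d powr (2 * s))"
    using M kern_const_nonneg[of s, where 'a='a] by (simp flip: ennreal_mult)
  finally show ?thesis .
qed

subsection \<open>Energy comparison\<close>

lemma sigma_finite_lebesgue: "sigma_finite_measure (lebesgue :: 'a::euclidean_space measure)"
proof
  obtain A :: "'a set set" where "countable A" "A \<subseteq> sets lborel" "\<Union>A = space lborel" "\<forall>a\<in>A. emeasure lborel a \<noteq> \<infinity>"
    using lborel.sigma_finite_countable by metis
  then show "\<exists>A. countable A \<and> A \<subseteq> sets lebesgue \<and> \<Union>A = space (lebesgue :: 'a measure) \<and> (\<forall>a\<in>A. emeasure lebesgue a \<noteq> \<infinity>)"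
    by (intro exI[of _ A]) (auto simp: subset_iff)
qed

text \<open>\<open>interaction\<close> lives on the product of two completed measures. For Borel
  data the integrand is already measurable for the Borel product, so the integral can be iterated
  and moved to \<open>lborel\<close>, where translations and the exchange of integrals are
  available.\<close>

lemma interaction_eq_iterated:
  fixes u w :: "'a::euclidean_space \<Rightarrow> real"
  assumes [measurable]: "A \<in> sets borel" "u \<in> borel_measurable borel" "w \<in> borel_measurable borel"
  shows "interaction s A u w
    = (\<integral>\<^sup>+x. \<integral>\<^sup>+y. ennreal (\<bar>u x - w y\<bar>\<^sup>2 * kern s (x - y)) * indicator A (x, y) \<partial>lborel \<partial>lborel)"
proof -
  interpret lebesgue: sigma_finite_measure "lebesgue :: 'a measure"
    by (rule sigma_finite_lebesgue)
  have [measurable]: "A \<in> sets (borel \<Otimes>\<^sub>M borel)" using assms(1) unfolding borel_prod .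
  let ?f = "\<lambda>z. ennreal (\<bar>u (fst z) - w (snd z)\<bar>\<^sup>2 / norm (fst z - snd z) powr (real DIM('a) + 2 * s)) * indicator A z"
  have "?f \<in> borel_measurable (borel \<Otimes>\<^sub>M borel)" by measurable
  moreover have "(\<lambda>z. (fst z, snd z)) \<in> measurable (lebesgue \<Otimes>\<^sub>M lebesgue) (borel \<Otimes>\<^sub>M (borel :: 'a measure))"
    by (intro measurable_Pair measurable_compose[OF measurable_fst] measurable_compose[OF measurable_snd])
       (auto intro: measurable_completion)
  then have "(\<lambda>z. z) \<in> measurable (lebesgue \<Otimes>\<^sub>M lebesgue) (borel \<Otimes>\<^sub>M (borel :: 'a measure))"
    by simp
  ultimately have m: "?f \<in> borel_measurable (lebesgue \<Otimes>\<^sub>M lebesgue)"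
    by (rule measurable_compose[rotated])
  have "interaction s A u w = (\<integral>\<^sup>+x. \<integral>\<^sup>+y. ?f (x, y) \<partial>lebesgue \<partial>lebesgue)"
    unfolding interaction_def by (rule lebesgue.nn_integral_fst[OF m, symmetric])
  then show ?thesis by (simp add: nn_integral_completion kern_def)
qed

text \<open>The difference of the two sides is the polynomial \<open>id\<close>. In each of the
  allowed cases its first two summands vanish, and the third is nonnegative because p q <= 1. The
  cases correspond to both points in \<open>\<Omega>\<close>, only the first, or only the
  second.\<close>

lemma gain_pointwise:
  fixes p q \<alpha> \<beta> :: real
  assumes \<alpha>: "0 \<le> \<alpha>" "\<alpha> \<le> 1" and \<beta>: "0 \<le> \<beta>" "\<beta> \<le> 1" and pq: "\<bar>p\<bar> \<le> 1" "\<bar>q\<bar> \<le> 1"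
    and cases: "p\<^sup>2 = 1 \<and> q\<^sup>2 = 1 \<or> p\<^sup>2 = 1 \<and> \<beta> = 0 \<or> \<alpha> = 0 \<and> q\<^sup>2 = 1"
  shows "((1 - \<alpha>) * p - (1 - \<beta>) * q)\<^sup>2 + 2 * \<alpha> * (1 - p * q) \<le> (p - q)\<^sup>2 + (\<alpha> - \<beta>)\<^sup>2"
proof -
  have le: "p * q \<le> 1"
    using mult_mono[OF pq] by (metis abs_ge_self abs_ge_zero abs_mult mult_1 order_trans zero_le_one)
  have id: "(p - q)\<^sup>2 + (\<alpha> - \<beta>)\<^sup>2 - (((1 - \<alpha>) * p - (1 - \<beta>) * q)\<^sup>2 + 2 * \<alpha> * (1 - p * q))
    = (1 - (1 - \<alpha>)\<^sup>2) * (p\<^sup>2 - 1) + (1 - (1 - \<beta>)\<^sup>2) * (q\<^sup>2 - 1) + 2 * \<beta> * (1 - \<alpha>) * (1 - p * q)"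
    by (simp add: power2_eq_square algebra_simps)
  have "0 \<le> 2 * \<beta> * (1 - \<alpha>) * (1 - p * q)"
    using \<alpha> \<beta> le by simp
  moreover have "(1 - (1 - \<alpha>)\<^sup>2) * (p\<^sup>2 - 1) = 0" "(1 - (1 - \<beta>)\<^sup>2) * (q\<^sup>2 - 1) = 0"
    using cases by auto
  ultimately show ?thesis using id by linarith
qed

definition gain_density :: "real \<Rightarrow> ('a::euclidean_space \<Rightarrow> real) \<Rightarrow> ('a \<Rightarrow> real) \<Rightarrow> 'a \<Rightarrow> 'a \<Rightarrow> real" where
  "gain_density s \<psi> u x y = \<psi> x * (1 - u x * u y) * kern s (x - y)"

text \<open>Integrates \<open>gain_pointwise\<close> with weights \<open>\<tau> * \<psi> x\<close>
  and \<open>\<tau> * \<psi> y\<close>. Off \<open>Q_set \<Omega>\<close> the cutoff vanishes at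
  both points, so gain and seminorm may be taken over all pairs. The inequality is arranged with
  sums only, because subtraction in \<open>ennreal\<close> truncates.\<close>

lemma energy_comparison:
  fixes u \<psi> :: "'a::euclidean_space \<Rightarrow> real"
  assumes [measurable]: "\<Omega> \<in> sets borel" "u \<in> borel_measurable borel" "\<psi> \<in> borel_measurable borel"
    and u: "\<And>x. \<bar>u x\<bar> \<le> 1" "\<And>x. x \<in> \<Omega> \<Longrightarrow> (u x)\<^sup>2 = 1"
    and \<psi>: "\<And>x. 0 \<le> \<psi> x" "\<And>x. \<psi> x \<le> 1" "\<And>x. x \<notin> \<Omega> \<Longrightarrow> \<psi> x = 0"
    and \<tau>: "0 < \<tau>" "\<tau> \<le> 1"
  shows "interaction s (Q_set \<Omega>) (\<lambda>x. (1 - \<tau> * \<psi> x) * u x) (\<lambda>x. (1 - \<tau> * \<psi> x) * u x)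
      + ennreal (2 * \<tau>) * (\<integral>\<^sup>+x. \<integral>\<^sup>+y. ennreal (gain_density s \<psi> u x y) \<partial>lborel \<partial>lborel)
    \<le> interaction s (Q_set \<Omega>) u u
      + ennreal (\<tau>\<^sup>2) * (\<integral>\<^sup>+x. \<integral>\<^sup>+y. ennreal (\<bar>\<psi> x - \<psi> y\<bar> * kern s (x - y)) \<partial>lborel \<partial>lborel)"
    (is "interaction s ?Q ?v ?v + _ * ?H \<le> _ + _ * ?D")
proof -
  have Q[measurable]: "?Q \<in> sets (borel \<Otimes>\<^sub>M borel)" unfolding Q_set_def by measurable
  then have Q': "?Q \<in> sets borel" unfolding borel_prod .
  have [measurable]: "?v \<in> borel_measurable borel" by measurable
  have uu: "u x * u y \<le> 1" for x y
    using mult_mono[OF u(1)[of x] u(1)[of y]] by (metis abs_ge_self abs_ge_zero abs_mult mult_1 order_trans zero_le_one)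
  have gd: "0 \<le> gain_density s \<psi> u x y" for x y
    unfolding gain_density_def using \<psi>(1) uu by simp
  have [measurable]: "(\<lambda>(x, y). gain_density s \<psi> u x y) \<in> borel_measurable (borel \<Otimes>\<^sub>M borel)"
    unfolding gain_density_def by measurable
  have pt: "ennreal (\<bar>?v x - ?v y\<bar>\<^sup>2 * kern s (x - y)) * indicator ?Q (x, y)
        + ennreal (2 * \<tau>) * ennreal (gain_density s \<psi> u x y)
      \<le> ennreal (\<bar>u x - u y\<bar>\<^sup>2 * kern s (x - y)) * indicator ?Q (x, y)
        + ennreal (\<tau>\<^sup>2) * ennreal (\<bar>\<psi> x - \<psi> y\<bar> * kern s (x - y))" for x y
  proof (cases "(x, y) \<in> ?Q")
    case True
    have "((1 - \<tau> * \<psi> x) * u x - (1 - \<tau> * \<psi> y) * u y)\<^sup>2 + 2 * (\<tau> * \<psi> x) * (1 - u x * u y)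
        \<le> (u x - u y)\<^sup>2 + (\<tau> * \<psi> x - \<tau> * \<psi> y)\<^sup>2"
    proof (rule gain_pointwise)
      show "(u x)\<^sup>2 = 1 \<and> (u y)\<^sup>2 = 1 \<or> (u x)\<^sup>2 = 1 \<and> \<tau> * \<psi> y = 0 \<or> \<tau> * \<psi> x = 0 \<and> (u y)\<^sup>2 = 1"
        using True \<psi>(3)[of x] \<psi>(3)[of y] u(2)[of x] u(2)[of y] by (auto simp: Q_set_def)
    qed (use \<psi>(1,2) \<tau> u(1) in \<open>auto simp: mult_le_one\<close>)
    also have "(\<tau> * \<psi> x - \<tau> * \<psi> y)\<^sup>2 = \<tau>\<^sup>2 * \<bar>\<psi> x - \<psi> y\<bar>\<^sup>2"
      by (simp add: power2_eq_square algebra_simps)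
    \<comment> \<open>The square is traded for the first power, as \<open>seminorm_bound\<close> is
      an L1 estimate.\<close>
    also have "\<dots> \<le> \<tau>\<^sup>2 * \<bar>\<psi> x - \<psi> y\<bar>"
      using \<psi>(1,2)[of x] \<psi>(1,2)[of y] power_decreasing[of 1 2 "\<bar>\<psi> x - \<psi> y\<bar>"]
      by (intro mult_left_mono) auto
    finally have "(\<bar>?v x - ?v y\<bar>\<^sup>2 + 2 * (\<tau> * \<psi> x) * (1 - u x * u y)) * kern s (x - y)
        \<le> (\<bar>u x - u y\<bar>\<^sup>2 + \<tau>\<^sup>2 * \<bar>\<psi> x - \<psi> y\<bar>) * kern s (x - y)"
      by (intro mult_right_mono) auto
    then have "\<bar>?v x - ?v y\<bar>\<^sup>2 * kern s (x - y) + 2 * \<tau> * gain_density s \<psi> u x y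
        \<le> \<bar>u x - u y\<bar>\<^sup>2 * kern s (x - y) + \<tau>\<^sup>2 * (\<bar>\<psi> x - \<psi> y\<bar> * kern s (x - y))"
      by (simp add: gain_density_def algebra_simps)
    then show ?thesis
      using True \<tau> gd[of x y] by (simp add: ennreal_leI flip: ennreal_plus ennreal_mult)
  next
    case False
    then show ?thesis using \<psi>(3) by (auto simp: Q_set_def gain_density_def)
  qed
  have "interaction s ?Q ?v ?v + ennreal (2 * \<tau>) * ?H
      = (\<integral>\<^sup>+x. \<integral>\<^sup>+y. ennreal (\<bar>?v x - ?v y\<bar>\<^sup>2 * kern s (x - y)) * indicator ?Q (x, y)
        + ennreal (2 * \<tau>) * ennreal (gain_density s \<psi> u x y) \<partial>lborel \<partial>lborel)"
    by (simp add: interaction_eq_iterated[OF Q'] nn_integral_add nn_integral_cmult)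
  also have "\<dots> \<le> (\<integral>\<^sup>+x. \<integral>\<^sup>+y. ennreal (\<bar>u x - u y\<bar>\<^sup>2 * kern s (x - y)) * indicator ?Q (x, y)
        + ennreal (\<tau>\<^sup>2) * ennreal (\<bar>\<psi> x - \<psi> y\<bar> * kern s (x - y)) \<partial>lborel \<partial>lborel)"
    by (intro nn_integral_mono pt)
  also have "\<dots> = interaction s ?Q u u + ennreal (\<tau>\<^sup>2) * ?D"
    by (simp add: interaction_eq_iterated[OF Q'] nn_integral_add nn_integral_cmult)
  finally show ?thesis .
qed

text \<open>The difference between \<open>\<psi> x\<close> and \<open>\<psi> (x + z)\<close> is at
  most min(1, |z|/d) and vanishes unless x or x + z lies in \<open>A\<close>, that is, off a set of
  measure at most 2|A|. No information on the shape of \<open>A\<close> enters.\<close>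

lemma cutoff_seminorm:
  fixes \<psi> :: "'a::euclidean_space \<Rightarrow> real"
  assumes s: "0 < s" "s < 1/2" and d: "0 < d"
    and [measurable]: "A \<in> sets borel" "\<psi> \<in> borel_measurable borel" and A: "emeasure lborel A < top"
    and \<psi>: "\<And>x. 0 \<le> \<psi> x" "\<And>x. \<psi> x \<le> 1" "\<And>x. x \<notin> A \<Longrightarrow> \<psi> x = 0"
    and lip: "\<And>x y. \<bar>\<psi> x - \<psi> y\<bar> \<le> norm (x - y) / d"
  shows "(\<integral>\<^sup>+x. \<integral>\<^sup>+y. ennreal (\<bar>\<psi> x - \<psi> y\<bar> * kern s (x - y)) \<partial>lborel \<partial>lborel)
     \<le> ennreal (2 * measure lborel A * kern_const s TYPE('a) / d powr (2 * s))"
proof (rule seminorm_bound[OF s d])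
  fix z :: 'a
  have "(\<integral>\<^sup>+x. ennreal \<bar>\<psi> x - \<psi> (x + z)\<bar> \<partial>lborel)
      \<le> (\<integral>\<^sup>+x. ennreal (min 1 (norm z / d)) * (indicator A x + indicator A (z + x)) \<partial>lborel)"
  proof (intro nn_integral_mono)
    fix x
    have "\<bar>\<psi> x - \<psi> (x + z)\<bar> \<le> min 1 (norm z / d)"
      using lip[of x "x + z"] \<psi>(1,2)[of x] \<psi>(1,2)[of "x + z"] by auto
    then have le: "ennreal \<bar>\<psi> x - \<psi> (x + z)\<bar> \<le> ennreal (min 1 (norm z / d))"
      by (rule ennreal_leI)
    show "ennreal \<bar>\<psi> x - \<psi> (x + z)\<bar> \<le> ennreal (min 1 (norm z / d)) * (indicator A x + indicator A (z + x))"
    proof (cases "x \<in> A \<or> z + x \<in> A")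
      case True
      then have "1 \<le> (indicator A x + indicator A (z + x) :: ennreal)"
        by (auto simp: indicator_def)
      then have "ennreal (min 1 (norm z / d)) * 1 \<le> ennreal (min 1 (norm z / d)) * (indicator A x + indicator A (z + x))"
        by (rule mult_left_mono) simp
      with le show ?thesis by (metis mult_1_right order_trans)
    next
      case False
      then show ?thesis using \<psi>(3)[of x] \<psi>(3)[of "x + z"] by (simp add: add.commute)
    qed
  qed
  also have "\<dots> = ennreal (min 1 (norm z / d)) * (emeasure lborel A + emeasure lborel A)"
    using nn_integral_lborel_shift[of "indicator A" z] by (simp add: nn_integral_cmult nn_integral_add)
  also have "\<dots> = ennreal (2 * measure lborel A * min 1 (norm z / d))"
    using A d by (simp add: emeasure_eq_ennreal_measure less_top[symmetric] mult.commute flip: ennreal_plus ennreal_mult)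
  finally show "(\<integral>\<^sup>+x. ennreal \<bar>\<psi> x - \<psi> (x + z)\<bar> \<partial>lborel) \<le> ennreal (2 * measure lborel A * min 1 (norm z / d))" .
qed auto

text \<open>Double counting of triples (a, x, y) with a in \<open>A\<close> and x, y in
  \<open>ball a \<rho>\<close>. For fixed a the pairs contribute at least c m^2. For fixed (x, y)
  the admissible a lie in \<open>ball x \<rho>\<close>, and |x - y| <= 2 \<open>\<rho>\<close>
  bounds the kernel below.\<close>

lemma gain_lower_bound:
  fixes u \<psi> :: "'a::euclidean_space \<Rightarrow> real"
  assumes s: "0 < s" and \<rho>: "0 < \<rho>" and c: "0 \<le> c" and m: "0 \<le> m"
    and [measurable]: "A \<in> sets borel" "u \<in> borel_measurable borel" "\<psi> \<in> borel_measurable borel"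
    and u: "\<And>x. \<bar>u x\<bar> \<le> 1" and \<psi>: "\<And>x. 0 \<le> \<psi> x" "\<And>x. \<psi> x \<noteq> 0 \<Longrightarrow> (u x)\<^sup>2 = 1"
    and mix: "\<And>a. a \<in> A \<Longrightarrow> \<exists>X\<in>sets borel. \<exists>Y\<in>sets borel. X \<subseteq> ball a \<rho> \<and> Y \<subseteq> ball a \<rho> \<and>
       ennreal m \<le> emeasure lborel X \<and> ennreal m \<le> emeasure lborel Y \<and>
       (\<forall>x\<in>X. \<forall>y\<in>Y. c \<le> \<psi> x * (1 - u x * u y))"
  shows "ennreal (c * m\<^sup>2) * emeasure lborel A
     \<le> ennreal (unit_ball_vol (DIM('a)) * \<rho> ^ DIM('a) * (2 * \<rho>) powr (real DIM('a) + 2 * s))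
       * (\<integral>\<^sup>+x. \<integral>\<^sup>+y. ennreal (gain_density s \<psi> u x y) \<partial>lborel \<partial>lborel)"
proof -
  define q where "q = (\<lambda>z. ennreal (\<psi> (fst z) * (1 - u (fst z) * u (snd z))))"
  define V where "V = unit_ball_vol (DIM('a)) * \<rho> ^ DIM('a)"
  define P where "P = (2 * \<rho>) powr (real DIM('a) + 2 * s)"
  have V: "0 \<le> V" "emeasure lborel (ball x \<rho>) = ennreal V" for x :: 'a
    using \<rho> by (auto simp: V_def emeasure_ball)
  have P: "0 < P" using \<rho> by (simp add: P_def)
  have uu: "u x * u y \<le> 1" for x y
    using mult_mono[OF u[of x] u[of y]] by (metis abs_ge_self abs_ge_zero abs_mult mult_1 order_trans zero_le_one)
  have [measurable]: "q \<in> borel_measurable (borel \<Otimes>\<^sub>M borel)" unfolding q_def by measurable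
  let ?I = "\<lambda>a z. indicator (ball a \<rho>) (fst z) * indicator (ball a \<rho>) (snd z) :: ennreal"
  have I: "?I a z = (if dist a (fst z) < \<rho> \<and> dist a (snd z) < \<rho> then 1 else 0)" for a z
    by (auto simp: indicator_def)
  have "ennreal (c * m\<^sup>2) * emeasure lborel A = (\<integral>\<^sup>+a. ennreal (c * m\<^sup>2) * indicator A a \<partial>lborel)"
    by (simp add: nn_integral_cmult_indicator)
  also have "\<dots> \<le> (\<integral>\<^sup>+a. \<integral>\<^sup>+z. indicator A a * (q z * ?I a z) \<partial>(lborel \<Otimes>\<^sub>M lborel) \<partial>lborel)"
  proof (intro nn_integral_mono)
    fix a
    show "ennreal (c * m\<^sup>2) * indicator A a \<le> (\<integral>\<^sup>+z. indicator A a * (q z * ?I a z) \<partial>(lborel \<Otimes>\<^sub>M lborel))"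
    proof (cases "a \<in> A")
      case True
      then obtain X Y where [measurable]: "X \<in> sets borel" "Y \<in> sets borel" and XY: "X \<subseteq> ball a \<rho>" "Y \<subseteq> ball a \<rho>"
        "ennreal m \<le> emeasure lborel X" "ennreal m \<le> emeasure lborel Y"
        "\<forall>x\<in>X. \<forall>y\<in>Y. c \<le> \<psi> x * (1 - u x * u y)"
        using mix by meson
      have "ennreal (c * m\<^sup>2) = ennreal c * (ennreal m * ennreal m)"
        using c m by (simp add: power2_eq_square flip: ennreal_mult)
      also have "\<dots> \<le> ennreal c * (emeasure lborel X * emeasure lborel Y)"
        by (intro mult_left_mono mult_mono XY) auto
      also have "\<dots> = ennreal c * emeasure (lborel \<Otimes>\<^sub>M lborel) (X \<times> Y)"
        by (subst lborel.emeasure_pair_measure_Times) auto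
      also have "\<dots> = (\<integral>\<^sup>+z. ennreal c * indicator (X \<times> Y) z \<partial>(lborel \<Otimes>\<^sub>M lborel))"
        by (subst nn_integral_cmult_indicator) auto
      also have "\<dots> \<le> (\<integral>\<^sup>+z. indicator A a * (q z * ?I a z) \<partial>(lborel \<Otimes>\<^sub>M lborel))"
      proof (intro nn_integral_mono)
        fix z
        show "ennreal c * indicator (X \<times> Y) z \<le> indicator A a * (q z * ?I a z)"
        proof (cases "z \<in> X \<times> Y")
          case True
          then show ?thesis using XY \<open>a \<in> A\<close> by (auto simp: q_def indicator_def intro: ennreal_leI)
        qed auto
      qed
      finally show ?thesis using True by simp
    qed auto
  qed
  also have "\<dots> = (\<integral>\<^sup>+z. \<integral>\<^sup>+a. indicator A a * (q z * ?I a z) \<partial>lborel \<partial>(lborel \<Otimes>\<^sub>M lborel))"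
    unfolding I lborel_prod by (rule lborel_pair.Fubini') (unfold lborel_prod[symmetric], measurable)
  also have "\<dots> \<le> (\<integral>\<^sup>+z. ennreal (V * P) * ennreal (gain_density s \<psi> u (fst z) (snd z)) \<partial>(lborel \<Otimes>\<^sub>M lborel))"
  proof (intro nn_integral_mono)
    fix z :: "'a \<times> 'a"
    obtain x y where z: "z = (x, y)" by force
    show "(\<integral>\<^sup>+a. indicator A a * (q z * ?I a z) \<partial>lborel) \<le> ennreal (V * P) * ennreal (gain_density s \<psi> u (fst z) (snd z))"
    proof (cases "norm (x - y) \<le> 2 * \<rho> \<and> q z \<noteq> 0")
      case False
      have "indicator A a * (q z * ?I a z) = 0" for a
      proof -
        have "dist x y \<le> dist a x + dist a y" by (metis dist_commute dist_triangle2 add.commute)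
        then show ?thesis using False by (auto simp: z indicator_def dist_norm)
      qed
      then have "(\<integral>\<^sup>+a. indicator A a * (q z * ?I a z) \<partial>lborel) = (\<integral>\<^sup>+a. 0 \<partial>(lborel :: 'a measure))"
        by (intro nn_integral_cong)
      then show ?thesis by simp
    next
      case True
      \<comment> \<open>On the diagonal 1 - u(x)^2 = 0 wherever \<open>\<psi>\<close> is nonzero, so
        pairs with nonzero \<open>q\<close> avoid the point where \<open>kern\<close> is 0.\<close>
      then have "x \<noteq> y"
        using \<psi>(2)[of x] by (cases "\<psi> x = 0") (auto simp: z q_def power2_eq_square)
      then have k: "1 / P \<le> kern s (x - y)" unfolding P_def using True s by (intro kern_ge) auto
      have "(\<integral>\<^sup>+a. indicator A a * (q z * ?I a z) \<partial>lborel) \<le> (\<integral>\<^sup>+a. q z * indicator (ball x \<rho>) a \<partial>lborel)"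
        by (intro nn_integral_mono) (auto simp: indicator_def z dist_commute)
      also have "\<dots> = q z * ennreal V" by (simp add: nn_integral_cmult_indicator V)
      also have "\<dots> = ennreal (V * (\<psi> x * (1 - u x * u y)))"
        using V(1) \<psi>(1)[of x] uu[of x y] by (simp add: q_def z mult.commute flip: ennreal_mult)
      also have "\<dots> \<le> ennreal (V * P * gain_density s \<psi> u x y)"
      proof (rule ennreal_leI)
        have "1 \<le> P * kern s (x - y)" using k P by (simp add: field_simps)
        then have "V * (\<psi> x * (1 - u x * u y)) * 1 \<le> V * (\<psi> x * (1 - u x * u y)) * (P * kern s (x - y))"
          using V(1) \<psi>(1)[of x] uu[of x y] by (intro mult_left_mono) auto
        then show "V * (\<psi> x * (1 - u x * u y)) \<le> V * P * gain_density s \<psi> u x y"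
          by (simp add: gain_density_def ac_simps)
      qed
      also have "\<dots> = ennreal (V * P) * ennreal (gain_density s \<psi> u x y)"
        using V(1) P by (simp add: ennreal_mult')
      finally show ?thesis by (simp add: z)
    qed
  qed
  also have "\<dots> = ennreal (V * P) * (\<integral>\<^sup>+z. ennreal (gain_density s \<psi> u (fst z) (snd z)) \<partial>(lborel \<Otimes>\<^sub>M lborel))"
    unfolding gain_density_def by (rule nn_integral_cmult) measurable
  also have "(\<integral>\<^sup>+z. ennreal (gain_density s \<psi> u (fst z) (snd z)) \<partial>(lborel \<Otimes>\<^sub>M lborel))
      = (\<integral>\<^sup>+x. \<integral>\<^sup>+y. ennreal (gain_density s \<psi> u x y) \<partial>lborel \<partial>lborel)"
  proof (subst lborel.nn_integral_fst[symmetric])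
    show "(\<lambda>z. ennreal (gain_density s \<psi> u (fst z) (snd z))) \<in> borel_measurable (lborel \<Otimes>\<^sub>M lborel)"
      unfolding gain_density_def by measurable
  qed simp
  finally show ?thesis by (simp add: V_def P_def)
qed

subsection \<open>Competitors at a given scale\<close>

text \<open>\<open>X\<close> stays within \<open>\<delta>\<close> of y, where the cutoff built from
  balls of radius 2 \<open>\<delta>\<close> equals 1. \<open>Y\<close> may lie farther away, even
  outside \<open>\<Omega>\<close>, because only the value of \<open>u\<close> is used there. The
  same \<open>c\<close> bounds volumes and contrast to save a parameter.\<close>

definition mixed_at :: "('a::euclidean_space \<Rightarrow> real) \<Rightarrow> real \<Rightarrow> real \<Rightarrow> real \<Rightarrow> 'a \<Rightarrow> bool" where
  "mixed_at u c R \<delta> y \<longleftrightarrow> (\<exists>X\<in>sets borel. \<exists>Y\<in>sets borel. X \<subseteq> ball y \<delta> \<and> Y \<subseteq> ball y (R * \<delta>) \<and>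
     ennreal (c * \<delta> ^ DIM('a)) \<le> emeasure lborel X \<and> ennreal (c * \<delta> ^ DIM('a)) \<le> emeasure lborel Y \<and>
     (\<forall>x\<in>X. \<forall>y\<in>Y. c \<le> 1 - u x * u y))"

text \<open>\<open>K\<close> is obtained before \<open>\<Omega>\<close>, \<open>u\<close>,
  \<open>\<delta>\<close> and \<open>G\<close> are chosen. This uniformity lets
  \<open>\<delta>\<close> be tied to \<open>\<epsilon>\<close> afterwards by a factor depending on
  \<open>K\<close>.\<close>

lemma competitor_at_scale:
  fixes u :: "'a::euclidean_space \<Rightarrow> real"
  assumes s: "0 < s" "s < 1/2" and c: "0 < c" and R: "1 \<le> R"
  obtains K where "0 < K"
    "\<And>\<Omega> u \<delta> G. open \<Omega> \<Longrightarrow> bounded \<Omega> \<Longrightarrow> u \<in> borel_measurable borel \<Longrightarrow> (\<And>x. \<bar>u x\<bar> \<le> 1) \<Longrightarrow>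
      (\<And>x. x \<in> \<Omega> \<Longrightarrow> (u x)\<^sup>2 = 1) \<Longrightarrow> interaction s (Q_set \<Omega>) u u < top \<Longrightarrow>
      0 < \<delta> \<Longrightarrow> (\<And>y. y \<in> G \<Longrightarrow> ball y (2 * \<delta>) \<subseteq> \<Omega>) \<Longrightarrow> (\<And>y. y \<in> G \<Longrightarrow> mixed_at u c R \<delta> (y::'a)) \<Longrightarrow>
      \<exists>v\<in>borel_measurable borel. (\<forall>x. \<bar>v x\<bar> \<le> 1) \<and> (\<forall>x. x \<notin> (\<Union>y\<in>G. ball y (2 * \<delta>)) \<longrightarrow> v x = u x) \<and>
         (\<forall>x. \<bar>v x - u x\<bar> \<le> 1) \<and>
         interaction s (Q_set \<Omega>) v v + ennreal (K * measure lborel (\<Union>y\<in>G. ball y (2 * \<delta>)) / \<delta> powr (2 * s))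
           \<le> interaction s (Q_set \<Omega>) u u"
proof -
  define k where "k = kern_const s TYPE('a)"
  have k: "0 \<le> k" unfolding k_def by (rule kern_const_nonneg)
  define V where "V = unit_ball_vol (DIM('a)) * (R + 2) ^ DIM('a) * (2 * (R + 2)) powr (real DIM('a) + 2 * s)"
  have V: "0 < V" using R by (simp add: V_def)
  \<comment> \<open>\<open>gain_lower_bound\<close> compares c (c \<open>\<delta>\<close>^n)^2 |A|
    with V \<open>\<delta>\<close>^n \<open>\<delta>\<close>^(n+2s) H; the quotient of the constants
    is c^3 / V and the powers of \<open>\<delta>\<close> combine to
    \<open>\<delta>\<close>^(-2s).\<close>
  define c1 where "c1 = c ^ 3 / V"
  have c1: "0 < c1" using c V by (simp add: c1_def)
  \<comment> \<open>Small enough for 2 \<open>\<tau>\<close> k <= \<open>c1\<close>, so that the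
    quadratic seminorm term costs at most half of the linear gain. The summand 1 covers k =
    0.\<close>
  define \<tau> where "\<tau> = min 1 (c1 / (2 * k + 1))"
  have \<tau>: "0 < \<tau>" "\<tau> \<le> 1" using c1 k by (auto simp: \<tau>_def)
  have "\<tau> * (2 * k + 1) \<le> c1 / (2 * k + 1) * (2 * k + 1)"
    unfolding \<tau>_def using k by (intro mult_right_mono) auto
  then have "\<tau> * (2 * k + 1) \<le> c1" using k by simp
  then have \<tau>k: "2 * \<tau> * k \<le> c1" using \<tau>(1) by (simp add: algebra_simps)
  define K where "K = \<tau> * c1"
  have K: "0 < K" using \<tau> c1 by (simp add: K_def)
  show ?thesis
  proof (rule that[OF K])
    fix \<Omega> and u :: "'a \<Rightarrow> real" and \<delta> and G :: "'a set"
    assume u[measurable]: "u \<in> borel_measurable borel" and u1: "\<And>x. \<bar>u x\<bar> \<le> 1" "\<And>x. x \<in> \<Omega> \<Longrightarrow> (u x)\<^sup>2 = 1"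
      and E: "interaction s (Q_set \<Omega>) u u < top" and \<delta>: "0 < \<delta>"
      and G: "\<And>y. y \<in> G \<Longrightarrow> ball y (2 * \<delta>) \<subseteq> \<Omega>" "\<And>y. y \<in> G \<Longrightarrow> mixed_at u c R \<delta> y" and \<Omega>: "open \<Omega>" "bounded \<Omega>"
    define A where "A = (\<Union>y\<in>G. ball y (2 * \<delta>))"
    have A\<Omega>: "A \<subseteq> \<Omega>" using G by (auto simp: A_def)
    have opA: "open A" by (auto simp: A_def)
    have bA: "bounded A" using A\<Omega> \<Omega> bounded_subset by blast
    have [measurable]: "A \<in> sets borel" "\<Omega> \<in> sets borel" using opA \<Omega> by auto
    have Afin: "emeasure lborel A < top" using emeasure_bounded_finite[OF bA] by simp
    define a where "a = measure lborel A"
    have aeq: "emeasure lborel A = ennreal a"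
      using Afin by (simp add: a_def emeasure_eq_ennreal_measure less_top[symmetric])
    have a0: "0 \<le> a" by (simp add: a_def)
    \<comment> \<open>\<open>infdist\<close> to the empty set is 0 by convention, which would make
      the cutoff vanish identically.\<close>
    have ne: "- A \<noteq> {}" using bA not_bounded_UNIV[where 'a='a] by (metis Compl_empty_eq double_complement)
    define \<psi> where "\<psi> = (\<lambda>x. min 1 (infdist x (- A) / \<delta>))"
    have [measurable]: "\<psi> \<in> borel_measurable borel"
      unfolding \<psi>_def by (intro borel_measurable_continuous_onI continuous_intros) (use \<delta> in auto)
    have \<psi>: "\<And>x. 0 \<le> \<psi> x" "\<And>x. \<psi> x \<le> 1" "\<And>x. x \<notin> A \<Longrightarrow> \<psi> x = 0"
      using \<delta> by (auto simp: \<psi>_def infdist_nonneg)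
    have lip: "\<bar>\<psi> x - \<psi> y\<bar> \<le> norm (x - y) / \<delta>" for x y
    proof -
      have "\<bar>infdist x (- A) - infdist y (- A)\<bar> \<le> norm (x - y)"
        using infdist_triangle_abs[of x "- A" y] by (simp add: dist_norm)
      then have "\<bar>infdist x (- A) / \<delta> - infdist y (- A) / \<delta>\<bar> \<le> norm (x - y) / \<delta>"
        using \<delta> by (simp add: diff_divide_distrib[symmetric] abs_divide divide_right_mono)
      then show ?thesis unfolding \<psi>_def by linarith
    qed
    have \<psi>1: "\<psi> x = 1" if "y \<in> G" "x \<in> ball y \<delta>" for x y
    proof -
      have "\<delta> \<le> dist x w" if "w \<in> - A" for w
      proof (rule ccontr)
        assume "\<not> \<delta> \<le> dist x w"
        then have "dist y w < 2 * \<delta>" using \<open>x \<in> ball y \<delta>\<close> dist_triangle[of y w x] by simp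
        then show False using that \<open>y \<in> G\<close> by (auto simp: A_def)
      qed
      then have "\<delta> \<le> infdist x (- A)" using ne by (auto simp: infdist_def intro!: cINF_greatest)
      then show ?thesis using \<delta> by (simp add: \<psi>_def)
    qed
    define v where "v = (\<lambda>x. (1 - \<tau> * \<psi> x) * u x)"
    have [measurable]: "v \<in> borel_measurable borel" unfolding v_def by measurable
    define H where "H = (\<integral>\<^sup>+x. \<integral>\<^sup>+y. ennreal (gain_density s \<psi> u x y) \<partial>lborel \<partial>lborel)"
    have cmp: "interaction s (Q_set \<Omega>) v v + ennreal (2 * \<tau>) * H
       \<le> interaction s (Q_set \<Omega>) u u
        + ennreal (\<tau>\<^sup>2) * (\<integral>\<^sup>+x. \<integral>\<^sup>+y. ennreal (\<bar>\<psi> x - \<psi> y\<bar> * kern s (x - y)) \<partial>lborel \<partial>lborel)"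
      unfolding v_def H_def using \<tau> u1 \<psi>(1,2) \<psi>(3)[OF contra_subsetD[OF A\<Omega>]] by (intro energy_comparison) auto
    have D: "(\<integral>\<^sup>+x. \<integral>\<^sup>+y. ennreal (\<bar>\<psi> x - \<psi> y\<bar> * kern s (x - y)) \<partial>lborel \<partial>lborel)
       \<le> ennreal (2 * a * k / \<delta> powr (2 * s))"
      unfolding a_def k_def by (rule cutoff_seminorm[OF s \<delta>]) (use \<psi> lip Afin in auto)
    define \<rho> where "\<rho> = (R + 2) * \<delta>"
    have \<rho>: "0 < \<rho>" using R \<delta> by (simp add: \<rho>_def)
    have "ennreal (c * (c * \<delta> ^ DIM('a))\<^sup>2) * emeasure lborel A
     \<le> ennreal (unit_ball_vol (DIM('a)) * \<rho> ^ DIM('a) * (2 * \<rho>) powr (real DIM('a) + 2 * s)) * H"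
      unfolding H_def
    proof (rule gain_lower_bound)
      fix b assume "b \<in> A"
      then obtain y where y: "y \<in> G" "dist y b < 2 * \<delta>" by (auto simp: A_def)
      obtain X Y where XY: "X\<in>sets borel" "Y\<in>sets borel" "X \<subseteq> ball y \<delta>" "Y \<subseteq> ball y (R * \<delta>)"
         "ennreal (c * \<delta> ^ DIM('a)) \<le> emeasure lborel X" "ennreal (c * \<delta> ^ DIM('a)) \<le> emeasure lborel Y"
         "\<forall>x\<in>X. \<forall>y\<in>Y. c \<le> 1 - u x * u y"
        using G(2)[OF y(1)] unfolding mixed_at_def by meson
      have sub: "ball y (r * \<delta>) \<subseteq> ball b \<rho>" if "r \<le> R" for r
      proof
        fix x assume "x \<in> ball y (r * \<delta>)"
        then have "dist y x < r * \<delta>" by simp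
        also have "\<dots> \<le> R * \<delta>" using that \<delta> by simp
        finally show "x \<in> ball b \<rho>"
          using dist_triangle[of b x y] y(2) by (simp add: \<rho>_def algebra_simps dist_commute)
      qed
      have "\<forall>x\<in>X. \<forall>z\<in>Y. c \<le> \<psi> x * (1 - u x * u z)"
        using XY \<psi>1[OF y(1)] by auto
      then show "\<exists>X\<in>sets borel. \<exists>Y\<in>sets borel. X \<subseteq> ball b \<rho> \<and> Y \<subseteq> ball b \<rho> \<and>
         ennreal (c * \<delta> ^ DIM('a)) \<le> emeasure lborel X \<and> ennreal (c * \<delta> ^ DIM('a)) \<le> emeasure lborel Y \<and>
         (\<forall>x\<in>X. \<forall>y\<in>Y. c \<le> \<psi> x * (1 - u x * u y))"
        using XY sub[of R] sub[of 1] R by (intro bexI[of _ X] bexI[of _ Y]) auto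
    next
      fix x assume "\<psi> x \<noteq> 0"
      then show "(u x)\<^sup>2 = 1" using \<psi>(3) A\<Omega> u1(2) by blast
    qed (use s c \<delta> \<rho> u1 \<psi> in auto)
    also have "unit_ball_vol (DIM('a)) * \<rho> ^ DIM('a) * (2 * \<rho>) powr (real DIM('a) + 2 * s)
        = V * \<delta> ^ DIM('a) * \<delta> powr (real DIM('a) + 2 * s)"
    proof -
      have "(2 * \<rho>) powr (real DIM('a) + 2 * s) = (2 * (R + 2)) powr (real DIM('a) + 2 * s) * \<delta> powr (real DIM('a) + 2 * s)"
        unfolding \<rho>_def mult.assoc[symmetric] by (rule powr_mult)
      then show ?thesis by (simp only: V_def \<rho>_def power_mult_distrib ac_simps)
    qed
    finally have H1: "ennreal (c * (c * \<delta> ^ DIM('a))\<^sup>2) * ennreal a \<le> ennreal (V * \<delta> ^ DIM('a) * \<delta> powr (real DIM('a) + 2 * s)) * H"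
      by (simp add: aeq)
    define P where "P = V * \<delta> ^ DIM('a) * \<delta> powr (real DIM('a) + 2 * s)"
    have P: "0 < P" using V \<delta> by (simp add: P_def)
    have "ennreal (c1 * a / \<delta> powr (2 * s)) = ennreal (1 / P) * (ennreal (c * (c * \<delta> ^ DIM('a))\<^sup>2) * ennreal a)"
    proof -
      have "c1 * a / \<delta> powr (2 * s) = 1 / P * (c * (c * \<delta> ^ DIM('a))\<^sup>2 * a)"
        using \<delta> V by (simp add: P_def c1_def powr_add powr_realpow power2_eq_square power3_eq_cube field_simps)
      then show ?thesis using P c \<delta> a0 by (simp flip: ennreal_mult)
    qed
    also have "\<dots> \<le> ennreal (1 / P) * (ennreal P * H)"
      using H1 unfolding P_def by (intro mult_left_mono) auto
    also have "\<dots> = H" using P by (simp add: mult.assoc[symmetric] flip: ennreal_mult)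
    finally have H2: "ennreal (c1 * a / \<delta> powr (2 * s)) \<le> H" .
    define T where "T = a / \<delta> powr (2 * s)"
    have T: "0 \<le> T" using a0 by (simp add: T_def)
    have "interaction s (Q_set \<Omega>) v v + ennreal (2 * \<tau>) * ennreal (c1 * T)
        \<le> interaction s (Q_set \<Omega>) v v + ennreal (2 * \<tau>) * H"
      using H2 by (intro add_left_mono mult_left_mono) (auto simp: T_def)
    also note cmp
    also have "interaction s (Q_set \<Omega>) u u
        + ennreal (\<tau>\<^sup>2) * (\<integral>\<^sup>+x. \<integral>\<^sup>+y. ennreal (\<bar>\<psi> x - \<psi> y\<bar> * kern s (x - y)) \<partial>lborel \<partial>lborel)
        \<le> interaction s (Q_set \<Omega>) u u + ennreal (\<tau>\<^sup>2) * ennreal (2 * k * T)"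
      using D by (intro add_left_mono mult_left_mono) (auto simp: T_def mult.commute mult.left_commute)
    also have "ennreal (\<tau>\<^sup>2) * ennreal (2 * k * T) \<le> ennreal (K * T)"
    proof -
      have "\<tau>\<^sup>2 * (2 * k * T) = \<tau> * T * (2 * \<tau> * k)" by (simp add: power2_eq_square)
      also have "\<dots> \<le> \<tau> * T * c1" using \<tau> T \<tau>k by (intro mult_left_mono) auto
      finally show ?thesis using T k by (simp add: K_def ac_simps ennreal_leI flip: ennreal_mult)
    qed
    finally have le: "interaction s (Q_set \<Omega>) v v + ennreal (2 * \<tau>) * ennreal (c1 * T)
        \<le> interaction s (Q_set \<Omega>) u u + ennreal (K * T)" by (simp add: add_left_mono)
    \<comment> \<open>The gain is written as two equal halves: one cancels against the seminorm
      term, the other is the claimed surplus.\<close>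
    have "ennreal (2 * \<tau>) * ennreal (c1 * T) = ennreal (K * T) + ennreal (K * T)"
      using \<tau> c1 T by (simp add: K_def ac_simps flip: ennreal_mult ennreal_plus)
    with le have "ennreal (K * T) + (interaction s (Q_set \<Omega>) v v + ennreal (K * T))
        \<le> ennreal (K * T) + interaction s (Q_set \<Omega>) u u" by (simp add: ac_simps)
    then have "interaction s (Q_set \<Omega>) v v + ennreal (K * T) \<le> interaction s (Q_set \<Omega>) u u"
      by (simp add: ennreal_add_left_cancel_le)
    then have fin: "interaction s (Q_set \<Omega>) v v + ennreal (K * a / \<delta> powr (2 * s)) \<le> interaction s (Q_set \<Omega>) u u"
      by (simp add: T_def)
    have t: "0 \<le> \<tau> * \<psi> x" "\<tau> * \<psi> x \<le> 1" for x using \<tau> \<psi> by (auto simp: mult_le_one)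
    have "\<bar>v x\<bar> \<le> 1" for x
      using t[of x] u1(1)[of x] by (auto simp: v_def abs_mult intro: mult_le_one)
    moreover have "\<bar>v x - u x\<bar> \<le> 1" for x
    proof -
      have "v x - u x = - (\<tau> * \<psi> x * u x)" by (simp add: v_def algebra_simps)
      then show ?thesis using t[of x] u1(1)[of x] by (simp add: abs_mult mult_le_one)
    qed
    ultimately show "\<exists>v\<in>borel_measurable borel. (\<forall>x. \<bar>v x\<bar> \<le> 1) \<and> (\<forall>x. x \<notin> (\<Union>y\<in>G. ball y (2 * \<delta>)) \<longrightarrow> v x = u x) \<and>
         (\<forall>x. \<bar>v x - u x\<bar> \<le> 1) \<and>
         interaction s (Q_set \<Omega>) v v + ennreal (K * measure lborel (\<Union>y\<in>G. ball y (2 * \<delta>)) / \<delta> powr (2 * s))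
           \<le> interaction s (Q_set \<Omega>) u u"
      using fin \<psi>(3) by (intro bexI[of _ v]) (auto simp: a_def A_def[symmetric] v_def)
  qed
qed

text \<open>With \<open>\<delta> = \<kappa> * \<epsilon>\<close> the nonlocal gain is (M+1) |A|
  \<open>\<epsilon>\<close>^(-2s), and the potential costs at most M |A|
  \<open>\<epsilon>\<close>^(-2s), as W is at most M on \<open>A\<close> and W(u) = 0 on the rest of
  \<open>\<Omega>\<close>. What remains is |A| \<open>\<epsilon>\<close>^(-2s), at least c
  \<open>\<kappa>\<close> \<open>\<epsilon>\<close>^(1-2s).\<close>

lemma recovery_at_scale:
  fixes u :: "'a::euclidean_space \<Rightarrow> real"
  assumes s: "0 < s" "s < 1/2" and W: "double_well W"
    and \<Omega>: "open \<Omega>" "bounded \<Omega>" and um[measurable]: "u \<in> borel_measurable borel"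
    and u: "\<And>x. \<bar>u x\<bar> \<le> 1" "\<And>x. x \<in> \<Omega> \<Longrightarrow> (u x)\<^sup>2 = 1"
    and E: "interaction s (Q_set \<Omega>) u u < top"
    and c: "0 < c" and R: "1 \<le> R" and \<delta>0: "0 < \<delta>0"
    and G: "\<And>\<delta>. 0 < \<delta> \<Longrightarrow> \<delta> < \<delta>0 \<Longrightarrow> \<exists>G. (\<forall>y\<in>G. ball y (2 * \<delta>) \<subseteq> \<Omega> \<and> mixed_at u c R \<delta> y) \<and>
        ennreal (c * \<delta>) \<le> emeasure lborel (\<Union>y\<in>G. ball y (2 * \<delta>))"
  shows "\<exists>c'>0. \<exists>C \<epsilon>0. 0 < \<epsilon>0 \<and> (\<forall>\<epsilon>. 0 < \<epsilon> \<and> \<epsilon> < \<epsilon>0 \<longrightarrow>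
      (\<exists>v\<in>borel_measurable borel. (\<forall>x. \<bar>v x\<bar> \<le> 1) \<and> (\<forall>x. x \<notin> \<Omega> \<longrightarrow> v x = u x) \<and>
        (\<integral>\<^sup>+x. ennreal \<bar>v x - u x\<bar> \<partial>lborel) \<le> ennreal (C * \<epsilon> powr (2 * s)) \<and>
        F1_eps s \<Omega> W \<epsilon> v + ennreal (c' * \<epsilon> powr (1 - 2 * s)) \<le> interaction s (Q_set \<Omega>) u u))"
proof -
  have [measurable]: "\<Omega> \<in> sets borel" using \<Omega> by auto
  obtain K where K: "0 < K" and comp: "\<And>\<delta> G. 0 < \<delta> \<Longrightarrow> (\<And>y. y \<in> G \<Longrightarrow> ball y (2 * \<delta>) \<subseteq> \<Omega>) \<Longrightarrow>
      (\<And>y. y \<in> G \<Longrightarrow> mixed_at u c R \<delta> y) \<Longrightarrow>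
      \<exists>v\<in>borel_measurable borel. (\<forall>x. \<bar>v x\<bar> \<le> 1) \<and> (\<forall>x. x \<notin> (\<Union>y\<in>G. ball y (2 * \<delta>)) \<longrightarrow> v x = u x) \<and>
         (\<forall>x. \<bar>v x - u x\<bar> \<le> 1) \<and>
         interaction s (Q_set \<Omega>) v v + ennreal (K * measure lborel (\<Union>y\<in>G. ball y (2 * \<delta>)) / \<delta> powr (2 * s))
           \<le> interaction s (Q_set \<Omega>) u u"
  proof (rule competitor_at_scale[OF s c R, where 'a='a], goal_cases)
    case (1 K)
    show ?case by (rule 1(1)[OF 1(2)], rule 1(3)[OF \<Omega> um u E])
  qed
  obtain M where M: "\<And>t. t \<in> {-1..1} \<Longrightarrow> W t \<le> M" "0 \<le> M"
  proof -
    have "compact (W ` {-1..1})"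
      using W unfolding double_well_def by (intro compact_continuous_image) auto
    then have "bounded (W ` {-1..1})" by (rule compact_imp_bounded)
    then obtain B where B: "\<forall>x\<in>W ` {-1..1}. norm x \<le> B" unfolding bounded_iff by blast
    have "W t \<le> \<bar>B\<bar>" if "t \<in> {-1..1}" for t
    proof -
      have "\<bar>W t\<bar> \<le> B" using B that by (metis image_eqI real_norm_def)
      then show ?thesis by linarith
    qed
    then show ?thesis by (intro that[of "\<bar>B\<bar>"]) auto
  qed
  \<comment> \<open>Solves K / \<open>\<kappa>\<close>^(2s) = M + 1, one more than the bound for the
    potential.\<close>
  define \<kappa> where "\<kappa> = (K / (M + 1)) powr (1 / (2 * s))"
  have \<kappa>: "0 < \<kappa>" using K M by (simp add: \<kappa>_def)
  have \<kappa>s: "\<kappa> powr (2 * s) = K / (M + 1)" using K M s by (simp add: \<kappa>_def powr_powr)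
  define e where "e = enn2real (interaction s (Q_set \<Omega>) u u)"
  have e: "interaction s (Q_set \<Omega>) u u = ennreal e" "0 \<le> e" using E by (auto simp: e_def)
  have main: "\<forall>\<epsilon>. 0 < \<epsilon> \<and> \<epsilon> < \<delta>0 / \<kappa> \<longrightarrow>
      (\<exists>v\<in>borel_measurable borel. (\<forall>x. \<bar>v x\<bar> \<le> 1) \<and> (\<forall>x. x \<notin> \<Omega> \<longrightarrow> v x = u x) \<and>
        (\<integral>\<^sup>+x. ennreal \<bar>v x - u x\<bar> \<partial>lborel) \<le> ennreal (e / (M + 1) * \<epsilon> powr (2 * s)) \<and>
        F1_eps s \<Omega> W \<epsilon> v + ennreal (c * \<kappa> * \<epsilon> powr (1 - 2 * s)) \<le> interaction s (Q_set \<Omega>) u u)"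
  proof (intro allI impI)
    fix \<epsilon> assume \<epsilon>: "0 < \<epsilon> \<and> \<epsilon> < \<delta>0 / \<kappa>"
    define \<delta> where "\<delta> = \<kappa> * \<epsilon>"
    have \<delta>: "0 < \<delta>" "\<delta> < \<delta>0" using \<epsilon> \<kappa> by (auto simp: \<delta>_def field_simps)
    obtain G where G: "\<forall>y\<in>G. ball y (2 * \<delta>) \<subseteq> \<Omega> \<and> mixed_at u c R \<delta> y"
        "ennreal (c * \<delta>) \<le> emeasure lborel (\<Union>y\<in>G. ball y (2 * \<delta>))"
      using G[OF \<delta>] by blast
    define A where "A = (\<Union>y\<in>G. ball y (2 * \<delta>))"
    have A\<Omega>: "A \<subseteq> \<Omega>" using G by (auto simp: A_def)
    have [measurable]: "A \<in> sets borel" unfolding A_def by (intro borel_open open_UN) auto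
    define a where "a = measure lborel A"
    have a0: "0 \<le> a" by (simp add: a_def)
    have "emeasure lborel A < top" using emeasure_bounded_finite bounded_subset[OF \<Omega>(2) A\<Omega>] by auto
    then have aeq: "emeasure lborel A = ennreal a" by (simp add: a_def emeasure_eq_ennreal_measure less_top[symmetric])
    have ca: "c * \<delta> \<le> a" using G(2) a0 unfolding A_def[symmetric] aeq by simp
    obtain v where [measurable]: "v \<in> borel_measurable borel" and v: "\<And>x. \<bar>v x\<bar> \<le> 1" "\<And>x. x \<notin> A \<Longrightarrow> v x = u x"
      "\<And>x. \<bar>v x - u x\<bar> \<le> 1"
      and vE: "interaction s (Q_set \<Omega>) v v + ennreal (K * a / \<delta> powr (2 * s)) \<le> interaction s (Q_set \<Omega>) u u"
      using comp[of \<delta> G] \<delta>(1) G(1) unfolding a_def A_def by blast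
    have Ke: "K / \<delta> powr (2 * s) = (M + 1) / \<epsilon> powr (2 * s)"
    proof -
      have "(M + 1) * \<kappa> powr (2 * s) = K" unfolding \<kappa>s using M by simp
      then have "K / \<delta> powr (2 * s) = (M + 1) * \<kappa> powr (2 * s) / (\<kappa> powr (2 * s) * \<epsilon> powr (2 * s))"
        by (simp add: \<delta>_def powr_mult)
      then show ?thesis using \<kappa> by simp
    qed
    define S where "S = 1 / \<epsilon> powr (2 * s)"
    have S: "0 < S" using \<epsilon> by (simp add: S_def)
    have KS: "K * a / \<delta> powr (2 * s) = (M + 1) * a * S"
    proof -
      have "K * a / \<delta> powr (2 * s) = K / \<delta> powr (2 * s) * a" by simp
      then show ?thesis unfolding Ke by (simp add: S_def)
    qed
    have pot: "(\<integral>\<^sup>+x\<in>\<Omega>. ennreal (W (v x)) \<partial>lebesgue) \<le> ennreal (M * a)"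
    proof -
      have "(\<integral>\<^sup>+x\<in>\<Omega>. ennreal (W (v x)) \<partial>lebesgue) \<le> (\<integral>\<^sup>+x. ennreal M * indicator A x \<partial>lebesgue)"
      proof (intro nn_integral_mono)
        fix x
        show "ennreal (W (v x)) * indicator \<Omega> x \<le> ennreal M * indicator A x"
        proof (cases "x \<in> A")
          case True
          then show ?thesis using v(1)[of x] M(1)[of "v x"] by (auto simp: indicator_def abs_le_iff intro: ennreal_leI)
        next
          case False
          then have "x \<in> \<Omega> \<Longrightarrow> W (v x) = 0"
            using v(2)[OF False] u(2)[of x] W by (auto simp: double_well_def power2_eq_1_iff)
          then show ?thesis by (cases "x \<in> \<Omega>") auto
        qed
      qed
      also have "\<dots> = ennreal (M * a)"
        using M a0 by (simp add: nn_integral_completion nn_integral_cmult_indicator aeq ennreal_mult)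
      finally show ?thesis .
    qed
    have "F1_eps s \<Omega> W \<epsilon> v + ennreal (a * S)
        = interaction s (Q_set \<Omega>) v v + (ennreal S * (\<integral>\<^sup>+x\<in>\<Omega>. ennreal (W (v x)) \<partial>lebesgue) + ennreal (a * S))"
      using \<epsilon> by (simp add: F1_eps_eq S_def add.assoc)
    also have "\<dots> \<le> interaction s (Q_set \<Omega>) v v + (ennreal S * ennreal (M * a) + ennreal (a * S))"
      using pot by (intro add_left_mono add_right_mono mult_left_mono) auto
    also have "ennreal S * ennreal (M * a) + ennreal (a * S) = ennreal (K * a / \<delta> powr (2 * s))"
      unfolding KS using S M a0 by (simp add: algebra_simps flip: ennreal_mult ennreal_plus)
    also note vE
    finally have F: "F1_eps s \<Omega> W \<epsilon> v + ennreal (a * S) \<le> interaction s (Q_set \<Omega>) u u" .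
    have "c * \<kappa> * \<epsilon> powr (1 - 2 * s) = c * \<delta> * S"
      using \<epsilon> by (simp add: \<delta>_def S_def powr_diff)
    also have "\<dots> \<le> a * S" using ca S by (intro mult_right_mono) auto
    finally have "F1_eps s \<Omega> W \<epsilon> v + ennreal (c * \<kappa> * \<epsilon> powr (1 - 2 * s)) \<le> F1_eps s \<Omega> W \<epsilon> v + ennreal (a * S)"
      by (intro add_left_mono ennreal_leI)
    with F have F': "F1_eps s \<Omega> W \<epsilon> v + ennreal (c * \<kappa> * \<epsilon> powr (1 - 2 * s)) \<le> interaction s (Q_set \<Omega>) u u"
      by (rule order_trans[rotated])
    \<comment> \<open>The energy of \<open>v\<close> is nonnegative, so the gain cannot exceed the
      energy of \<open>u\<close>. This bounds |A| from above and gives the L1 rate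
      \<open>\<epsilon>\<close>^(2s).\<close>
    have "ennreal ((M + 1) * a * S) \<le> ennreal e"
      using vE unfolding KS e(1) by (rule order_trans[rotated]) simp
    then have "(M + 1) * a * S \<le> e" using e(2) by simp
    then have ae: "a \<le> e / (M + 1) * \<epsilon> powr (2 * s)"
      using M \<epsilon> by (simp add: S_def field_simps)
    have "(\<integral>\<^sup>+x. ennreal \<bar>v x - u x\<bar> \<partial>lborel) \<le> (\<integral>\<^sup>+x. indicator A x \<partial>lborel)"
    proof (intro nn_integral_mono)
      fix x show "ennreal \<bar>v x - u x\<bar> \<le> indicator A x"
        using v(2)[of x] v(3)[of x] by (cases "x \<in> A") auto
    qed
    also have "\<dots> = ennreal a" by (simp add: aeq)
    also have "\<dots> \<le> ennreal (e / (M + 1) * \<epsilon> powr (2 * s))" using ae by (rule ennreal_leI)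
    finally show "\<exists>v\<in>borel_measurable borel. (\<forall>x. \<bar>v x\<bar> \<le> 1) \<and> (\<forall>x. x \<notin> \<Omega> \<longrightarrow> v x = u x) \<and>
        (\<integral>\<^sup>+x. ennreal \<bar>v x - u x\<bar> \<partial>lborel) \<le> ennreal (e / (M + 1) * \<epsilon> powr (2 * s)) \<and>
        F1_eps s \<Omega> W \<epsilon> v + ennreal (c * \<kappa> * \<epsilon> powr (1 - 2 * s)) \<le> interaction s (Q_set \<Omega>) u u"
      using v A\<Omega> F' by (intro bexI[of _ v]) auto
  qed
  show ?thesis
    by (rule exI[of _ "c * \<kappa>"], rule conjI, use c \<kappa> in simp, rule exI[of _ "e / (M + 1)"],
        rule exI[of _ "\<delta>0 / \<kappa>"], rule conjI, use \<kappa> \<delta>0 in simp, rule main)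
qed

subsection \<open>Interfaces inside the domain\<close>

lemma emeasure_lborel_translate:
  fixes A :: "'a::euclidean_space set"
  assumes [measurable]: "A \<in> sets borel"
  shows "emeasure lborel {x. w + x \<in> A} = emeasure lborel A"
proof -
  have "emeasure lborel {x. w + x \<in> A} = (\<integral>\<^sup>+x. indicator A (w + x) \<partial>lborel)"
    by (subst nn_integral_indicator[symmetric], measurable, intro nn_integral_cong) (simp add: indicator_def)
  then show ?thesis using nn_integral_lborel_shift[of "indicator A" w] by simp
qed

text \<open>The vectors \<open>w j\<close> are the steps of one discrete path shared by all starting
  points in \<open>S\<close>. With \<open>N\<close> of order 1/\<open>\<delta>\<close> the bound
  turns into |A| >= c \<open>\<delta>\<close>.\<close>

lemma emeasure_le_translates:
  fixes A :: "'a::euclidean_space set"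
  assumes [measurable]: "A \<in> sets borel"
    and S: "\<And>x. x \<in> S \<Longrightarrow> \<exists>j<N::nat. w j + x \<in> A"
  shows "emeasure lborel S \<le> of_nat N * emeasure lborel A"
proof -
  have "emeasure lborel S \<le> emeasure lborel (\<Union>j<N. {x. w j + x \<in> A})"
    using S by (intro emeasure_mono) auto
  also have "\<dots> \<le> (\<Sum>j<N. emeasure lborel {x. w j + x \<in> A})"
    by (intro emeasure_subadditive_finite) auto
  also have "\<dots> = of_nat N * emeasure lborel A"
    by (simp add: emeasure_lborel_translate)
  finally show ?thesis .
qed

text \<open>The measure of {x in X : x + h in Y}, integrated over h, equals |X| |Y| >= a^2, and it
  is 0 unless |h| < 2 \<open>\<rho>\<close>. Some h thus does at least as well as the mean; the
  factor 2 in the bound makes the contradiction strict. A common h gives many starting points the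
  same path.\<close>

lemma exists_good_translation:
  fixes X Y :: "'a::euclidean_space set"
  assumes [measurable]: "X \<in> sets borel" "Y \<in> sets borel" and sub: "X \<subseteq> ball z \<rho>" "Y \<subseteq> ball z \<rho>"
    and a: "0 < a" "ennreal a \<le> emeasure lborel X" "ennreal a \<le> emeasure lborel Y"
    and v: "emeasure lborel (ball (0::'a) (2 * \<rho>)) = ennreal v" "0 < v"
  obtains h where "norm h < 2 * \<rho>" "ennreal (a\<^sup>2 / (2 * v)) \<le> emeasure lborel {x \<in> X. x + h \<in> Y}"
proof (rule ccontr)
  let ?c = "a\<^sup>2 / (2 * v)"
  assume "\<not> thesis"
  then have no: "emeasure lborel {x \<in> X. x + h \<in> Y} \<le> ennreal ?c" if "norm h < 2 * \<rho>" for h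
    using that \<open>\<And>h. \<lbrakk>norm h < 2 * \<rho>; ennreal ?c \<le> emeasure lborel {x \<in> X. x + h \<in> Y}\<rbrakk> \<Longrightarrow> thesis\<close> by (meson linear)
  have "ennreal (a\<^sup>2) \<le> emeasure lborel X * emeasure lborel Y"
    using a mult_mono[OF a(2,3)] by (simp add: power2_eq_square ennreal_mult)
  also have "\<dots> = (\<integral>\<^sup>+x. indicator X x * (\<integral>\<^sup>+h. indicator Y (x + h) \<partial>lborel) \<partial>lborel)"
    by (simp add: nn_integral_lborel_shift nn_integral_multc)
  also have "\<dots> = (\<integral>\<^sup>+x. \<integral>\<^sup>+h. indicator X x * indicator Y (x + h) \<partial>lborel \<partial>lborel)"
    by (simp add: nn_integral_cmult)
  also have "\<dots> = (\<integral>\<^sup>+h. \<integral>\<^sup>+x. indicator X x * indicator Y (x + h) \<partial>lborel \<partial>lborel)"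
    by (rule lborel_pair.Fubini') measurable
  also have "\<dots> \<le> (\<integral>\<^sup>+h. ennreal ?c * indicator (ball 0 (2 * \<rho>)) h \<partial>(lborel :: 'a measure))"
  proof (intro nn_integral_mono)
    fix h :: 'a
    have eq: "(\<integral>\<^sup>+x. indicator X x * indicator Y (x + h) \<partial>lborel) = emeasure lborel {x \<in> X. x + h \<in> Y}"
      by (subst nn_integral_indicator[symmetric], measurable, intro nn_integral_cong) (simp add: indicator_def)
    show "(\<integral>\<^sup>+x. indicator X x * indicator Y (x + h) \<partial>lborel) \<le> ennreal ?c * indicator (ball 0 (2 * \<rho>)) h"
    proof (cases "norm h < 2 * \<rho>")
      case True
      then show ?thesis using no unfolding eq by simp
    next
      case False
      have em: "{x \<in> X. x + h \<in> Y} = {}"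
      proof -
        have "norm h < 2 * \<rho>" if "x \<in> X" "x + h \<in> Y" for x
        proof -
          have "dist x (x + h) \<le> dist z x + dist z (x + h)" by (metis dist_commute dist_triangle)
          also have "\<dots> < 2 * \<rho>" using that sub by fastforce
          finally show ?thesis by (simp add: dist_norm)
        qed
        then show ?thesis using False by auto
      qed
      show ?thesis unfolding eq em by simp
    qed
  qed
  also have "\<dots> = ennreal (?c * v)"
    using v by (simp add: nn_integral_cmult_indicator less_imp_le del: ennreal_eq_0_iff flip: ennreal_mult)
  also have "\<dots> = ennreal (a\<^sup>2 / 2)" using v by simp
  finally show False using a by simp
qed

text \<open>A density statement that is uniform in the radius \<open>d\<close>. Exchanging
  integrals, V |E \<inter> ball z r| is at most the integral over \<open>ball z r'\<close> of the
  mass of \<open>E\<close> in \<open>ball x d\<close>; this mass is at most V on the exceptional set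
  and at most \<open>\<theta>\<close> V elsewhere.\<close>

lemma density_points_measure:
  fixes E :: "'a::euclidean_space set"
  assumes [measurable]: "E \<in> sets borel" and d: "0 < d" "r + d \<le> r'"
    and \<theta>: "0 \<le> \<theta>" and V: "emeasure lborel (ball (0::'a) d) = ennreal V" "0 < V"
    and \<beta>: "emeasure lborel (ball z r') = ennreal \<beta>" "0 \<le> \<beta>"
  shows "{x \<in> ball z r'. ennreal (\<theta> * V) < emeasure lborel (E \<inter> ball x d)} \<in> sets borel" (is "?X \<in> _")
    and "emeasure lborel (E \<inter> ball z r)
      \<le> emeasure lborel {x \<in> ball z r'. ennreal (\<theta> * V) < emeasure lborel (E \<inter> ball x d)} + ennreal (\<theta> * \<beta>)"
proof -
  have Vx: "emeasure lborel (ball x d) = ennreal V" for x :: 'a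
    using V(1) d by (simp add: emeasure_ball)
  have f: "emeasure lborel (E \<inter> ball x d) = (\<integral>\<^sup>+y. (if y \<in> E \<and> dist x y < d then 1 else 0) \<partial>lborel)" for x
    by (subst nn_integral_indicator[symmetric], measurable, intro nn_integral_cong) (simp add: indicator_def)
  have [measurable]: "(\<lambda>x. emeasure lborel (E \<inter> ball x d)) \<in> borel_measurable borel"
    unfolding f by measurable
  show X[measurable]: "?X \<in> sets borel" by measurable
  have "ennreal V * emeasure lborel (E \<inter> ball z r) = (\<integral>\<^sup>+y. ennreal V * indicator (E \<inter> ball z r) y \<partial>lborel)"
    by (simp add: nn_integral_cmult_indicator)
  also have "\<dots> \<le> (\<integral>\<^sup>+y. \<integral>\<^sup>+x. (if y \<in> E \<and> dist x y < d then 1 else 0) * indicator (ball z r') x \<partial>lborel \<partial>lborel)"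
  proof (intro nn_integral_mono)
    fix y
    show "ennreal V * indicator (E \<inter> ball z r) y
      \<le> (\<integral>\<^sup>+x. (if y \<in> E \<and> dist x y < d then 1 else 0) * indicator (ball z r') x \<partial>lborel)"
    proof (cases "y \<in> E \<inter> ball z r")
      case True
      have "ennreal V * indicator (E \<inter> ball z r) y = (\<integral>\<^sup>+x. indicator (ball y d) x \<partial>lborel)"
        using True by (simp add: Vx)
      also have "\<dots> \<le> (\<integral>\<^sup>+x. (if y \<in> E \<and> dist x y < d then 1 else 0) * indicator (ball z r') x \<partial>lborel)"
      proof (intro nn_integral_mono)
        fix x
        have "dist y x < d \<Longrightarrow> dist z x < r'"
          using True d dist_triangle[of z x y] by auto
        then show "indicator (ball y d) x \<le> (if y \<in> E \<and> dist x y < d then 1 else 0) * (indicator (ball z r') x :: ennreal)"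
          using True by (auto simp: indicator_def dist_commute)
      qed
      finally show ?thesis .
    qed auto
  qed
  also have "\<dots> = (\<integral>\<^sup>+x. \<integral>\<^sup>+y. (if y \<in> E \<and> dist x y < d then 1 else 0) * indicator (ball z r') x \<partial>lborel \<partial>lborel)"
    unfolding indicator_def mem_ball by (rule lborel_pair.Fubini') measurable
  also have "\<dots> = (\<integral>\<^sup>+x. emeasure lborel (E \<inter> ball x d) * indicator (ball z r') x \<partial>lborel)"
    unfolding f by (intro nn_integral_cong nn_integral_multc) measurable
  also have "\<dots> \<le> (\<integral>\<^sup>+x. ennreal V * indicator ?X x + ennreal (\<theta> * V) * indicator (ball z r') x \<partial>lborel)"
  proof (intro nn_integral_mono)
    fix x
    have "emeasure lborel (E \<inter> ball x d) \<le> ennreal V"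
      using emeasure_mono[of "E \<inter> ball x d" "ball x d" lborel] by (simp add: Vx)
    then show "emeasure lborel (E \<inter> ball x d) * indicator (ball z r') x
        \<le> ennreal V * indicator ?X x + ennreal (\<theta> * V) * indicator (ball z r') x"
      by (cases "x \<in> ?X") (auto simp: indicator_def not_less intro: add_increasing2)
  qed
  also have "\<dots> = ennreal V * emeasure lborel ?X + ennreal (\<theta> * V) * ennreal \<beta>"
    by (simp add: nn_integral_add nn_integral_cmult_indicator \<beta>)
  also have "\<dots> = ennreal V * (emeasure lborel ?X + ennreal (\<theta> * \<beta>))"
    using V \<theta> \<beta> by (simp add: distrib_left ac_simps flip: ennreal_mult)
  finally have "ennreal V * emeasure lborel (E \<inter> ball z r) \<le> ennreal V * (emeasure lborel ?X + ennreal (\<theta> * \<beta>))" .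
  then show "emeasure lborel (E \<inter> ball z r) \<le> emeasure lborel ?X + ennreal (\<theta> * \<beta>)"
    using V(2) by (subst (asm) ennreal_mult_le_mult_iff) auto
qed

lemma nat_ceiling_steps:
  assumes "0 < d" "0 \<le> (l::real)"
  obtains N :: nat where "0 < N" "l \<le> real N * d" "real N * d \<le> l + d"
proof
  \<comment> \<open>Floor plus one instead of the ceiling, so that \<open>N\<close> is positive even
    for l = 0.\<close>
  define N where "N = nat \<lfloor>l / d\<rfloor> + 1"
  have "real N = of_int \<lfloor>l / d\<rfloor> + 1" using assms by (simp add: N_def)
  then have "l / d \<le> real N" "real N \<le> l / d + 1" by linarith+
  then show "l \<le> real N * d" "real N * d \<le> l + d" using assms by (auto simp: field_simps)
  show "0 < N" by (simp add: N_def)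
qed

text \<open>The geometric input of \<open>recovery_at_scale\<close>, with constants uniform in
  \<open>\<delta>\<close>. The order \<open>\<delta>\<close> is that of the volume of a
  \<open>\<delta>\<close>-neighbourhood of a hypersurface.\<close>

definition mixed_family :: "'a::euclidean_space set \<Rightarrow> ('a \<Rightarrow> real) \<Rightarrow> bool" where
  "mixed_family \<Omega> u \<longleftrightarrow> (\<exists>c>0. \<exists>R\<ge>1. \<exists>\<delta>0>0. \<forall>\<delta>. 0 < \<delta> \<longrightarrow> \<delta> < \<delta>0 \<longrightarrow>
     (\<exists>G. (\<forall>y\<in>G. ball y (2 * \<delta>) \<subseteq> \<Omega> \<and> mixed_at u c R \<delta> y) \<and>
        ennreal (c * \<delta>) \<le> emeasure lborel (\<Union>y\<in>G. ball y (2 * \<delta>))))"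

text \<open>Straight paths lead from points whose \<open>d\<close>-ball holds a fair share of
  \<open>E\<close> to points whose \<open>d\<close>-ball holds a fair share of the complement. At
  the first arrival the preceding point still sees mostly \<open>E\<close>, so the arrival point
  sees both phases within \<open>\<delta>\<close>.\<close>

lemma interior_mixed_family:
  fixes \<Omega> E :: "'a::euclidean_space set"
  assumes r: "0 < r" "ball z r \<subseteq> \<Omega>" and [measurable]: "E \<in> sets borel"
    and u: "\<And>x. x \<in> \<Omega> \<Longrightarrow> x \<in> E \<Longrightarrow> u x = 1" "\<And>x. x \<in> \<Omega> \<Longrightarrow> x \<notin> E \<Longrightarrow> u x = -1"
    and pos: "0 < emeasure lborel (E \<inter> ball z (r/2))" "0 < emeasure lborel (- E \<inter> ball z (r/2))"
  shows "mixed_family \<Omega> u"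
proof -
  \<comment> \<open>Midway between r/2 and r: it leaves r/4 for the \<open>d\<close>-balls around
    points of the half ball, and r/4 for the radius 2 \<open>\<delta>\<close> of the cutoff
    balls.\<close>
  define \<rho> where "\<rho> = 3 * r / 4"
  define \<beta> where "\<beta> = unit_ball_vol (DIM('a)) * \<rho> ^ DIM('a)"
  have \<beta>: "emeasure lborel (ball x \<rho>) = ennreal \<beta>" "0 < \<beta>" for x :: 'a
    using r by (auto simp: \<beta>_def \<rho>_def emeasure_ball)
  define m where "m = min (measure lborel (E \<inter> ball z (r/2))) (measure lborel (- E \<inter> ball z (r/2)))"
  have fin: "emeasure lborel (S \<inter> ball z (r/2)) < top" for S
    by (rule le_less_trans[OF emeasure_mono emeasure_lborel_ball_finite[of z "r/2", simplified]]) auto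
  have m: "0 < m" using pos fin unfolding m_def
    by (auto simp: measure_def enn2real_positive_iff)
  have mle: "ennreal m \<le> emeasure lborel (E \<inter> ball z (r/2))" "ennreal m \<le> emeasure lborel (- E \<inter> ball z (r/2))"
    using fin[of E] fin[of "- E"] by (simp_all add: m_def emeasure_eq_ennreal_measure ennreal_leI)
  have "ennreal m \<le> emeasure lborel (ball z \<rho>)"
    by (rule order_trans[OF mle(1)]) (use r in \<open>auto intro!: emeasure_mono simp: \<rho>_def\<close>)
  then have m\<beta>: "m \<le> \<beta>" using \<beta> by simp
  \<comment> \<open>The error \<open>\<theta> * \<beta>\<close> in
    \<open>density_points_measure\<close> becomes m/2, half of the available mass, and
    \<open>\<theta>\<close> is at most 1/2, which the step to the preceding point of a path
    needs.\<close>
  define \<theta> where "\<theta> = m / (2 * \<beta>)"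
  have \<theta>: "0 < \<theta>" "\<theta> \<le> 1/2" using m m\<beta> \<beta> by (auto simp: \<theta>_def field_simps)
  have \<theta>\<beta>: "\<theta> * \<beta> = m / 2" using \<beta>(2) by (simp add: \<theta>_def)
  define v where "v = unit_ball_vol (DIM('a)) * (2 * \<rho>) ^ DIM('a)"
  have v: "emeasure lborel (ball (0::'a) (2 * \<rho>)) = ennreal v" "0 < v"
    using r by (auto simp: v_def \<rho>_def emeasure_ball)
  define c0 where "c0 = (m/2)\<^sup>2 / (2 * v)"
  have c0: "0 < c0" using m v by (simp add: c0_def)
  \<comment> \<open>The three entries serve the volumes in \<open>mixed_at\<close> (balls of radius
    \<open>\<delta>\<close>/2), the contrast 1 - (1)(-1) = 2, and the lower bound for the measure of
    the union.\<close>
  define c where "c = min (min (\<theta> * unit_ball_vol (DIM('a)) / 2 ^ DIM('a)) 2) (c0 / (4 * \<rho> + 3))"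
  have c: "0 < c" using \<theta> c0 r by (auto simp: c_def \<rho>_def)
  define \<delta>0 where "\<delta>0 = min 1 (r / 8)"
  have \<delta>0: "0 < \<delta>0" using r by (simp add: \<delta>0_def)
  have main: "\<exists>G. (\<forall>y\<in>G. ball y (2 * \<delta>) \<subseteq> \<Omega> \<and> mixed_at u c 1 \<delta> y) \<and>
        ennreal (c * \<delta>) \<le> emeasure lborel (\<Union>y\<in>G. ball y (2 * \<delta>))" if \<delta>: "0 < \<delta>" "\<delta> < \<delta>0" for \<delta>
  proof -
    define d where "d = \<delta> / 2"
    have d: "0 < d" "r / 2 + d \<le> \<rho>" "d \<le> \<delta>" "d + d \<le> \<delta>" using \<delta> by (auto simp: d_def \<delta>0_def \<rho>_def)
    define V where "V = unit_ball_vol (DIM('a)) * d ^ DIM('a)"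
    have V: "emeasure lborel (ball x d) = ennreal V" "0 < V" for x :: 'a
      using d by (auto simp: V_def emeasure_ball)
    define X where "X = {x \<in> ball z \<rho>. ennreal (\<theta> * V) < emeasure lborel (E \<inter> ball x d)}"
    define Y where "Y = {x \<in> ball z \<rho>. ennreal (\<theta> * V) < emeasure lborel (- E \<inter> ball x d)}"
    have XY[measurable]: "X \<in> sets borel" "Y \<in> sets borel"
      unfolding X_def Y_def using \<theta>(1) \<beta>(2)
      by (auto intro!: density_points_measure(1)[OF _ d(1,2) _ V(1)[of 0] V(2) \<beta>(1)] simp del: mem_ball)
    have half: "ennreal (m/2) \<le> e" if "ennreal m \<le> e + ennreal (m/2)" for e
    proof -
      have "ennreal (m/2) + ennreal (m/2) \<le> ennreal (m/2) + e"
        using that m by (simp add: add.commute flip: ennreal_plus)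
      then show ?thesis by (simp add: ennreal_add_left_cancel_le)
    qed
    have X2: "ennreal (m/2) \<le> emeasure lborel X"
      using order_trans[OF mle(1) density_points_measure(2)[OF _ d(1,2) _ V(1)[of 0] V(2) \<beta>(1), of E \<theta>]] \<theta> \<beta>(2)
      by (intro half) (simp add: X_def \<theta>\<beta> del: mem_ball)
    have Y2: "ennreal (m/2) \<le> emeasure lborel Y"
      using order_trans[OF mle(2) density_points_measure(2)[OF _ d(1,2) _ V(1)[of 0] V(2) \<beta>(1), of "- E" \<theta>]] \<theta> \<beta>(2)
      by (intro half) (simp add: Y_def \<theta>\<beta> del: mem_ball)
    obtain h where h: "norm h < 2 * \<rho>" "ennreal c0 \<le> emeasure lborel {x \<in> X. x + h \<in> Y}"
    proof (rule exists_good_translation[OF XY _ _ _ X2 Y2 v])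
      show "X \<subseteq> ball z \<rho>" "Y \<subseteq> ball z \<rho>" by (auto simp: X_def Y_def)
    qed (use m in \<open>auto simp: c0_def\<close>)
    obtain N where N: "0 < N" "norm h \<le> real N * d" "real N * d \<le> norm h + d"
      using nat_ceiling_steps[of d "norm h"] d by auto
    define G where "G = {y \<in> ball z \<rho>. mixed_at u c 1 \<delta> y}"
    define A where "A = (\<Union>y\<in>G. ball y (2 * \<delta>))"
    have [measurable]: "A \<in> sets borel" unfolding A_def by (intro borel_open open_UN) auto
    have sub\<Omega>: "ball y (2 * \<delta>) \<subseteq> \<Omega>" if "y \<in> ball z \<rho>" for y
    proof -
      have "ball y (2 * \<delta>) \<subseteq> ball z r"
      proof
        fix x assume "x \<in> ball y (2 * \<delta>)"
        then show "x \<in> ball z r" using that \<delta> dist_triangle[of z x y] by (simp add: \<rho>_def \<delta>0_def)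
      qed
      then show ?thesis using r by blast
    qed
    have mixed: "mixed_at u c 1 \<delta> y"
      if y: "y \<in> ball z \<rho>" "dist y x1 \<le> d" "dist y x2 \<le> d"
        and x1: "ennreal (\<theta> * V) \<le> emeasure lborel (E \<inter> ball x1 d)"
        and x2: "ennreal (\<theta> * V) \<le> emeasure lborel (- E \<inter> ball x2 d)" for y x1 x2
    proof -
      have sub: "ball x d \<subseteq> ball y \<delta>" if "dist y x \<le> d" for x
      proof
        fix w assume "w \<in> ball x d"
        then show "w \<in> ball y \<delta>" using that d(4) dist_triangle[of y w x] by simp
      qed
      have in\<Omega>: "ball y \<delta> \<subseteq> \<Omega>" using sub\<Omega>[OF y(1)] \<delta> by (auto simp: subset_iff)
      have "c * \<delta> ^ DIM('a) \<le> \<theta> * unit_ball_vol (DIM('a)) / 2 ^ DIM('a) * \<delta> ^ DIM('a)"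
        using \<delta> by (intro mult_right_mono) (auto simp: c_def)
      also have "\<dots> = \<theta> * V" by (simp add: V_def d_def power_divide)
      finally have le: "ennreal (c * \<delta> ^ DIM('a)) \<le> ennreal (\<theta> * V)" by (rule ennreal_leI)
      show ?thesis
        unfolding mixed_at_def
      proof (rule bexI[of _ "E \<inter> ball x1 d"], rule bexI[of _ "- E \<inter> ball x2 d"], intro conjI ballI)
        fix p q assume "p \<in> E \<inter> ball x1 d" "q \<in> - E \<inter> ball x2 d"
        then have "u p = 1" "u q = -1" using u sub[OF y(2)] sub[OF y(3)] in\<Omega> by blast+
        then show "c \<le> 1 - u p * u q" by (simp add: c_def)
      qed (use sub[OF y(2)] sub[OF y(3)] le x1 x2 in \<open>auto intro: order_trans\<close>)
    qed
    have hit: "\<exists>j<N + 1. (real j / real N) *\<^sub>R h + x \<in> A" if x: "x \<in> {x \<in> X. x + h \<in> Y}" for x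
    proof -
      define p where "p = (\<lambda>j::nat. (real j / real N) *\<^sub>R h + x)"
      have pB: "p j \<in> ball z \<rho>" if "j \<le> N" for j
      proof -
        have "p j = (1 - real j / real N) *\<^sub>R x + (real j / real N) *\<^sub>R (x + h)"
          by (simp add: p_def algebra_simps)
        moreover have "x \<in> ball z \<rho>" "x + h \<in> ball z \<rho>" using x by (auto simp: X_def Y_def)
        ultimately show ?thesis using convex_ball[of z \<rho>] that N(1)
          by (auto simp: convex_alt simp del: mem_ball)
      qed
      have step: "dist (p (Suc j)) (p j) \<le> d" for j
      proof -
        have "p (Suc j) - p j = (1 / real N) *\<^sub>R h"
          by (simp add: p_def algebra_simps add_divide_distrib)
        then show ?thesis using N by (simp add: dist_norm field_simps)
      qed
      \<comment> \<open>Since the preceding point is not in \<open>Y\<close>, its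
        \<open>d\<close>-ball has at most \<open>\<theta> * V\<close> of the complement, hence at
        least \<open>V - \<theta> * V\<close>, which is no less than \<open>\<theta> * V\<close>, of
        \<open>E\<close>. If j = 0, the start lies in \<open>X\<close> and \<open>Y\<close> at
        once.\<close>
      define j where "j = (LEAST j. p j \<in> Y)"
      have pN: "p N \<in> Y" using x N(1) by (simp add: p_def add.commute)
      then have jY: "p j \<in> Y" and jN: "j \<le> N" unfolding j_def by (auto intro: LeastI Least_le)
      have "mixed_at u c 1 \<delta> (p j)"
      proof (cases j)
        case 0
        have "p 0 \<in> X" using x by (simp add: p_def)
        then show ?thesis using jY 0 d pB[OF jN]
          by (intro mixed[of _ "p j" "p j"]) (auto simp: X_def Y_def)
      next
        case (Suc i)
        then have "p i \<notin> Y" using not_less_Least[of i "\<lambda>j. p j \<in> Y"] by (simp add: j_def)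
        then have le: "emeasure lborel (- E \<inter> ball (p i) d) \<le> ennreal (\<theta> * V)"
          using pB[of i] jN Suc by (auto simp: Y_def not_less)
        have "ennreal V = emeasure lborel ((E \<inter> ball (p i) d) \<union> (- E \<inter> ball (p i) d))"
          unfolding V(1)[of "p i", symmetric] by (intro arg_cong[where f="emeasure lborel"]) auto
        also have "\<dots> \<le> emeasure lborel (E \<inter> ball (p i) d) + emeasure lborel (- E \<inter> ball (p i) d)"
          by (intro emeasure_subadditive) auto
        also have "\<dots> \<le> emeasure lborel (E \<inter> ball (p i) d) + ennreal (\<theta> * V)"
          using le by (rule add_left_mono)
        finally have 1: "ennreal V \<le> emeasure lborel (E \<inter> ball (p i) d) + ennreal (\<theta> * V)" .
        have "\<theta> * V + \<theta> * V \<le> V" using \<theta>(2) V(2) by (simp flip: distrib_right mult_2)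
        then have "ennreal (\<theta> * V) + ennreal (\<theta> * V) \<le> ennreal V" using \<theta> V(2) by (simp flip: ennreal_plus)
        with 1 have "ennreal (\<theta> * V) + ennreal (\<theta> * V) \<le> ennreal (\<theta> * V) + emeasure lborel (E \<inter> ball (p i) d)"
          by (metis add.commute order_trans)
        then have "ennreal (\<theta> * V) \<le> emeasure lborel (E \<inter> ball (p i) d)"
          by (simp add: ennreal_add_left_cancel_le)
        then show ?thesis using jY step[of i] d pB[OF jN] Suc
          by (intro mixed[of _ "p i" "p j"]) (auto simp: Y_def)
      qed
      then have "p j \<in> A" using pB[OF jN] \<delta> by (auto simp: A_def G_def)
      then show ?thesis using jN by (auto simp: p_def intro!: exI[of _ j])
    qed
    have "ennreal c0 \<le> of_nat (N + 1) * emeasure lborel A"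
      by (rule order_trans[OF h(2) emeasure_le_translates[OF _ hit]]) auto
    moreover have "real (N + 1) \<le> (4 * \<rho> + 3) / \<delta>"
    proof -
      have "real N * \<delta> \<le> 2 * norm h + \<delta>" using N(3) by (simp add: d_def)
      then have "real (N + 1) * \<delta> \<le> 4 * \<rho> + 3" using h(1) \<delta> by (simp add: \<delta>0_def algebra_simps)
      then show ?thesis using \<delta> by (simp add: field_simps)
    qed
    ultimately have "ennreal c0 \<le> ennreal ((4 * \<rho> + 3) / \<delta>) * emeasure lborel A"
      by (metis (no_types, lifting) ennreal_leI ennreal_of_nat_eq_real_of_nat mult_right_mono order_trans zero_le)
    then have "ennreal (\<delta> / (4 * \<rho> + 3)) * ennreal c0
        \<le> ennreal (\<delta> / (4 * \<rho> + 3)) * (ennreal ((4 * \<rho> + 3) / \<delta>) * emeasure lborel A)"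
      by (rule mult_left_mono) simp
    also have "\<dots> = emeasure lborel A"
    proof -
      have "\<delta> / (4 * \<rho> + 3) * ((4 * \<rho> + 3) / \<delta>) = 1" using \<delta> r by (simp add: \<rho>_def)
      then show ?thesis using \<delta> r by (simp add: \<rho>_def mult.assoc[symmetric] flip: ennreal_mult)
    qed
    finally have "ennreal (c0 / (4 * \<rho> + 3) * \<delta>) \<le> emeasure lborel A"
      using \<delta> c0 r by (simp add: \<rho>_def mult.commute flip: ennreal_mult)
    moreover have "ennreal (c * \<delta>) \<le> ennreal (c0 / (4 * \<rho> + 3) * \<delta>)"
      using \<delta> by (intro ennreal_leI mult_right_mono) (auto simp: c_def)
    ultimately have "ennreal (c * \<delta>) \<le> emeasure lborel A" by (rule order_trans[rotated])
    then show ?thesis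
      using sub\<Omega> by (intro exI[of _ G]) (auto simp: G_def A_def simp del: mem_ball)
  qed
  show ?thesis
    unfolding mixed_family_def
    by (rule exI[of _ c], rule conjI[OF c], rule exI[of _ 1], rule conjI, simp,
        rule exI[of _ \<delta>0], rule conjI[OF \<delta>0]) (use main in blast)
qed

subsection \<open>Lipschitz boundaries\<close>

text \<open>\<open>f\<close> is the signed height, measured along \<open>e\<close>, above the graph that bounds \<open>\<Omega>\<close> near \<open>p\<close>.\<close>

definition lipschitz_chart :: "'a::euclidean_space set \<Rightarrow> 'a \<Rightarrow> real \<Rightarrow> 'a \<Rightarrow> ('a \<Rightarrow> real) \<Rightarrow> real \<Rightarrow> bool" where
  "lipschitz_chart \<Omega> p \<rho> e f \<Lambda> \<longleftrightarrow> 0 < \<rho> \<and> norm e = 1 \<and> 1 \<le> \<Lambda> \<and> f p = 0 \<and>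
     (\<forall>x y. \<bar>f x - f y\<bar> \<le> \<Lambda> * norm (x - y)) \<and> (\<forall>x t. f (x + t *\<^sub>R e) = f x + t) \<and>
     (\<forall>x\<in>ball p \<rho>. x \<in> \<Omega> \<longleftrightarrow> 0 < f x)"

text \<open>Subtracting the graph function from the coordinate along \<open>e\<close> gives a
  globally defined Lipschitz height. It vanishes at p: p is outside the open set, and a negative
  height would persist in a ball free of points of \<open>\<Omega>\<close>.\<close>

lemma lipschitz_domain_chart:
  fixes \<Omega> :: "'a::euclidean_space set"
  assumes \<Omega>: "lipschitz_domain \<Omega>" and p: "p \<in> frontier \<Omega>"
  obtains \<rho> e f \<Lambda> where "lipschitz_chart \<Omega> p \<rho> e f \<Lambda>"
proof -
  obtain \<rho> e \<phi> L where \<rho>: "0 < \<rho>" and e: "norm e = 1" and \<phi>: "L-lipschitz_on {y. y \<bullet> e = 0} \<phi>"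
    and eq: "\<Omega> \<inter> ball p \<rho> = {x \<in> ball p \<rho>. \<phi> (hyp_proj e x) < x \<bullet> e}"
    using bspec[OF conjunct2[OF \<Omega>[unfolded lipschitz_domain_def]] p] by (elim exE conjE) (rule that)
  have op: "open \<Omega>" using \<Omega> by (simp add: lipschitz_domain_def)
  have L: "0 \<le> L" using \<phi> by (rule lipschitz_on_nonneg)
  have ee: "e \<bullet> e = 1" using e by (simp add: norm_eq_1)
  define f where "f = (\<lambda>x. x \<bullet> e - \<phi> (hyp_proj e x))"
  \<comment> \<open>The factor 2 is a crude Lipschitz constant of the projection; the summand 1
    comes from the coordinate along \<open>e\<close> and makes \<open>\<Lambda>\<close> at least
    1.\<close>
  define \<Lambda> where "\<Lambda> = 2 * L + 1"
  have hp: "hyp_proj e x \<bullet> e = 0" for x by (simp add: hyp_proj_def inner_diff_left ee)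
  have ie: "\<bar>w \<bullet> e\<bar> \<le> norm w" for w using Cauchy_Schwarz_ineq2[of w e] e by simp
  have lip: "\<bar>f x - f y\<bar> \<le> \<Lambda> * norm (x - y)" for x y
  proof -
    have "hyp_proj e x - hyp_proj e y = (x - y) - ((x - y) \<bullet> e) *\<^sub>R e"
      by (simp add: hyp_proj_def algebra_simps)
    then have "norm (hyp_proj e x - hyp_proj e y) \<le> norm (x - y) + norm (((x - y) \<bullet> e) *\<^sub>R e)"
      using norm_triangle_ineq4 by metis
    also have "\<dots> \<le> 2 * norm (x - y)" using ie[of "x - y"] e by simp
    finally have n: "norm (hyp_proj e x - hyp_proj e y) \<le> 2 * norm (x - y)" .
    have "\<bar>\<phi> (hyp_proj e x) - \<phi> (hyp_proj e y)\<bar> \<le> L * norm (hyp_proj e x - hyp_proj e y)"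
      using lipschitz_onD[OF \<phi>, of "hyp_proj e x" "hyp_proj e y"] hp by (simp add: dist_norm dist_real_def)
    also have "\<dots> \<le> L * (2 * norm (x - y))" using n L by (rule mult_left_mono)
    finally have "\<bar>\<phi> (hyp_proj e x) - \<phi> (hyp_proj e y)\<bar> \<le> L * (2 * norm (x - y))" .
    moreover have "\<bar>x \<bullet> e - y \<bullet> e\<bar> \<le> norm (x - y)" using ie[of "x - y"] by (simp add: inner_diff_left)
    ultimately show ?thesis by (simp add: f_def \<Lambda>_def algebra_simps)
  qed
  have tr: "f (x + t *\<^sub>R e) = f x + t" for x t
    by (simp add: f_def hyp_proj_def inner_add_left ee algebra_simps)
  have mem: "x \<in> \<Omega> \<longleftrightarrow> 0 < f x" if "x \<in> ball p \<rho>" for x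
  proof -
    have "x \<in> \<Omega> \<inter> ball p \<rho> \<longleftrightarrow> x \<in> {x \<in> ball p \<rho>. \<phi> (hyp_proj e x) < x \<bullet> e}" unfolding eq ..
    then show ?thesis using that by (simp add: f_def del: mem_ball)
  qed
  have "p \<notin> \<Omega>" using p op by (simp add: frontier_def interior_open)
  then have "f p \<le> 0" using mem[of p] \<rho> by auto
  moreover have "0 \<le> f p"
  proof (rule ccontr)
    assume "\<not> 0 \<le> f p"
    then have neg: "f p < 0" by simp
    define d where "d = min \<rho> (- f p / \<Lambda>)"
    have "0 < - f p / \<Lambda>" using neg L by (intro divide_pos_pos) (auto simp: \<Lambda>_def)
    then have "0 < d" using \<rho> by (simp add: d_def)
    moreover have "p \<in> closure \<Omega>" using p by (simp add: frontier_def)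
    ultimately obtain x where x: "x \<in> \<Omega>" "dist x p < d" by (meson closure_approachable)
    then have "0 < f x" using mem[of x] by (simp add: d_def dist_commute)
    moreover have "f x - f p \<le> \<Lambda> * norm (x - p)" using lip[of x p] by linarith
    moreover have "\<Lambda> * norm (x - p) < - f p"
    proof -
      have "norm (x - p) < - f p / \<Lambda>" using x(2) by (simp add: dist_norm d_def)
      then show ?thesis using L by (simp add: \<Lambda>_def field_simps)
    qed
    ultimately show False by linarith
  qed
  ultimately have "f p = 0" by simp
  then show ?thesis
    using \<rho> e L lip tr mem by (intro that[of \<rho> e f \<Lambda>]) (auto simp: lipschitz_chart_def \<Lambda>_def)
qed

section \<open>Translations of a Lipschitz domain and finite energy\<close>

lemma chart_measurable:
  assumes "\<And>x y. \<bar>f x - f y\<bar> \<le> \<Lambda> * norm (x - y)"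
  shows "(f :: 'a::euclidean_space \<Rightarrow> real) \<in> borel_measurable borel"
proof -
  have \<Lambda>: "0 \<le> \<Lambda>"
  proof -
    obtain b :: 'a where "b \<in> Basis" using nonempty_Basis by blast
    then show ?thesis using assms[of b 0] by (auto intro: order_trans)
  qed
  have "\<Lambda>-lipschitz_on UNIV f" using assms \<Lambda> by (intro lipschitz_onI) (auto simp: dist_norm dist_real_def)
  then show ?thesis by (intro borel_measurable_continuous_onI lipschitz_on_continuous_on)
qed

text \<open>For t < \<open>\<rho>\<close>, about \<open>\<rho>\<close>/t translates of the band
  along \<open>e\<close> are disjoint and fit into \<open>ball p (5 * \<rho>)\<close>, so each has
  measure of order t. For t >= \<open>\<rho>\<close> the volume of that ball suffices.\<close>

lemma band_measure:
  fixes p :: "'a::euclidean_space"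
  assumes ch: "lipschitz_chart \<Omega> p \<rho> e f \<Lambda>"
  obtains C where "0 \<le> C" "\<And>t. 0 < t \<Longrightarrow> emeasure lborel {x \<in> ball p \<rho>. \<bar>f x\<bar> \<le> t} \<le> ennreal (C * t)"
proof -
  have \<rho>: "0 < \<rho>" and e: "norm e = 1" and lip: "\<And>x y. \<bar>f x - f y\<bar> \<le> \<Lambda> * norm (x - y)"
    and tr: "\<And>x t. f (x + t *\<^sub>R e) = f x + t"
    using ch by (auto simp: lipschitz_chart_def)
  have [measurable]: "f \<in> borel_measurable borel" by (rule chart_measurable[OF lip])
  define V where "V = measure lborel (ball p (5 * \<rho>))"
  have V: "emeasure lborel (ball p (5 * \<rho>)) = ennreal V" "0 \<le> V"
    using emeasure_lborel_ball_finite[of p "5 * \<rho>"] by (auto simp: V_def emeasure_eq_ennreal_measure)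
  have "emeasure lborel {x \<in> ball p \<rho>. \<bar>f x\<bar> \<le> t} \<le> ennreal (V / \<rho> * t)" if t: "0 < t" for t
  proof (cases "t < \<rho>")
    case False
    have "emeasure lborel {x \<in> ball p \<rho>. \<bar>f x\<bar> \<le> t} \<le> emeasure lborel (ball p (5 * \<rho>))"
      using \<rho> by (intro emeasure_mono) auto
    also have "\<dots> \<le> ennreal (V / \<rho> * t)"
    proof -
      have "V * \<rho> \<le> V * t" using False V(2) by (intro mult_left_mono) auto
      then have "V \<le> V / \<rho> * t" using \<rho> by (simp add: field_simps)
      then show ?thesis unfolding V(1) by (rule ennreal_leI)
    qed
    finally show ?thesis .
  next
    case True
    define T where "T = {x \<in> ball p \<rho>. \<bar>f x\<bar> \<le> t}"
    have [measurable]: "T \<in> sets borel" unfolding T_def by measurable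
    obtain N where N: "0 < N" "\<rho> \<le> real N * t" "real N * t \<le> \<rho> + t"
      using nat_ceiling_steps[of t \<rho>] t \<rho> by auto
    \<comment> \<open>A shift by 3t exceeds the width 2t of the band in the values of
      \<open>f\<close>, hence disjointness. All shifts are at most 3 \<open>\<rho>\<close>, since k
      t <= \<open>\<rho>\<close> for k < N.\<close>
    define S where "S = (\<lambda>k::nat. {x. (- (3 * real k * t)) *\<^sub>R e + x \<in> T})"
    have [measurable]: "S k \<in> sets borel" for k unfolding S_def by measurable
    have Sf: "\<bar>f x - 3 * real k * t\<bar> \<le> t" "dist p ((- (3 * real k * t)) *\<^sub>R e + x) < \<rho>" if "x \<in> S k" for x k
      using that tr[of x "- (3 * real k * t)"] by (auto simp: S_def T_def add.commute)
    have disj: "disjoint_family_on S {..<N}"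
    proof -
      have "j = k" if "x \<in> S j" "x \<in> S k" for x j k
      proof (rule ccontr)
        assume "j \<noteq> k"
        then have "1 \<le> \<bar>real j - real k\<bar>" by linarith
        then have "t \<le> \<bar>real j - real k\<bar> * t" using t by simp
        also have "\<dots> = \<bar>real j * t - real k * t\<bar>" using t by (simp add: abs_mult left_diff_distrib flip: left_diff_distrib)
        finally show False using Sf(1)[OF that(1)] Sf(1)[OF that(2)] t by linarith
      qed
      then show ?thesis by (auto simp: disjoint_family_on_def)
    qed
    have "of_nat N * emeasure lborel T = (\<Sum>k<N. emeasure lborel (S k))"
      by (simp add: S_def emeasure_lborel_translate del: scaleR_minus_left)
    also have "\<dots> = emeasure lborel (\<Union>k<N. S k)"
      using disj by (intro sum_emeasure) auto
    also have "\<dots> \<le> emeasure lborel (ball p (5 * \<rho>))"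
    proof (intro emeasure_mono)
      show "(\<Union>k<N. S k) \<subseteq> ball p (5 * \<rho>)"
      proof clarify
        fix k x assume k: "k < N" and x: "x \<in> S k"
        have "(real k + 1) * t \<le> real N * t" using k t by (intro mult_right_mono) auto
        then have "real k * t \<le> \<rho>" using N(3) by (simp add: algebra_simps)
        have "dist p x \<le> dist p ((- (3 * real k * t)) *\<^sub>R e + x) + dist ((- (3 * real k * t)) *\<^sub>R e + x) x"
          by (rule dist_triangle)
        also have "dist ((- (3 * real k * t)) *\<^sub>R e + x) x = 3 * real k * t"
          using e t by (simp add: dist_norm)
        finally show "x \<in> ball p (5 * \<rho>)" using Sf(2)[OF x] \<open>real k * t \<le> \<rho>\<close> \<rho> by simp
      qed
    qed auto
    finally have le: "of_nat N * emeasure lborel T \<le> ennreal V" by (simp add: V)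
    have "emeasure lborel T = ennreal (t / \<rho>) * (ennreal (\<rho> / t) * emeasure lborel T)"
      using t \<rho> by (simp add: mult.assoc[symmetric] flip: ennreal_mult)
    also have "\<dots> \<le> ennreal (t / \<rho>) * (of_nat N * emeasure lborel T)"
    proof (intro mult_left_mono mult_right_mono)
      have "\<rho> / t \<le> real N" using N t by (simp add: field_simps)
      then show "ennreal (\<rho> / t) \<le> of_nat N" by (metis ennreal_leI ennreal_of_nat_eq_real_of_nat)
    qed auto
    also have "\<dots> \<le> ennreal (t / \<rho>) * ennreal V" using le by (intro mult_left_mono) auto
    also have "\<dots> = ennreal (V / \<rho> * t)" using t \<rho> V by (simp add: mult.commute flip: ennreal_mult)
    finally show ?thesis unfolding T_def .
  qed
  then show ?thesis using V \<rho> by (intro that[of "V / \<rho>"]) auto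
qed

text \<open>If exactly one of x, x + z lies in \<open>\<Omega>\<close>, the segment between them
  meets the frontier. For short z both ends lie in one chart of a finite cover, where the height at
  x is at most \<open>\<Lambda>\<close> |z|, and \<open>band_measure\<close> applies. For long z the
  bound 2 |\<open>\<Omega>\<close>| is enough.\<close>

lemma lipschitz_domain_translation_bound:
  fixes \<Omega> :: "'a::euclidean_space set"
  assumes \<Omega>: "lipschitz_domain \<Omega>" "bounded \<Omega>"
  obtains M where "0 \<le> M"
    "\<And>z. (\<integral>\<^sup>+x. ennreal \<bar>indicator \<Omega> x - indicator \<Omega> (x + z)\<bar> \<partial>lborel) \<le> ennreal (M * min 1 (norm z))"
proof -
  have op: "open \<Omega>" using \<Omega> by (simp add: lipschitz_domain_def)
  then have [measurable]: "\<Omega> \<in> sets borel" by auto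
  define m where "m = measure lborel \<Omega>"
  have m: "emeasure lborel \<Omega> = ennreal m" "0 \<le> m"
    using emeasure_bounded_finite[OF \<Omega>(2)] by (auto simp: m_def emeasure_eq_ennreal_measure)
  let ?I = "\<lambda>z. (\<integral>\<^sup>+x. ennreal \<bar>indicator \<Omega> x - indicator \<Omega> (x + z)\<bar> \<partial>lborel)"
  have triv: "?I z \<le> ennreal (2 * m)" for z
  proof -
    have "?I z \<le> (\<integral>\<^sup>+x. indicator \<Omega> x + indicator \<Omega> (z + x) \<partial>lborel)"
      by (intro nn_integral_mono) (auto simp: indicator_def add.commute)
    also have "\<dots> = ennreal m + ennreal m"
      using nn_integral_lborel_shift[of "indicator \<Omega>" z] by (simp add: nn_integral_add m)
    finally show ?thesis using m by (simp flip: ennreal_plus)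
  qed
  define loc where "loc = (\<lambda>p \<rho> C. 0 < \<rho> \<and> 0 \<le> C \<and> (\<forall>z. z \<noteq> 0 \<longrightarrow>
      emeasure lborel {x. x \<in> ball p \<rho> \<and> x + z \<in> ball p \<rho> \<and> (x \<in> \<Omega>) \<noteq> (x + z \<in> \<Omega>)} \<le> ennreal (C * norm z)))"
  have "\<exists>\<rho> C. loc p \<rho> C" if "p \<in> frontier \<Omega>" for p
  proof -
    from that obtain \<rho> e f \<Lambda> where ch: "lipschitz_chart \<Omega> p \<rho> e f \<Lambda>"
      using lipschitz_domain_chart[OF \<Omega>(1)] by metis
    obtain C where C: "0 \<le> C" "\<And>t. 0 < t \<Longrightarrow> emeasure lborel {x \<in> ball p \<rho>. \<bar>f x\<bar> \<le> t} \<le> ennreal (C * t)"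
      using band_measure[OF ch] by blast
    have c: "0 < \<rho>" "1 \<le> \<Lambda>" "\<And>x y. \<bar>f x - f y\<bar> \<le> \<Lambda> * norm (x - y)" "\<And>x. x \<in> ball p \<rho> \<Longrightarrow> x \<in> \<Omega> \<longleftrightarrow> 0 < f x"
      using ch by (auto simp: lipschitz_chart_def)
    have [measurable]: "f \<in> borel_measurable borel" by (rule chart_measurable[OF c(3)])
    have "emeasure lborel {x. x \<in> ball p \<rho> \<and> x + z \<in> ball p \<rho> \<and> (x \<in> \<Omega>) \<noteq> (x + z \<in> \<Omega>)} \<le> ennreal (C * \<Lambda> * norm z)"
      if "z \<noteq> 0" for z
    proof -
      have "emeasure lborel {x. x \<in> ball p \<rho> \<and> x + z \<in> ball p \<rho> \<and> (x \<in> \<Omega>) \<noteq> (x + z \<in> \<Omega>)}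
          \<le> emeasure lborel {x \<in> ball p \<rho>. \<bar>f x\<bar> \<le> \<Lambda> * norm z}"
      proof (rule emeasure_mono)
        show "{x. x \<in> ball p \<rho> \<and> x + z \<in> ball p \<rho> \<and> (x \<in> \<Omega>) \<noteq> (x + z \<in> \<Omega>)} \<subseteq> {x \<in> ball p \<rho>. \<bar>f x\<bar> \<le> \<Lambda> * norm z}"
        proof (rule subsetI)
          fix x assume "x \<in> {x. x \<in> ball p \<rho> \<and> x + z \<in> ball p \<rho> \<and> (x \<in> \<Omega>) \<noteq> (x + z \<in> \<Omega>)}"
          then have x: "x \<in> ball p \<rho>" "x + z \<in> ball p \<rho>" "(x \<in> \<Omega>) \<noteq> (x + z \<in> \<Omega>)" by blast+
          then have "0 < f x \<and> f (x + z) \<le> 0 \<or> f x \<le> 0 \<and> 0 < f (x + z)"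
            using c(4)[of x] c(4)[of "x + z"] by auto
          moreover have "\<bar>f x - f (x + z)\<bar> \<le> \<Lambda> * norm z" using c(3)[of x "x + z"] by simp
          ultimately have "\<bar>f x\<bar> \<le> \<Lambda> * norm z" by linarith
          with x show "x \<in> {x \<in> ball p \<rho>. \<bar>f x\<bar> \<le> \<Lambda> * norm z}" by blast
        qed
      qed measurable
      also have "\<dots> \<le> ennreal (C * (\<Lambda> * norm z))" using that c by (intro C) simp
      finally show ?thesis by (simp add: mult.assoc)
    qed
    with c C have "loc p \<rho> (C * \<Lambda>)" unfolding loc_def by auto
    then show ?thesis by blast
  qed
  then obtain \<rho> C where "\<And>p. p \<in> frontier \<Omega> \<Longrightarrow> loc p (\<rho> p) (C p)"
    by metis
  then have \<rho>C: "\<And>p. p \<in> frontier \<Omega> \<Longrightarrow> 0 < \<rho> p" "\<And>p. p \<in> frontier \<Omega> \<Longrightarrow> 0 \<le> C p"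
    "\<And>p z. p \<in> frontier \<Omega> \<Longrightarrow> z \<noteq> 0 \<Longrightarrow>
      emeasure lborel {x. x \<in> ball p (\<rho> p) \<and> x + z \<in> ball p (\<rho> p) \<and> (x \<in> \<Omega>) \<noteq> (x + z \<in> \<Omega>)} \<le> ennreal (C p * norm z)"
    unfolding loc_def by blast+
  have "compact (frontier \<Omega>)" using \<Omega>(2) by (simp add: compact_frontier_bounded)
  moreover have "frontier \<Omega> \<subseteq> (\<Union>p\<in>frontier \<Omega>. ball p (\<rho> p / 2))" using \<rho>C(1) by force
  ultimately obtain P where P: "P \<subseteq> frontier \<Omega>" "finite P" "frontier \<Omega> \<subseteq> (\<Union>p\<in>P. ball p (\<rho> p / 2))"
    using compactE_image[of "frontier \<Omega>" "frontier \<Omega>" "\<lambda>p. ball p (\<rho> p / 2)"] by auto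
  \<comment> \<open>Half radii, so that a point in the half ball of a chart can move by less than
    \<open>z0\<close> and stay in the full ball. The inserted 1 keeps the set nonempty and
    \<open>z0\<close> at most 1.\<close>
  define z0 where "z0 = Min (insert 1 ((\<lambda>p. \<rho> p / 2) ` P))"
  have z0: "0 < z0" "z0 \<le> 1" "\<And>p. p \<in> P \<Longrightarrow> z0 \<le> \<rho> p / 2"
  proof -
    show "0 < z0" "z0 \<le> 1" using P \<rho>C(1) by (auto simp: z0_def)
    show "z0 \<le> \<rho> p / 2" if "p \<in> P" for p
      unfolding z0_def using P(2) that by (intro Min_le) auto
  qed
  define K where "K = (\<Sum>p\<in>P. C p)"
  have K: "0 \<le> K" using P \<rho>C(2) by (auto simp: K_def intro: sum_nonneg)
  have near: "?I z \<le> ennreal (K * norm z)" if z: "norm z < z0" for z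
  proof (cases "z = 0")
    case False
    let ?B = "\<lambda>p. {x. x \<in> ball p (\<rho> p) \<and> x + z \<in> ball p (\<rho> p) \<and> (x \<in> \<Omega>) \<noteq> (x + z \<in> \<Omega>)}"
    have B[measurable]: "?B p \<in> sets borel" for p
    proof -
      have "?B p = {x. x \<in> ball p (\<rho> p) \<and> x + z \<in> ball p (\<rho> p) \<and> (x \<in> \<Omega> \<and> x + z \<notin> \<Omega> \<or> x \<notin> \<Omega> \<and> x + z \<in> \<Omega>)}" by auto
      also have "\<dots> \<in> sets borel" by measurable
      finally show ?thesis .
    qed
    have "?I z \<le> (\<integral>\<^sup>+x. indicator (\<Union>p\<in>P. ?B p) x \<partial>lborel)"
    proof (intro nn_integral_mono)
      fix x
      show "ennreal \<bar>indicator \<Omega> x - indicator \<Omega> (x + z)\<bar> \<le> indicator (\<Union>p\<in>P. ?B p) x"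
      proof (cases "(x \<in> \<Omega>) = (x + z \<in> \<Omega>)")
        case ne: False
        have "closed_segment x (x + z) \<inter> frontier \<Omega> \<noteq> {}"
          using ne by (intro connected_Int_frontier) auto
        then obtain q where q: "q \<in> closed_segment x (x + z)" "q \<in> frontier \<Omega>" by blast
        obtain p where p: "p \<in> P" "dist p q < \<rho> p / 2" using P(3) q(2) by auto
        have "dist q x \<le> norm z" "dist q (x + z) \<le> norm z"
          using dist_in_closed_segment[OF q(1)] by (simp_all add: dist_norm norm_minus_commute)
        then have "dist p x < \<rho> p" "dist p (x + z) < \<rho> p"
          using p z z0(3)[OF p(1)] dist_triangle[of p x q] dist_triangle[of p "x + z" q] by linarith+
        then have "x \<in> (\<Union>p\<in>P. ?B p)" using p(1) ne by auto
        then show ?thesis by (auto simp: indicator_def)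
      qed (auto simp: indicator_def)
    qed
    also have "\<dots> = emeasure lborel (\<Union>p\<in>P. ?B p)"
      using P(2) B by (intro nn_integral_indicator) (auto intro!: sets.finite_UN)
    also have "\<dots> \<le> (\<Sum>p\<in>P. emeasure lborel (?B p))"
      using P(2) B by (intro emeasure_subadditive_finite) auto
    also have "\<dots> \<le> (\<Sum>p\<in>P. ennreal (C p * norm z))"
      using P(1) \<rho>C(3) False by (intro sum_mono) blast
    also have "\<dots> = ennreal (\<Sum>p\<in>P. C p * norm z)"
      using P(1) \<rho>C(2) by (intro sum_ennreal) auto
    also have "\<dots> = ennreal (K * norm z)" by (simp add: K_def sum_distrib_right)
    finally show ?thesis .
  qed auto
  \<comment> \<open>The second summand covers |z| >= \<open>z0\<close>, where \<open>2 * m\<close>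
    equals \<open>2 * m / z0\<close> times \<open>z0\<close>, and \<open>z0\<close> is at most
    min(1,|z|).\<close>
  define M where "M = K + 2 * m / z0"
  have M: "0 \<le> M" using K m z0 by (simp add: M_def)
  have "?I z \<le> ennreal (M * min 1 (norm z))" for z
  proof (cases "norm z < z0")
    case True
    have "K * norm z \<le> M * min 1 (norm z)"
      using True z0 m by (auto simp: M_def min_def intro!: mult_right_mono)
    then show ?thesis using near[OF True] by (meson ennreal_leI order_trans)
  next
    case False
    have "2 * m = 2 * m / z0 * z0" using z0 by simp
    also have "\<dots> \<le> M * min 1 (norm z)"
      using False z0 K m by (intro mult_mono) (auto simp: M_def)
    finally show ?thesis using triv[of z] by (meson ennreal_leI order_trans)
  qed
  with M show ?thesis by (rule that)
qed

text \<open>As \<open>u\<close> is constant on \<open>\<Omega>\<close>, only pairs with exactly one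
  point in \<open>\<Omega>\<close> contribute, each with a squared difference of at most 4. The
  energy is thus bounded by a multiple of the fractional perimeter of \<open>\<Omega>\<close>.
  Applied to one phase on \<open>\<Omega>\<close>, this makes the minimum finite.\<close>

lemma lipschitz_domain_finite_energy:
  fixes \<Omega> :: "'a::euclidean_space set"
  assumes s: "0 < s" "s < 1/2" and \<Omega>: "lipschitz_domain \<Omega>" "bounded \<Omega>"
    and [measurable]: "u \<in> borel_measurable borel" and u: "\<And>x. \<bar>u x\<bar> \<le> 1" "\<And>x. x \<in> \<Omega> \<Longrightarrow> u x = 1"
  shows "interaction s (Q_set \<Omega>) u u < top"
proof -
  have "open \<Omega>" using \<Omega> by (simp add: lipschitz_domain_def)
  then have [measurable]: "\<Omega> \<in> sets borel" by auto
  have Q[measurable]: "Q_set \<Omega> \<in> sets (borel \<Otimes>\<^sub>M borel)" unfolding Q_set_def by measurable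
  then have Q': "Q_set \<Omega> \<in> sets borel" unfolding borel_prod .
  obtain M where M: "0 \<le> M"
    "\<And>z. (\<integral>\<^sup>+x. ennreal \<bar>indicator \<Omega> x - indicator \<Omega> (x + z)\<bar> \<partial>lborel) \<le> ennreal (M * min 1 (norm z))"
    using lipschitz_domain_translation_bound[OF \<Omega>] by blast
  have "interaction s (Q_set \<Omega>) u u
    = (\<integral>\<^sup>+x. \<integral>\<^sup>+y. ennreal (\<bar>u x - u y\<bar>\<^sup>2 * kern s (x - y)) * indicator (Q_set \<Omega>) (x, y) \<partial>lborel \<partial>lborel)"
    by (rule interaction_eq_iterated[OF Q']) auto
  also have "\<dots> \<le> (\<integral>\<^sup>+x. \<integral>\<^sup>+y. ennreal 4 * ennreal (\<bar>indicator \<Omega> x - indicator \<Omega> y\<bar> * kern s (x - y)) \<partial>lborel \<partial>lborel)"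
  proof (intro nn_integral_mono)
    fix x y
    show "ennreal (\<bar>u x - u y\<bar>\<^sup>2 * kern s (x - y)) * indicator (Q_set \<Omega>) (x, y)
      \<le> ennreal 4 * ennreal (\<bar>indicator \<Omega> x - indicator \<Omega> y\<bar> * kern s (x - y))"
    proof (cases "(x \<in> \<Omega>) = (y \<in> \<Omega>)")
      case True
      then show ?thesis using u(2)[of x] u(2)[of y] by (cases "x \<in> \<Omega>") (auto simp: Q_set_def)
    next
      case False
      have "\<bar>u x - u y\<bar> \<le> 2" using u(1)[of x] u(1)[of y] by linarith
      then have "\<bar>u x - u y\<bar>\<^sup>2 \<le> 2\<^sup>2" by (rule power_mono) simp
      then have "\<bar>u x - u y\<bar>\<^sup>2 * kern s (x - y) \<le> 4 * kern s (x - y)" by (intro mult_right_mono) auto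
      moreover have "\<bar>indicator \<Omega> x - indicator \<Omega> y\<bar> = (1::real)" using False by (auto simp: indicator_def)
      moreover have "ennreal 4 * ennreal (kern s (x - y)) = ennreal (4 * kern s (x - y))"
        by (rule ennreal_mult[symmetric]) auto
      ultimately show ?thesis
        by (cases "(x, y) \<in> Q_set \<Omega>") (auto simp del: ennreal_numeral intro: ennreal_leI)
    qed
  qed
  also have "\<dots> = ennreal 4 * (\<integral>\<^sup>+x. \<integral>\<^sup>+y. ennreal (\<bar>indicator \<Omega> x - indicator \<Omega> y\<bar> * kern s (x - y)) \<partial>lborel \<partial>lborel)"
    by (simp add: nn_integral_cmult)
  also have "\<dots> \<le> ennreal 4 * ennreal (M * kern_const s TYPE('a) / 1 powr (2 * s))"
    using M by (intro mult_left_mono seminorm_bound[OF s]) auto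
  also have "\<dots> < top" by (simp add: ennreal_mult_less_top)
  finally show ?thesis .
qed

text \<open>Paths run down along \<open>-e\<close> from a small ball above p until they reach the
  graph, and are then lifted so that the cutoff balls stay in \<open>\<Omega>\<close>. Seen from
  there, one phase is nearby and the datum is found a bounded multiple of \<open>\<delta>\<close>
  below.\<close>

lemma boundary_mixed_family:
  fixes \<Omega> :: "'a::euclidean_space set"
  assumes ch: "lipschitz_chart \<Omega> p \<rho>0 e f \<Lambda>" and \<rho>: "0 < \<rho>" "\<rho> \<le> \<rho>0"
    and [measurable]: "u \<in> borel_measurable borel" and c1: "0 < c1"
    and out: "\<And>y. y \<in> ball p \<rho> \<Longrightarrow> y \<notin> \<Omega> \<Longrightarrow> c1 \<le> 1 - \<sigma> * u y"
    and ins: "AE x in lborel. x \<in> \<Omega> \<inter> ball p \<rho> \<longrightarrow> u x = \<sigma>"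
  shows "mixed_family \<Omega> u"
proof -
  have e: "norm e = 1" and \<Lambda>: "1 \<le> \<Lambda>" and fp: "f p = 0" and lip: "\<And>x y. \<bar>f x - f y\<bar> \<le> \<Lambda> * norm (x - y)"
    and tr: "\<And>x t. f (x + t *\<^sub>R e) = f x + t" and mem: "\<And>x. x \<in> ball p \<rho> \<Longrightarrow> x \<in> \<Omega> \<longleftrightarrow> 0 < f x"
    using ch \<rho> by (auto simp: lipschitz_chart_def)
  define \<omega> where "\<omega> = unit_ball_vol (DIM('a))"
  have \<omega>: "0 < \<omega>" by (simp add: \<omega>_def)
  have vol: "emeasure lborel (ball x r) = ennreal (\<omega> * r ^ DIM('a))" if "0 \<le> r" for x :: 'a and r
    using that by (simp add: emeasure_ball \<omega>_def)
  define h where "h = \<rho> / 8"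
  have h: "0 < h" "\<rho> = 8 * h" using \<rho> by (auto simp: h_def)
  \<comment> \<open>With \<open>\<Lambda> * \<eta> = h / 2\<close> all heights on
    \<open>ball a \<eta>\<close> lie between h/2 and 3h/2.\<close>
  define \<eta> where "\<eta> = h / (2 * \<Lambda>)"
  have \<eta>: "0 < \<eta>" "\<eta> \<le> h" "\<Lambda> * \<eta> = h / 2"
    using h \<Lambda> by (auto simp: \<eta>_def field_simps intro: order_trans[of _ "h * 1"])
  \<comment> \<open>A height above M \<open>\<delta>\<close> stays positive within distance 2
    \<open>\<delta>\<close>.\<close>
  define M where "M = 2 * \<Lambda>"
  define R where "R = 2 * M + 2"
  \<comment> \<open>Keeps centres within 5h + M \<open>\<delta>\<close> of p, together with balls of
    radius R \<open>\<delta>\<close>, inside the chart: 5h + (3M+2) \<open>\<delta>\<close> < 8h =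
    \<open>\<rho>\<close>.\<close>
  define \<delta>0 where "\<delta>0 = min 1 (h / (2 * M + 5))"
  have \<delta>0: "0 < \<delta>0" using h \<Lambda> by (simp add: \<delta>0_def M_def)
  define a where "a = p + h *\<^sub>R e"
  define c2 where "c2 = \<omega> * \<eta> ^ DIM('a) / (2 * h + 1)"
  define c where "c = min (min \<omega> c1) c2"
  have c: "0 < c" using \<omega> c1 \<eta> h by (simp add: c_def c2_def)
  have main: "\<exists>G. (\<forall>y\<in>G. ball y (2 * \<delta>) \<subseteq> \<Omega> \<and> mixed_at u c R \<delta> y) \<and>
        ennreal (c * \<delta>) \<le> emeasure lborel (\<Union>y\<in>G. ball y (2 * \<delta>))" if \<delta>: "0 < \<delta>" "\<delta> < \<delta>0" for \<delta>
  proof -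
    have "\<delta> < h / (2 * M + 5)" using \<delta> by (simp add: \<delta>0_def)
    then have small: "(2 * M + 5) * \<delta> < h" using \<Lambda> by (simp add: M_def field_simps)
    have \<delta>1: "\<delta> < 1" using \<delta> by (simp add: \<delta>0_def)
    obtain N where N: "0 < N" "2 * h \<le> real N * \<delta>" "real N * \<delta> \<le> 2 * h + \<delta>"
      using nat_ceiling_steps[of \<delta> "2 * h"] \<delta> h by auto
    define G where "G = {y. ball y (2 * \<delta>) \<subseteq> \<Omega> \<and> mixed_at u c R \<delta> y}"
    define A where "A = (\<Union>y\<in>G. ball y (2 * \<delta>))"
    have [measurable]: "A \<in> sets borel" unfolding A_def by (intro borel_open open_UN) auto
    have good: "y \<in> G"
      if y: "dist p y < 5 * h + M * \<delta>" "M * \<delta> < f y" "f y \<le> (M + 1) * \<delta>" for y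
    proof -
      have b: "x \<in> ball p \<rho>" if "dist y x < R * \<delta>" for x
      proof -
        have "dist p x \<le> dist p y + dist y x" by (rule dist_triangle)
        moreover have "M * \<delta> + R * \<delta> \<le> (2 * M + 5) * \<delta> + M * \<delta>"
          using \<delta> by (simp add: R_def algebra_simps)
        moreover have "M * \<delta> \<le> (2 * M + 5) * \<delta>" using \<Lambda> \<delta> by (intro mult_right_mono) (auto simp: M_def)
        ultimately show ?thesis using y(1) that small h by simp
      qed
      have b2: "ball y (2 * \<delta>) \<subseteq> ball y (R * \<delta>)"
        using \<delta> \<Lambda> by (intro subset_ball mult_right_mono) (auto simp: R_def M_def)
      have sub: "ball y (2 * \<delta>) \<subseteq> \<Omega>"
      proof
        fix x assume x: "x \<in> ball y (2 * \<delta>)"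
        have "\<Lambda> * norm (y - x) \<le> \<Lambda> * (2 * \<delta>)" using x \<Lambda> by (intro mult_left_mono) (auto simp: dist_norm)
        then have "0 < f x" using lip[of y x] y(2) by (simp add: M_def)
        moreover have "x \<in> ball p \<rho>" using b x b2 by auto
        ultimately show "x \<in> \<Omega>" using mem by blast
      qed
      \<comment> \<open>From a height of at most (M+1) \<open>\<delta>\<close> this descent ends at
        height at most -M \<open>\<delta>\<close>, so \<open>ball w \<delta>\<close> misses
        \<open>\<Omega>\<close>. Its distance from y plus the radius \<open>\<delta>\<close> is
        exactly R \<open>\<delta>\<close>.\<close>
      define w where "w = y + (- ((2 * M + 1) * \<delta>)) *\<^sub>R e"
      have fw: "f w \<le> - (M * \<delta>)" using y(3) by (simp only: w_def tr) (simp add: algebra_simps)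
      have yw: "dist y w = (2 * M + 1) * \<delta>" using e \<delta> \<Lambda> by (simp add: w_def dist_norm M_def)
      have wsub: "ball w \<delta> \<subseteq> ball y (R * \<delta>)"
      proof
        fix x assume "x \<in> ball w \<delta>"
        then show "x \<in> ball y (R * \<delta>)" using dist_triangle[of y x w] yw by (simp add: R_def algebra_simps)
      qed
      have wout: "x \<notin> \<Omega> \<and> x \<in> ball p \<rho>" if x: "x \<in> ball w \<delta>" for x
      proof -
        have xb: "x \<in> ball p \<rho>" using b wsub x by auto
        have "\<Lambda> * norm (x - w) \<le> \<Lambda> * \<delta>" using x \<Lambda> by (intro mult_left_mono) (auto simp: dist_norm norm_minus_commute)
        moreover have "\<Lambda> * \<delta> \<le> M * \<delta>" using \<Lambda> \<delta> by (simp add: M_def)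
        ultimately have "f x \<le> 0" using lip[of x w] fw by linarith
        then show ?thesis using mem[OF xb] xb by auto
      qed
      have "mixed_at u c R \<delta> y"
        unfolding mixed_at_def
      proof (rule bexI[of _ "{x \<in> ball y \<delta>. u x = \<sigma>}"], rule bexI[of _ "ball w \<delta>"], intro conjI ballI)
        have cle: "ennreal (c * \<delta> ^ DIM('a)) \<le> ennreal (\<omega> * \<delta> ^ DIM('a))"
          using \<delta> by (intro ennreal_leI mult_right_mono) (auto simp: c_def)
        have "emeasure lborel {x \<in> ball y \<delta>. u x = \<sigma>} = emeasure lborel (ball y \<delta>)"
        proof (rule emeasure_eq_AE)
          show "AE x in lborel. x \<in> {x \<in> ball y \<delta>. u x = \<sigma>} \<longleftrightarrow> x \<in> ball y \<delta>"
            using ins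
          proof eventually_elim
            case (elim x)
            have "x \<in> ball y \<delta> \<Longrightarrow> x \<in> ball y (2 * \<delta>)" using \<delta> by auto
            then have "x \<in> ball y \<delta> \<Longrightarrow> x \<in> \<Omega> \<inter> ball p \<rho>" using sub b b2 by auto
            then show ?case using elim by auto
          qed
        qed auto
        then show "ennreal (c * \<delta> ^ DIM('a)) \<le> emeasure lborel {x \<in> ball y \<delta>. u x = \<sigma>}"
          using cle \<delta> by (simp add: vol)
        show "ennreal (c * \<delta> ^ DIM('a)) \<le> emeasure lborel (ball w \<delta>)"
          using cle \<delta> by (simp add: vol)
      next
        fix x z assume "x \<in> {x \<in> ball y \<delta>. u x = \<sigma>}" "z \<in> ball w \<delta>"
        then show "c \<le> 1 - u x * u z" using out[of z] wout[of z] by (simp add: c_def min_le_iff_disj)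
      qed (use wsub in auto)
      with sub show "y \<in> G" by (simp add: G_def)
    qed
    have hit: "\<exists>j<N. ((M - real j) * \<delta>) *\<^sub>R e + x \<in> A" if x: "x \<in> ball a \<eta>" for x
    proof -
      have fa: "f a = h" by (simp add: a_def tr fp)
      have "\<Lambda> * norm (x - a) \<le> \<Lambda> * \<eta>" using x \<Lambda> by (intro mult_left_mono) (auto simp: dist_norm norm_minus_commute)
      then have fx: "h / 2 \<le> f x" "f x \<le> 3 * h / 2" using lip[of x a] fa \<eta>(3) by auto
      \<comment> \<open>One step earlier, at i = j - 1 < N, the height is in (0,
        \<open>\<delta>\<close>]; a lift by M \<open>\<delta>\<close> gives what \<open>good\<close>
        asks for. The total shift (M - i) \<open>\<delta>\<close> depends on i alone, as
        \<open>emeasure_le_translates\<close> requires.\<close>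
      define j where "j = (LEAST j::nat. f x - real j * \<delta> \<le> 0)"
      have PN: "f x - real N * \<delta> \<le> 0" using fx N(2) h by linarith
      then have j0: "f x - real j * \<delta> \<le> 0" and jN: "j \<le> N" unfolding j_def by (auto intro: LeastI Least_le)
      have "j \<noteq> 0" using j0 fx h by (intro notI) simp
      then obtain i where i: "j = Suc i" using not0_implies_Suc by blast
      then have i0: "0 < f x - real i * \<delta>"
        using not_less_Least[of i "\<lambda>j. f x - real j * \<delta> \<le> 0"] by (simp add: j_def)
      define y where "y = x + ((M - real i) * \<delta>) *\<^sub>R e"
      have fy: "f y = f x - real i * \<delta> + M * \<delta>" unfolding y_def tr by (simp add: algebra_simps)
      have "dist p y \<le> dist p a + dist a x + dist x y"
        using dist_triangle[of p y a] dist_triangle[of a y x] by linarith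
      moreover have "dist p a = h" using e h by (simp add: a_def dist_norm)
      moreover have "dist a x < h" using x \<eta> by simp
      moreover have "dist x y \<le> M * \<delta> + real i * \<delta>"
      proof -
        have "dist x y = \<bar>M - real i\<bar> * \<delta>" using e \<delta> by (simp add: y_def dist_norm abs_mult)
        also have "\<dots> \<le> (M + real i) * \<delta>" using \<delta> \<Lambda> by (intro mult_right_mono) (auto simp: M_def)
        finally show ?thesis by (simp add: algebra_simps)
      qed
      moreover have "real i * \<delta> < 2 * h" using i0 fx h by linarith
      ultimately have "dist p y < 5 * h + M * \<delta>" using h by linarith
      moreover have "f y \<le> (M + 1) * \<delta>" using j0 by (simp add: fy i algebra_simps)
      ultimately have "y \<in> G" using i0 by (intro good) (auto simp: fy)
      then have "y \<in> A" using \<delta> unfolding A_def by (intro UN_I[of y]) auto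
      then show ?thesis using i jN by (auto simp: y_def add.commute intro!: exI[of _ i])
    qed
    have "emeasure lborel (ball a \<eta>) \<le> of_nat N * emeasure lborel A"
      by (rule emeasure_le_translates[OF _ hit]) auto
    moreover have "real N \<le> (2 * h + 1) / \<delta>" using N(3) \<delta> \<delta>1 by (simp add: field_simps)
    ultimately have "ennreal (\<omega> * \<eta> ^ DIM('a)) \<le> ennreal ((2 * h + 1) / \<delta>) * emeasure lborel A"
      using \<eta> by (simp add: vol)
        (metis (no_types, lifting) ennreal_leI ennreal_of_nat_eq_real_of_nat mult_right_mono order_trans zero_le)
    then have "ennreal (\<delta> / (2 * h + 1)) * ennreal (\<omega> * \<eta> ^ DIM('a))
        \<le> ennreal (\<delta> / (2 * h + 1)) * (ennreal ((2 * h + 1) / \<delta>) * emeasure lborel A)"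
      by (rule mult_left_mono) simp
    also have "\<dots> = emeasure lborel A"
    proof -
      have "\<delta> / (2 * h + 1) * ((2 * h + 1) / \<delta>) = 1" using \<delta> h by simp
      then show ?thesis using \<delta> h by (simp add: mult.assoc[symmetric] flip: ennreal_mult)
    qed
    finally have "ennreal (c2 * \<delta>) \<le> emeasure lborel A"
      using \<delta> h \<omega> \<eta> by (simp add: c2_def mult.commute flip: ennreal_mult)
    moreover have "ennreal (c * \<delta>) \<le> ennreal (c2 * \<delta>)"
      using \<delta> by (intro ennreal_leI mult_right_mono) (auto simp: c_def)
    ultimately have "ennreal (c * \<delta>) \<le> emeasure lborel A" by (rule order_trans[rotated])
    then show ?thesis by (intro exI[of _ G]) (auto simp: G_def A_def simp del: mem_ball)
  qed
  have R: "1 \<le> R" using \<Lambda> by (simp add: R_def M_def)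
  show ?thesis
    unfolding mixed_family_def
    by (rule exI[of _ c], rule conjI[OF c], rule exI[of _ R], rule conjI[OF R],
        rule exI[of _ \<delta>0], rule conjI[OF \<delta>0]) (use main in blast)
qed

subsection \<open>Minimizers\<close>

lemma interior_ess_boundary_mixed_family:
  fixes \<Omega> E :: "'a::euclidean_space set"
  assumes z: "z \<in> ess_boundary E" and r: "0 < r" "ball z r \<subseteq> \<Omega>" and E: "E \<in> sets borel"
    and u: "\<And>x. x \<in> \<Omega> \<Longrightarrow> x \<in> E \<Longrightarrow> u x = 1" "\<And>x. x \<in> \<Omega> \<Longrightarrow> x \<notin> E \<Longrightarrow> u x = -1"
  shows "mixed_family \<Omega> u"
proof (rule interior_mixed_family[OF r E u])
  let ?B = "ball z (r/2)"
  have [measurable]: "E \<in> sets borel" by (rule E)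
  have "0 < r / 2" using r by simp
  then have e: "0 < emeasure lebesgue (E \<inter> ?B)" "emeasure lebesgue (E \<inter> ?B) < emeasure lebesgue ?B"
    using z unfolding ess_boundary_def by blast+
  have l: "emeasure lebesgue (E \<inter> ?B) = emeasure lborel (E \<inter> ?B)" "emeasure lebesgue ?B = emeasure lborel ?B"
    by (simp_all add: main_part_sets)
  show "0 < emeasure lborel (E \<inter> ?B)" using e l by simp
  show "0 < emeasure lborel (- E \<inter> ?B)"
  proof (rule ccontr)
    assume "\<not> ?thesis"
    then have 0: "emeasure lborel (- E \<inter> ?B) = 0" by simp
    have "emeasure lborel ?B = emeasure lborel ((E \<inter> ?B) \<union> (- E \<inter> ?B))"
      by (intro arg_cong[where f="emeasure lborel"]) auto
    also have "\<dots> \<le> emeasure lborel (E \<inter> ?B) + emeasure lborel (- E \<inter> ?B)"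
      by (intro emeasure_subadditive) auto
    finally show False using 0 e l by simp
  qed
qed

section \<open>Essential boundary and connected components\<close>

lemma ess_boundary_AE_cong:
  assumes "AE x in lebesgue. x \<in> E \<longleftrightarrow> x \<in> E'" and [measurable]: "E \<in> sets lebesgue" "E' \<in> sets lebesgue"
  shows "ess_boundary E = ess_boundary (E' :: 'a::euclidean_space set)"
proof -
  have "emeasure lebesgue (E \<inter> ball x r) = emeasure lebesgue (E' \<inter> ball x r)" for x r
    by (rule emeasure_eq_AE) (use assms in auto)
  then show ?thesis by (simp add: ess_boundary_def)
qed

text \<open>The points near which \<open>S\<close> is null and those near which its complement is
  null form disjoint open sets, which cover \<open>\<Omega>\<close> when it contains no essential
  boundary point. Connectedness leaves only one of them, and a locally null set is null.\<close>

lemma pure_phase_on_component: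
  fixes \<Omega> S :: "'a::euclidean_space set"
  assumes \<Omega>: "open \<Omega>" "connected \<Omega>" and S: "S \<in> sets borel" and no: "\<Omega> \<inter> ess_boundary S = {}"
  shows "(AE x in lborel. x \<in> \<Omega> \<longrightarrow> x \<in> S) \<or> (AE x in lborel. x \<in> \<Omega> \<longrightarrow> x \<notin> S)"
proof -
  have [measurable]: "S \<in> sets borel" by (rule S)
  define U where "U = (\<lambda>T. {x \<in> \<Omega>. \<exists>\<rho>>0. negligible (T \<inter> ball x \<rho>)})"
  have op: "open (U T)" for T
  proof (rule openI)
    fix x assume "x \<in> U T"
    then obtain \<rho> where x: "x \<in> \<Omega>" "0 < \<rho>" "negligible (T \<inter> ball x \<rho>)" by (auto simp: U_def)
    then obtain r where r: "0 < r" "ball x r \<subseteq> \<Omega>" using \<Omega>(1) openE by blast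
    have "ball x (min r \<rho>) \<subseteq> U T"
    proof
      fix y assume y: "y \<in> ball x (min r \<rho>)"
      have "ball y (\<rho> - dist x y) \<subseteq> ball x \<rho>"
      proof
        fix w assume "w \<in> ball y (\<rho> - dist x y)"
        then show "w \<in> ball x \<rho>" using dist_triangle[of x w y] by simp
      qed
      then have "negligible (T \<inter> ball y (\<rho> - dist x y))"
        by (intro negligible_subset[OF x(3)]) blast
      moreover have "0 < \<rho> - dist x y" using y by simp
      moreover have "y \<in> \<Omega>" using y r by auto
      ultimately show "y \<in> U T" unfolding U_def by blast
    qed
    then show "\<exists>e>0. ball x e \<subseteq> U T" using r x by (intro exI[of _ "min r \<rho>"]) auto
  qed
  have disj: "U S \<inter> U (- S) = {}"
  proof (rule ccontr)
    assume "U S \<inter> U (- S) \<noteq> {}"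
    then obtain x \<rho> \<rho>' where x: "0 < \<rho>" "negligible (S \<inter> ball x \<rho>)" "0 < \<rho>'" "negligible (- S \<inter> ball x \<rho>')"
      by (auto simp: U_def)
    have "negligible ((S \<inter> ball x \<rho>) \<union> (- S \<inter> ball x \<rho>'))" using x by (intro negligible_Un)
    then have "negligible (ball x (min \<rho> \<rho>'))" by (rule negligible_subset) auto
    then show False using open_not_negligible[of "ball x (min \<rho> \<rho>')"] x by auto
  qed
  have cov: "\<Omega> \<subseteq> U S \<union> U (- S)"
  proof
    fix x assume x: "x \<in> \<Omega>"
    then have "x \<notin> ess_boundary S" using no by auto
    then obtain \<rho> where \<rho>: "0 < \<rho>"
      "\<not> (0 < emeasure lebesgue (S \<inter> ball x \<rho>) \<and> emeasure lebesgue (S \<inter> ball x \<rho>) < emeasure lebesgue (ball x \<rho>))"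
      unfolding ess_boundary_def by blast
    show "x \<in> U S \<union> U (- S)"
    proof (cases "emeasure lebesgue (S \<inter> ball x \<rho>) = 0")
      case True
      then have "negligible (S \<inter> ball x \<rho>)" by (simp add: negligible_iff_null_sets null_setsI)
      then show ?thesis using \<rho>(1) x by (auto simp: U_def)
    next
      case False
      then have ge: "emeasure lebesgue (ball x \<rho>) \<le> emeasure lebesgue (S \<inter> ball x \<rho>)"
        using \<rho>(2) by (auto simp: not_less zero_less_iff_neq_zero)
      have ballfin: "emeasure lebesgue (ball x \<rho>) < top"
        using emeasure_lborel_ball_finite[of x \<rho>] by (simp add: main_part_sets)
      have "emeasure lebesgue (S \<inter> ball x \<rho>) \<le> emeasure lebesgue (ball x \<rho>)"
        by (intro emeasure_mono) auto
      then have fin: "emeasure lebesgue (S \<inter> ball x \<rho>) \<noteq> \<infinity>"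
        using ballfin by auto
      have "emeasure lebesgue (- S \<inter> ball x \<rho>) = emeasure lebesgue (ball x \<rho> - S \<inter> ball x \<rho>)"
        by (intro arg_cong[where f="emeasure lebesgue"]) auto
      also have "\<dots> = emeasure lebesgue (ball x \<rho>) - emeasure lebesgue (S \<inter> ball x \<rho>)"
        using fin by (intro emeasure_Diff) auto
      also have "\<dots> = 0" using ge ballfin by (simp add: diff_eq_0_iff_ennreal)
      finally have "negligible (- S \<inter> ball x \<rho>)" by (simp add: negligible_iff_null_sets null_setsI)
      then show ?thesis using \<rho>(1) x by (auto simp: U_def)
    qed
  qed
  have ae: "AE x in lborel. x \<in> \<Omega> \<longrightarrow> x \<notin> T" if T: "T \<in> sets borel" "\<Omega> \<subseteq> U T" for T
  proof -
    have "negligible (\<Omega> \<inter> T)"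
    proof (subst locally_negligible_alt, intro ballI)
      fix x assume x: "x \<in> \<Omega> \<inter> T"
      then obtain \<rho> where "0 < \<rho>" "negligible (T \<inter> ball x \<rho>)" using T(2) by (auto simp: U_def)
      then show "\<exists>V. openin (top_of_set (\<Omega> \<inter> T)) V \<and> x \<in> V \<and> negligible V"
        using x by (intro exI[of _ "\<Omega> \<inter> T \<inter> ball x \<rho>"]) (auto simp: openin_open intro: negligible_subset)
    qed
    then have "\<Omega> \<inter> T \<in> null_sets lborel"
      using T(1) \<Omega>(1) by (simp add: negligible_iff_null_sets null_sets_completion_iff)
    then show ?thesis by (rule AE_I') auto
  qed
  have "U S \<inter> \<Omega> = {} \<or> U (- S) \<inter> \<Omega> = {}"
    using connectedD[OF \<Omega>(2) op op, of S "- S"] disj cov by auto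
  then have "\<Omega> \<subseteq> U (- S) \<or> \<Omega> \<subseteq> U S" using cov by blast
  then show ?thesis using ae[of S] ae[of "- S"] S by auto
qed

text \<open>Excludes that other components of \<open>\<Omega>\<close> come arbitrarily close to p.
  Above the graph, every nearby point of \<open>\<Omega>\<close> is joined within
  \<open>\<Omega>\<close> to one common ball around a point straight above p.\<close>

lemma chart_in_component:
  fixes \<Omega> :: "'a::euclidean_space set"
  assumes ch: "lipschitz_chart \<Omega> p \<rho> e f \<Lambda>" and C: "C \<in> components \<Omega>" "p \<in> closure C"
  obtains r where "0 < r" "r \<le> \<rho>" "\<Omega> \<inter> ball p r \<subseteq> C"
proof -
  have \<rho>: "0 < \<rho>" and e: "norm e = 1" and \<Lambda>: "1 \<le> \<Lambda>" and fp: "f p = 0" and lip: "\<And>x y. \<bar>f x - f y\<bar> \<le> \<Lambda> * norm (x - y)"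
    and tr: "\<And>x t. f (x + t *\<^sub>R e) = f x + t" and mem: "\<And>x. x \<in> ball p \<rho> \<Longrightarrow> x \<in> \<Omega> \<longleftrightarrow> 0 < f x"
    using ch by (auto simp: lipschitz_chart_def)
  \<comment> \<open>With t = \<open>\<rho>\<close>/2 this gives \<open>\<Lambda>\<close> r =
    \<open>\<rho>\<close>/4 < t: the ball of radius r around p + t e has positive height and lies in
    \<open>\<Omega>\<close>.\<close>
  define r where "r = \<rho> / (4 * \<Lambda>)"
  define t where "t = \<rho> / 2"
  have \<rho>r: "\<rho> = 4 * \<Lambda> * r" using \<Lambda> by (simp add: r_def)
  have r0: "0 < r" using \<rho> \<Lambda> by (simp add: r_def)
  have r: "4 * r \<le> \<rho>" "\<Lambda> * r < t" "0 < t"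
    using \<Lambda> r0 by (auto simp: \<rho>r t_def)
  define V where "V = (\<lambda>x. closed_segment x (x + t *\<^sub>R e) \<union> ball (p + t *\<^sub>R e) r)"
  define A where "A = (\<Union>x\<in>\<Omega> \<inter> ball p r. V x)"
  have shifted: "x + t *\<^sub>R e \<in> ball (p + t *\<^sub>R e) r" if "x \<in> ball p r" for x
    using that by (simp add: dist_norm algebra_simps)
  have "connected (V x)" if "x \<in> ball p r" for x
    unfolding V_def using shifted[OF that] by (intro connected_Un) (auto simp del: mem_ball)
  moreover have "p + t *\<^sub>R e \<in> V x" for x using r0 by (simp add: V_def)
  ultimately have conn: "connected A"
    unfolding A_def by (intro connected_Union) blast+
  have VO: "V x \<subseteq> \<Omega>" if x: "x \<in> \<Omega> \<inter> ball p r" for x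
  proof
    fix y assume "y \<in> V x"
    then consider "y \<in> closed_segment x (x + t *\<^sub>R e)" | "y \<in> ball (p + t *\<^sub>R e) r" by (auto simp: V_def)
    then show "y \<in> \<Omega>"
    proof cases
      case 1
      then obtain l where l: "0 \<le> l" "l \<le> 1" "y = (1 - l) *\<^sub>R x + l *\<^sub>R (x + t *\<^sub>R e)"
        by (auto simp: closed_segment_def)
      then have y: "y = x + (l * t) *\<^sub>R e" by (simp add: algebra_simps)
      have "0 < f x" using x mem[of x] r r0 by auto
      moreover have "f y = f x + l * t" unfolding y by (rule tr)
      ultimately have "0 < f y" using l r by (simp add: add_pos_nonneg)
      moreover have "y \<in> ball p \<rho>"
      proof -
        have "dist p y \<le> dist p x + dist x y" by (rule dist_triangle)
        moreover have "dist x y = l * t" unfolding y dist_norm using e l(1,2) r by simp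
        moreover have "l * t \<le> t" using mult_right_mono[of l 1 t] l r by simp
        ultimately have "dist p y < r + t" using x by auto
        then show ?thesis using r r0 by (simp add: t_def)
      qed
      ultimately show ?thesis using mem by blast
    next
      case 2
      have "\<Lambda> * norm ((p + t *\<^sub>R e) - y) \<le> \<Lambda> * r"
        using 2 \<Lambda> by (intro mult_left_mono) (auto simp: dist_norm)
      then have "0 < f y" using lip[of "p + t *\<^sub>R e" y] r(2) by (simp add: tr fp)
      moreover have "y \<in> ball p \<rho>"
      proof -
        have "dist p y \<le> dist p (p + t *\<^sub>R e) + dist (p + t *\<^sub>R e) y" by (rule dist_triangle)
        moreover have "dist p (p + t *\<^sub>R e) = t" using e r by (simp add: dist_norm)
        ultimately show ?thesis using 2 r r0 by (simp add: t_def)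
      qed
      ultimately show ?thesis using mem by blast
    qed
  qed
  have AO: "A \<subseteq> \<Omega>" unfolding A_def using VO by blast
  have sub: "\<Omega> \<inter> ball p r \<subseteq> A" by (auto simp: A_def V_def)
  obtain x where "x \<in> C" "dist x p < r" using C(2) r0 by (meson closure_approachable)
  moreover have "C \<subseteq> \<Omega>" using C(1) by (rule in_components_subset)
  ultimately have "x \<in> C \<inter> A" using sub by (auto simp: dist_commute)
  then have "A \<subseteq> C" using components_maximal[OF C(1) conn AO] by auto
  then show ?thesis using sub r r0 by (intro that[of r]) auto
qed

section \<open>The limit energy and Borel representatives\<close>

lemma interaction_AE_cong:
  fixes u u' w w' :: "'a::euclidean_space \<Rightarrow> real"
  assumes u: "AE x in lebesgue. u x = u' x" and w: "AE x in lebesgue. w x = w' x"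
  shows "interaction s A u w = interaction s A u' w'"
proof -
  interpret lebesgue: sigma_finite_measure "lebesgue :: 'a measure" by (rule sigma_finite_lebesgue)
  obtain N M where N: "{x. u x \<noteq> u' x} \<subseteq> N" "N \<in> null_sets (lebesgue :: 'a measure)"
    and M: "{x. w x \<noteq> w' x} \<subseteq> M" "M \<in> null_sets (lebesgue :: 'a measure)"
    using u w unfolding eventually_ae_filter by auto
  have "N \<times> UNIV \<in> null_sets (lebesgue \<Otimes>\<^sub>M (lebesgue :: 'a measure))"
    using N(2) by (intro null_setsI) (auto simp: lebesgue.emeasure_pair_measure_Times null_setsD1 null_setsD2)
  moreover have "UNIV \<times> M \<in> null_sets ((lebesgue :: 'a measure) \<Otimes>\<^sub>M lebesgue)"
    using M(2) by (intro null_setsI) (auto simp: lebesgue.emeasure_pair_measure_Times null_setsD1 null_setsD2)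
  ultimately have "N \<times> UNIV \<union> UNIV \<times> M \<in> null_sets (lebesgue \<Otimes>\<^sub>M lebesgue)" by (rule null_sets.Un)
  then have "AE z in lebesgue \<Otimes>\<^sub>M lebesgue. u (fst z) = u' (fst z) \<and> w (snd z) = w' (snd z)"
    by (rule AE_I') (use N M in auto)
  then show ?thesis unfolding interaction_def by (intro nn_integral_cong_AE) auto
qed

text \<open>\<open>Q_set \<Omega>\<close> is the disjoint union of the pairs inside, inside-outside
  and outside-inside. The last two contribute equally by the symmetry of the kernel, which explains
  the factor 2 in \<open>F1\<close>.\<close>

lemma interaction_Q_set_split:
  fixes u g :: "'a::euclidean_space \<Rightarrow> real"
  assumes [measurable]: "\<Omega> \<in> sets borel" "u \<in> borel_measurable borel" "g \<in> borel_measurable borel"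
    and ug: "\<And>x. x \<notin> \<Omega> \<Longrightarrow> u x = g x"
  shows "interaction s (Q_set \<Omega>) u u = interaction s (\<Omega> \<times> \<Omega>) u u + 2 * interaction s (\<Omega> \<times> (- \<Omega>)) u g"
proof -
  have Q: "Q_set \<Omega> \<in> sets (borel \<Otimes>\<^sub>M borel)" "\<Omega> \<times> \<Omega> \<in> sets (borel \<Otimes>\<^sub>M borel)"
    "\<Omega> \<times> (- \<Omega>) \<in> sets (borel \<Otimes>\<^sub>M borel)" "(- \<Omega>) \<times> \<Omega> \<in> sets (borel \<Otimes>\<^sub>M borel)"
    unfolding Q_set_def by measurable
  note [measurable] = Q
  note Q' = Q[unfolded borel_prod]
  let ?k = "\<lambda>x y. ennreal (\<bar>u x - u y\<bar>\<^sup>2 * kern s (x - y))"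
  have eq: "interaction s (\<Omega> \<times> (- \<Omega>)) u g
      = (\<integral>\<^sup>+x. \<integral>\<^sup>+y. ?k x y * indicator (\<Omega> \<times> (- \<Omega>)) (x, y) \<partial>lborel \<partial>lborel)"
    unfolding interaction_eq_iterated[OF Q'(3) assms(2,3)]
    by (intro nn_integral_cong) (auto simp: indicator_def ug)
  have sym: "(\<integral>\<^sup>+x. \<integral>\<^sup>+y. ?k x y * indicator ((- \<Omega>) \<times> \<Omega>) (x, y) \<partial>lborel \<partial>lborel)
      = (\<integral>\<^sup>+x. \<integral>\<^sup>+y. ?k x y * indicator (\<Omega> \<times> (- \<Omega>)) (x, y) \<partial>lborel \<partial>lborel)"
  proof -
    have "(\<integral>\<^sup>+x. \<integral>\<^sup>+y. ?k x y * indicator ((- \<Omega>) \<times> \<Omega>) (x, y) \<partial>lborel \<partial>lborel)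
        = (\<integral>\<^sup>+y. \<integral>\<^sup>+x. ?k x y * indicator ((- \<Omega>) \<times> \<Omega>) (x, y) \<partial>lborel \<partial>lborel)"
      by (rule lborel_pair.Fubini') measurable
    also have "\<dots> = (\<integral>\<^sup>+x. \<integral>\<^sup>+y. ?k x y * indicator (\<Omega> \<times> (- \<Omega>)) (x, y) \<partial>lborel \<partial>lborel)"
      by (intro nn_integral_cong) (auto simp: indicator_def abs_minus_commute kern_commute)
    finally show ?thesis .
  qed
  have "interaction s (Q_set \<Omega>) u u = (\<integral>\<^sup>+x. \<integral>\<^sup>+y. ?k x y * indicator (\<Omega> \<times> \<Omega>) (x, y)
      + (?k x y * indicator (\<Omega> \<times> (- \<Omega>)) (x, y) + ?k x y * indicator ((- \<Omega>) \<times> \<Omega>) (x, y)) \<partial>lborel \<partial>lborel)"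
    unfolding interaction_eq_iterated[OF Q'(1) assms(2,2)]
    by (intro nn_integral_cong) (auto simp: Q_set_def indicator_def)
  also have "\<dots> = (\<integral>\<^sup>+x. \<integral>\<^sup>+y. ?k x y * indicator (\<Omega> \<times> \<Omega>) (x, y) \<partial>lborel \<partial>lborel)
      + ((\<integral>\<^sup>+x. \<integral>\<^sup>+y. ?k x y * indicator (\<Omega> \<times> (- \<Omega>)) (x, y) \<partial>lborel \<partial>lborel)
        + (\<integral>\<^sup>+x. \<integral>\<^sup>+y. ?k x y * indicator ((- \<Omega>) \<times> \<Omega>) (x, y) \<partial>lborel \<partial>lborel))"
    by (simp add: nn_integral_add)
  also have "\<dots> = interaction s (\<Omega> \<times> \<Omega>) u u + (interaction s (\<Omega> \<times> (- \<Omega>)) u g + interaction s (\<Omega> \<times> (- \<Omega>)) u g)"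
    unfolding sym eq interaction_eq_iterated[OF Q'(2) assms(2,2)] ..
  finally show ?thesis by (simp add: mult_2)
qed

lemma F1_eq_interaction:
  fixes u g :: "'a::euclidean_space \<Rightarrow> real"
  assumes "\<Omega> \<in> sets borel" "u \<in> borel_measurable borel" "g \<in> borel_measurable borel"
    and "\<And>x. x \<notin> \<Omega> \<Longrightarrow> u x = g x" and "is_phase \<Omega> u' E" and "AE x in lebesgue. u' x = u x"
  shows "F1 s \<Omega> g u' = interaction s (Q_set \<Omega>) u u"
proof -
  have "F1 s \<Omega> g u' = interaction s (\<Omega> \<times> \<Omega>) u' u' + 2 * interaction s (\<Omega> \<times> (- \<Omega>)) u' g"
    using assms(5) unfolding F1_def by auto
  also have "\<dots> = interaction s (\<Omega> \<times> \<Omega>) u u + 2 * interaction s (\<Omega> \<times> (- \<Omega>)) u g"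
    using interaction_AE_cong[OF assms(6,6)] interaction_AE_cong[OF assms(6), of g g] by simp
  finally show ?thesis using interaction_Q_set_split[OF assms(1-4)] by simp
qed

text \<open>After division the excess is at most -c \<open>\<epsilon>\<close>^(-q) with q =
  \<open>\<mu>\<close> - (1 - 2s) > 0. Finiteness of \<open>m1\<close> makes the difference in
  \<open>ereal\<close> one of real numbers.\<close>

lemma excess_tendsto_MInfty:
  assumes ev: "eventually (\<lambda>\<epsilon>. F1_eps s \<Omega> W \<epsilon> (v \<epsilon>) + ennreal (c * \<epsilon> powr (1 - 2 * s)) \<le> m1 s \<Omega> g) (at_right 0)"
    and m: "m1 s \<Omega> g < top" and c: "0 < c" and \<mu>: "1 - 2 * s < \<mu>"
  shows "((\<lambda>\<epsilon>. F1_excess s \<Omega> W g \<epsilon> (v \<epsilon>) / ereal (\<epsilon> powr \<mu>)) \<longlongrightarrow> -\<infinity>) (at_right 0)"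
  unfolding tendsto_MInfty
proof
  fix r :: real
  define q where "q = \<mu> - (1 - 2 * s)"
  have q: "0 < q" using \<mu> by (simp add: q_def)
  have pos: "eventually (\<lambda>\<epsilon>::real. 0 < \<epsilon>) (at_right 0)" by (simp add: eventually_at_right_less)
  have "((\<lambda>\<epsilon>::real. \<epsilon> powr q) \<longlongrightarrow> 0) (at_right 0)"
    using q pos by (intro tendsto_zero_powrI[where b=q]) (auto elim: eventually_mono intro: tendsto_ident_at)
  then have "filterlim (\<lambda>\<epsilon>::real. inverse (\<epsilon> powr q)) at_top (at_right 0)"
    by (rule filterlim_inverse_at_top) (use pos in \<open>auto elim: eventually_mono\<close>)
  then have "eventually (\<lambda>\<epsilon>. (\<bar>r\<bar> + 1) / c \<le> inverse (\<epsilon> powr q)) (at_right 0)"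
    by (simp add: filterlim_at_top)
  with ev pos show "eventually (\<lambda>\<epsilon>. F1_excess s \<Omega> W g \<epsilon> (v \<epsilon>) / ereal (\<epsilon> powr \<mu>) < ereal r) (at_right 0)"
  proof eventually_elim
    case (elim \<epsilon>)
    obtain e where e: "m1 s \<Omega> g = ennreal e" "0 \<le> e" using m by (cases "m1 s \<Omega> g") auto
    have "F1_eps s \<Omega> W \<epsilon> (v \<epsilon>) \<le> F1_eps s \<Omega> W \<epsilon> (v \<epsilon>) + ennreal (c * \<epsilon> powr (1 - 2 * s))" by simp
    also note elim(1)
    also note m
    finally obtain a where a: "F1_eps s \<Omega> W \<epsilon> (v \<epsilon>) = ennreal a" "0 \<le> a" by (cases "F1_eps s \<Omega> W \<epsilon> (v \<epsilon>)") auto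
    have "a + c * \<epsilon> powr (1 - 2 * s) \<le> e"
      using elim(1) a e c by (simp flip: ennreal_plus)
    then have "(a - e) / \<epsilon> powr \<mu> \<le> - (c * \<epsilon> powr (1 - 2 * s)) / \<epsilon> powr \<mu>"
      by (intro divide_right_mono) auto
    also have "\<dots> = - (c * inverse (\<epsilon> powr q))"
      using elim(2) by (simp add: q_def powr_diff powr_add field_simps)
    also have "\<dots> < r"
    proof -
      have "\<bar>r\<bar> + 1 \<le> c * inverse (\<epsilon> powr q)" using elim(3) c by (simp add: field_simps)
      then show ?thesis by linarith
    qed
    finally have "(a - e) / \<epsilon> powr \<mu> < r" .
    then show ?case using elim(2) a e by (simp add: F1_excess_def)
  qed
qed

lemma L1_dist_le:
  fixes u u' v :: "'a::euclidean_space \<Rightarrow> real"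
  assumes [measurable]: "\<Omega> \<in> sets borel" "u \<in> borel_measurable lebesgue" "v \<in> borel_measurable borel"
    and ae: "AE x in lebesgue. u x = u' x" and b: "(\<integral>\<^sup>+x. ennreal \<bar>v x - u' x\<bar> \<partial>lborel) \<le> ennreal B" "0 \<le> B"
  shows "0 \<le> L1_dist \<Omega> v u" "L1_dist \<Omega> v u \<le> B"
proof -
  have [measurable]: "v \<in> borel_measurable lebesgue" "\<Omega> \<in> sets lebesgue"
    by (auto intro: measurable_completion)
  show "0 \<le> L1_dist \<Omega> v u"
    unfolding L1_dist_def set_lebesgue_integral_def by (intro integral_nonneg_AE) auto
  have "(\<integral>\<^sup>+x. ennreal (indicator \<Omega> x *\<^sub>R \<bar>v x - u x\<bar>) \<partial>lebesgue) \<le> (\<integral>\<^sup>+x. ennreal \<bar>v x - u' x\<bar> \<partial>lebesgue)"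
    using ae by (intro nn_integral_mono_AE) (auto simp: indicator_def elim!: eventually_mono)
  also have "\<dots> \<le> ennreal B" using b by (simp add: nn_integral_completion)
  finally show "L1_dist \<Omega> v u \<le> B"
    unfolding L1_dist_def set_lebesgue_integral_def
    using b(2) by (subst integral_eq_nn_integral) (auto intro: enn2real_leI)
qed

text \<open>Either an interface meets \<open>\<Omega>\<close>, or every component carries a single
  phase. In the second case the selected component has phase \<open>\<sigma>\<close>, and whichever
  sign that is, some frontier point has a datum different from it.\<close>

lemma mixed_family_phase:
  fixes \<Omega> S :: "'a::euclidean_space set"
  assumes \<Omega>: "lipschitz_domain \<Omega>" "bounded \<Omega>" and g: "continuous_on UNIV g" "\<And>x. \<bar>g x\<bar> \<le> 1" and S[measurable]: "S \<in> sets borel"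
    and u: "\<And>x. x \<in> \<Omega> \<Longrightarrow> x \<in> S \<Longrightarrow> u x = 1" "\<And>x. x \<in> \<Omega> \<Longrightarrow> x \<notin> S \<Longrightarrow> u x = -1" "\<And>x. x \<notin> \<Omega> \<Longrightarrow> u x = g x"
    and um: "u \<in> borel_measurable borel"
    and cases: "(\<exists>x\<in>\<Omega>. x \<in> ess_boundary S) \<or>
       (\<exists>\<Omega>'\<in>components \<Omega>. \<not> (\<forall>x\<in>frontier \<Omega>'. g x = 1) \<and> \<not> (\<forall>x\<in>frontier \<Omega>'. g x = -1))"
  shows "mixed_family \<Omega> u"
proof (cases "\<exists>x\<in>\<Omega>. x \<in> ess_boundary S")
  case True
  have op: "open \<Omega>" using \<Omega> by (simp add: lipschitz_domain_def)
  from True obtain x where x: "x \<in> \<Omega>" "x \<in> ess_boundary S" by blast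
  obtain r where "0 < r" "ball x r \<subseteq> \<Omega>" using op x(1) openE by blast
  then show ?thesis by (intro interior_ess_boundary_mixed_family[OF x(2) _ _ S u(1,2)])
next
  case False
  have op: "open \<Omega>" using \<Omega> by (simp add: lipschitz_domain_def)
  from False cases obtain C where C: "C \<in> components \<Omega>"
    and gC: "\<exists>x\<in>frontier C. g x \<noteq> 1" "\<exists>x\<in>frontier C. g x \<noteq> -1" by blast
  have C\<Omega>: "C \<subseteq> \<Omega>" using C by (rule in_components_subset)
  have opC: "open C" "connected C" using C op open_components in_components_connected by blast+
  have "(AE x in lborel. x \<in> C \<longrightarrow> x \<in> S) \<or> (AE x in lborel. x \<in> C \<longrightarrow> x \<notin> S)"
    using False C\<Omega> by (intro pure_phase_on_component[OF opC S]) auto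
  then obtain \<sigma> p where \<sigma>: "\<sigma> = 1 \<or> \<sigma> = -1" "AE x in lborel. x \<in> C \<longrightarrow> u x = \<sigma>"
    and p: "p \<in> frontier C" "g p \<noteq> \<sigma>"
  proof
    assume "AE x in lborel. x \<in> C \<longrightarrow> x \<in> S"
    then have "AE x in lborel. x \<in> C \<longrightarrow> u x = 1" by (rule eventually_mono) (use u C\<Omega> in auto)
    then show ?thesis using gC(1) that[of 1] by blast
  next
    assume "AE x in lborel. x \<in> C \<longrightarrow> x \<notin> S"
    then have "AE x in lborel. x \<in> C \<longrightarrow> u x = -1" by (rule eventually_mono) (use u C\<Omega> in auto)
    then show ?thesis using gC(2) that[of "-1"] by blast
  qed
  have "p \<in> frontier \<Omega>" using p(1) frontier_of_components_subset[OF C] by blast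
  then obtain \<rho> e f \<Lambda> where ch: "lipschitz_chart \<Omega> p \<rho> e f \<Lambda>" using lipschitz_domain_chart[OF \<Omega>(1)] by metis
  have "p \<in> closure C" using p(1) by (simp add: frontier_def)
  then obtain r where r: "0 < r" "r \<le> \<rho>" "\<Omega> \<inter> ball p r \<subseteq> C" using chart_in_component[OF ch C] by blast
  \<comment> \<open>Half of the contrast at p, which is positive since |g p| <= 1 and g p differs
    from \<open>\<sigma>\<close>; continuity keeps the other half in a neighbourhood.\<close>
  define c where "c = (1 - \<sigma> * g p) / 2"
  have c: "0 < c" using \<sigma>(1) p(2) g(2)[of p] by (auto simp: c_def)
  have "isCont g p" using g(1) by (simp add: continuous_on_eq_continuous_at)
  then obtain d where d: "0 < d" "\<And>x. dist x p < d \<Longrightarrow> dist (g x) (g p) < c"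
    using c unfolding continuous_at_eps_delta by blast
  show ?thesis
  proof (rule boundary_mixed_family[OF ch _ _ um c])
    show "0 < min r d" "min r d \<le> \<rho>" using r d by auto
    fix y assume y: "y \<in> ball p (min r d)" "y \<notin> \<Omega>"
    then have "\<bar>g y - g p\<bar> < c" using d(2)[of y] by (simp add: dist_commute dist_real_def)
    then have "\<bar>\<sigma> * g y - \<sigma> * g p\<bar> < c" using \<sigma>(1) by auto
    moreover have "1 - \<sigma> * g p = 2 * c" by (simp add: c_def)
    ultimately show "c \<le> 1 - \<sigma> * u y" using u(3)[OF y(2)] by auto
  next
    show "AE x in lborel. x \<in> \<Omega> \<inter> ball p (min r d) \<longrightarrow> u x = \<sigma>"
      using \<sigma>(2) by (rule eventually_mono) (use r(3) in auto)
  qed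
qed

theorem theorem1p1:
  fixes \<Omega> :: "(real^'n) set" and s :: real and W :: "real \<Rightarrow> real"
    and g ubar :: "real^'n \<Rightarrow> real" and E :: "(real^'n) set"
  assumes s: "0 < s" "s < 1/2"
    and Omega: "bounded \<Omega>" "lipschitz_domain \<Omega>"
    and W: "double_well W"
    and g: "continuous_on UNIV g" "range g \<subseteq> {-1..1}"
    and m1: "m1 s \<Omega> g \<noteq> 0"
    and ubar: "ubar \<in> U1 s \<Omega> g" "is_phase \<Omega> ubar E"
    and cases:
      "(\<exists>x0 r \<alpha>. x0 \<in> ess_boundary E \<and> 0 < r \<and> closure (ball x0 r) \<subseteq> \<Omega> \<and>
          0 < \<alpha> \<and> \<alpha> < 1 \<and> C1_holder_surface \<alpha> (ess_boundary E \<inter> ball x0 r)) \<or>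
       (\<exists>\<Omega>'\<in>components \<Omega>. \<not> (\<forall>x\<in>frontier \<Omega>'. g x = 1) \<and> \<not> (\<forall>x\<in>frontier \<Omega>'. g x = -1))"
  shows "\<exists>v :: real \<Rightarrow> real^'n \<Rightarrow> real.
      (\<forall>\<epsilon>>0. v \<epsilon> \<in> X_space \<Omega> g) \<and>
      ((\<lambda>\<epsilon>. L1_dist \<Omega> (v \<epsilon>) ubar) \<longlongrightarrow> 0) (at_right 0) \<and>
      (\<forall>\<mu>>1 - 2 * s. ((\<lambda>\<epsilon>. F1_excess s \<Omega> W g \<epsilon> (v \<epsilon>) / ereal (\<epsilon> powr \<mu>)) \<longlongrightarrow> -\<infinity>) (at_right 0)) \<and>
      ((\<lambda>\<epsilon>. F2_eps s \<Omega> W g \<epsilon> (v \<epsilon>)) \<longlongrightarrow> -\<infinity>) (at_right 0)"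
proof -
  have op: "open \<Omega>" using Omega by (simp add: lipschitz_domain_def)
  then have \<Omega>m[measurable]: "\<Omega> \<in> sets borel" by auto
  have gm[measurable]: "g \<in> borel_measurable borel" using g(1) by (rule borel_measurable_continuous_onI)
  have g1: "\<bar>g x\<bar> \<le> 1" for x using g(2) by (auto simp: image_subset_iff abs_le_iff)
  have uX: "ubar \<in> X_space \<Omega> g" and F1u: "F1 s \<Omega> g ubar = m1 s \<Omega> g" using ubar(1) by (auto simp: U1_def)
  have um: "ubar \<in> borel_measurable lebesgue" and uout: "\<And>x. x \<notin> \<Omega> \<Longrightarrow> ubar x = g x"
    using uX by (auto simp: X_space_def)
  have Em: "E \<in> sets lebesgue" and uE: "AE x in lebesgue. x \<in> \<Omega> \<longrightarrow> ubar x = indicator E x - indicator (- E) x"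
    using ubar(2) by (auto simp: is_phase_def)
  obtain S N N' where SN: "E = S \<union> N" "N \<subseteq> N'" "N' \<in> null_sets lborel" "S \<in> sets lborel"
    using sets_completionE[OF Em] by metis
  have S[measurable]: "S \<in> sets borel" using SN by simp
  have ES: "AE x in lebesgue. x \<in> E \<longleftrightarrow> x \<in> S"
    by (rule AE_completion, rule AE_I'[OF SN(3)]) (use SN in auto)
  \<comment> \<open>A Borel representative of the minimizer, built from the Borel part
    \<open>S\<close> of \<open>E\<close>. It takes the values 1 and -1 everywhere in
    \<open>\<Omega>\<close>, not just almost everywhere, as the pointwise energy comparison
    needs.\<close>
  define u where "u = (\<lambda>x. if x \<in> \<Omega> then (if x \<in> S then 1 else -1) else g x)"
  have [measurable]: "u \<in> borel_measurable borel" unfolding u_def by measurable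
  have u: "\<And>x. x \<in> \<Omega> \<Longrightarrow> x \<in> S \<Longrightarrow> u x = 1" "\<And>x. x \<in> \<Omega> \<Longrightarrow> x \<notin> S \<Longrightarrow> u x = -1" "\<And>x. x \<notin> \<Omega> \<Longrightarrow> u x = g x"
    by (auto simp: u_def)
  have u1: "\<bar>u x\<bar> \<le> 1" for x using g1 by (auto simp: u_def)
  have ae: "AE x in lebesgue. ubar x = u x"
    using ES uE by eventually_elim (use uout in \<open>auto simp: u_def indicator_def\<close>)
  have Eu: "interaction s (Q_set \<Omega>) u u = m1 s \<Omega> g"
    using F1_eq_interaction[OF \<Omega>m _ gm u(3) ubar(2) ae] F1u by simp
  have fin: "m1 s \<Omega> g < top"
  proof -
    \<comment> \<open>A competitor with the single phase 1 in \<open>\<Omega>\<close>, used only to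
      bound the minimum.\<close>
    define w where "w = (\<lambda>x. if x \<in> \<Omega> then 1 else g x)"
    have [measurable]: "w \<in> borel_measurable borel" unfolding w_def by measurable
    have w1: "\<bar>w x\<bar> \<le> 1" for x using g1 by (auto simp: w_def)
    have "range w \<subseteq> {-1..1}" using w1 by (auto simp: abs_le_iff minus_le_iff)
    moreover have "w \<in> borel_measurable lebesgue" by (intro measurable_completion) simp
    ultimately have "w \<in> X_space \<Omega> g" by (simp add: X_space_def w_def)
    then have "m1 s \<Omega> g \<le> F1 s \<Omega> g w" unfolding m1_def by (rule INF_lower)
    also have "F1 s \<Omega> g w = interaction s (Q_set \<Omega>) w w"
      by (rule F1_eq_interaction[OF \<Omega>m _ gm, of _ _ UNIV]) (auto simp: w_def is_phase_def)
    also have "\<dots> < top"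
      using w1 by (intro lipschitz_domain_finite_energy[OF s Omega(2,1)]) (auto simp: w_def)
    finally show ?thesis .
  qed
  have eb: "ess_boundary E = ess_boundary S"
    using ES Em S by (intro ess_boundary_AE_cong) auto
  have "(\<exists>x\<in>\<Omega>. x \<in> ess_boundary S) \<or>
       (\<exists>\<Omega>'\<in>components \<Omega>. \<not> (\<forall>x\<in>frontier \<Omega>'. g x = 1) \<and> \<not> (\<forall>x\<in>frontier \<Omega>'. g x = -1))"
    using cases
  proof
    assume "\<exists>x0 r \<alpha>. x0 \<in> ess_boundary E \<and> 0 < r \<and> closure (ball x0 r) \<subseteq> \<Omega> \<and>
          0 < \<alpha> \<and> \<alpha> < 1 \<and> C1_holder_surface \<alpha> (ess_boundary E \<inter> ball x0 r)"
    then obtain x0 r where x0: "x0 \<in> ess_boundary S" "0 < r" "closure (ball x0 r) \<subseteq> \<Omega>" unfolding eb by blast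
    then have "x0 \<in> \<Omega>" using closure_subset[of "ball x0 r"] by (meson centre_in_ball subsetD)
    with x0 show ?thesis by blast
  qed blast
  then have "mixed_family \<Omega> u"
    by (intro mixed_family_phase[OF Omega(2,1) g(1) g1 S u]) auto
  then obtain c R \<delta>0 where mf: "0 < c" "1 \<le> R" "0 < \<delta>0" "\<And>\<delta>. 0 < \<delta> \<Longrightarrow> \<delta> < \<delta>0 \<Longrightarrow>
      \<exists>G. (\<forall>y\<in>G. ball y (2 * \<delta>) \<subseteq> \<Omega> \<and> mixed_at u c R \<delta> y) \<and>
        ennreal (c * \<delta>) \<le> emeasure lborel (\<Union>y\<in>G. ball y (2 * \<delta>))"
    unfolding mixed_family_def by blast
  have u2: "(u x)\<^sup>2 = 1" if "x \<in> \<Omega>" for x using that by (simp add: u_def)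
  obtain c' C \<epsilon>0 where c': "0 < c'" and \<epsilon>0: "0 < \<epsilon>0" and rec: "\<forall>\<epsilon>. 0 < \<epsilon> \<and> \<epsilon> < \<epsilon>0 \<longrightarrow>
      (\<exists>v\<in>borel_measurable borel. (\<forall>x. \<bar>v x\<bar> \<le> 1) \<and> (\<forall>x. x \<notin> \<Omega> \<longrightarrow> v x = u x) \<and>
        (\<integral>\<^sup>+x. ennreal \<bar>v x - u x\<bar> \<partial>lborel) \<le> ennreal (C * \<epsilon> powr (2 * s)) \<and>
        F1_eps s \<Omega> W \<epsilon> v + ennreal (c' * \<epsilon> powr (1 - 2 * s)) \<le> interaction s (Q_set \<Omega>) u u)"
    using recovery_at_scale[OF s W op Omega(1) _ u1 u2 _ mf] fin Eu by auto
  define P where "P = (\<lambda>\<epsilon> v. v \<in> borel_measurable borel \<and> (\<forall>x. \<bar>v x\<bar> \<le> 1) \<and> (\<forall>x. x \<notin> \<Omega> \<longrightarrow> v x = u x) \<and>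
        (\<integral>\<^sup>+x. ennreal \<bar>v x - u x\<bar> \<partial>lborel) \<le> ennreal (C * \<epsilon> powr (2 * s)) \<and>
        F1_eps s \<Omega> W \<epsilon> v + ennreal (c' * \<epsilon> powr (1 - 2 * s)) \<le> interaction s (Q_set \<Omega>) u u)"
  have "\<exists>v. 0 < \<epsilon> \<and> \<epsilon> < \<epsilon>0 \<longrightarrow> P \<epsilon> v" for \<epsilon>
    using rec unfolding P_def by blast
  then obtain V where V: "\<And>\<epsilon>. 0 < \<epsilon> \<Longrightarrow> \<epsilon> < \<epsilon>0 \<Longrightarrow> P \<epsilon> (V \<epsilon>)" by metis
  \<comment> \<open>The limits only see small \<open>\<epsilon>\<close>. Elsewhere
    \<open>ubar\<close> is a filler that belongs to the space.\<close>
  define v where "v = (\<lambda>\<epsilon>. if 0 < \<epsilon> \<and> \<epsilon> < \<epsilon>0 then V \<epsilon> else ubar)"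
  have near: "eventually (\<lambda>\<epsilon>. 0 < \<epsilon> \<and> \<epsilon> < \<epsilon>0) (at_right 0)"
    using \<epsilon>0 by (auto simp: eventually_at_right_field)
  have vX: "v \<epsilon> \<in> X_space \<Omega> g" for \<epsilon>
  proof (cases "0 < \<epsilon> \<and> \<epsilon> < \<epsilon>0")
    case True
    then have "P \<epsilon> (v \<epsilon>)" using V by (simp add: v_def)
    then show ?thesis using u(3) by (auto simp: P_def X_space_def abs_le_iff intro: measurable_completion)
  qed (use uX in \<open>auto simp: v_def\<close>)
  have evP: "eventually (\<lambda>\<epsilon>. P \<epsilon> (v \<epsilon>)) (at_right 0)"
    using near by eventually_elim (simp add: v_def V)
  have L1: "((\<lambda>\<epsilon>. L1_dist \<Omega> (v \<epsilon>) ubar) \<longlongrightarrow> 0) (at_right 0)"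
  proof (rule tendsto_sandwich)
    have bd: "eventually (\<lambda>\<epsilon>. 0 \<le> L1_dist \<Omega> (v \<epsilon>) ubar \<and> L1_dist \<Omega> (v \<epsilon>) ubar \<le> \<bar>C\<bar> * \<epsilon> powr (2 * s)) (at_right 0)"
      using evP
    proof eventually_elim
      case (elim \<epsilon>)
      have "ennreal (C * \<epsilon> powr (2 * s)) \<le> ennreal (\<bar>C\<bar> * \<epsilon> powr (2 * s))"
        by (intro ennreal_leI mult_right_mono) auto
      then have "(\<integral>\<^sup>+x. ennreal \<bar>v \<epsilon> x - u x\<bar> \<partial>lborel) \<le> ennreal (\<bar>C\<bar> * \<epsilon> powr (2 * s))"
        using elim unfolding P_def by (meson order_trans)
      then show ?case using L1_dist_le[OF \<Omega>m um _ ae] elim unfolding P_def by auto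
    qed
    show "eventually (\<lambda>\<epsilon>. 0 \<le> L1_dist \<Omega> (v \<epsilon>) ubar) (at_right 0)"
      "eventually (\<lambda>\<epsilon>. L1_dist \<Omega> (v \<epsilon>) ubar \<le> \<bar>C\<bar> * \<epsilon> powr (2 * s)) (at_right 0)"
      using bd by (auto elim: eventually_mono)
    have "((\<lambda>\<epsilon>::real. \<epsilon> powr (2 * s)) \<longlongrightarrow> 0) (at_right 0)"
      using s eventually_at_right_less[of "0::real"]
      by (intro tendsto_zero_powrI[where b="2 * s"]) (auto elim: eventually_mono intro: tendsto_ident_at)
    then show "((\<lambda>\<epsilon>::real. \<bar>C\<bar> * \<epsilon> powr (2 * s)) \<longlongrightarrow> 0) (at_right 0)"
      by (rule tendsto_mult_right_zero)
  qed simp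
  have "eventually (\<lambda>\<epsilon>. F1_eps s \<Omega> W \<epsilon> (v \<epsilon>) + ennreal (c' * \<epsilon> powr (1 - 2 * s)) \<le> m1 s \<Omega> g) (at_right 0)"
    using evP by eventually_elim (simp add: P_def Eu)
  then have lim: "((\<lambda>\<epsilon>. F1_excess s \<Omega> W g \<epsilon> (v \<epsilon>) / ereal (\<epsilon> powr \<mu>)) \<longlongrightarrow> -\<infinity>) (at_right 0)"
    if "1 - 2 * s < \<mu>" for \<mu>
    by (rule excess_tendsto_MInfty[OF _ fin c' that])
  \<comment> \<open>The exponent 1 exceeds 1 - 2s because s > 0, and
    \<open>\<epsilon> powr 1\<close> is \<open>\<epsilon>\<close> for positive
    \<open>\<epsilon>\<close>.\<close>
  have "((\<lambda>\<epsilon>. F1_excess s \<Omega> W g \<epsilon> (v \<epsilon>) / ereal (\<epsilon> powr 1)) \<longlongrightarrow> -\<infinity>) (at_right 0)"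
    using s by (intro lim) simp
  moreover have "eventually (\<lambda>\<epsilon>. F1_excess s \<Omega> W g \<epsilon> (v \<epsilon>) / ereal (\<epsilon> powr 1) = F2_eps s \<Omega> W g \<epsilon> (v \<epsilon>)) (at_right 0)"
    using near by eventually_elim (simp add: F2_eps_def)
  ultimately have "((\<lambda>\<epsilon>. F2_eps s \<Omega> W g \<epsilon> (v \<epsilon>)) \<longlongrightarrow> -\<infinity>) (at_right 0)"
    by (rule Lim_transform_eventually)
  with vX L1 lim show ?thesis by blast
qed

end
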